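(* Let $E$ be a symmetric space on $I$ with fundamental function $\phi$, and let $x\in E$. Then the following conditions are equivalent: (i) $x$ is an LLUKM point of $E$ and $\lim_{t\to0^+}\phi(t)x^*(t)=\lim_{s\to\infty}\phi(s)x^{**}(s)=0$. (ii) $x$ is an LKM point and a point of order continuity of $E$, and $\lim_{s\to\infty}\phi(s)x^{**}(s)=0$. (iii) $x$ is an LKM point and a point of $K$-order continuity of $E$, and $x^*(\infty)=0$.
   Context: Let $I=[0,\alpha)$ with $\alpha=1$ or $\alpha=\infty$, with Lebesgue measure $\mu$, and let $L^0$ be the set of (equivalence classes of) extended real valued measurable functions on $I$. A Banach function space $(E,\|\cdot\|_E)$ is a Banach lattice that is a sublattice of $L^0$ such that (1) $x\in L^0$, $y\in E$, $|x|\le|y|$ a.e. imply $x\in E$ and $\|x\|_E\le\|y\|_E$; (2) $E$ contains a strictly positive function. $E^+=\{x\in E:x\ge0\}$. For $x\in L^0$: $d_x(\lambda)=\mu\{s\in I:|x(s)|>\lambda\}$, $x^*(t)=\inf\{\lambda>0:d_x(\lambda)\le t\}$, $x^{**}(t)=\frac1t\int_0^t x^*(s)\,ds$; $x^*(\infty)=\lim_{t\to\infty}x^*(t)$ if $\alpha=\infty$ and $x^*(\infty)=0$ if $\alpha=1$. $E$ is symmetric if $x\in L^0$, $y\in E$, $d_x=d_y$ imply $x\in E$ and $\|x\|_E=\|y\|_E$. Its fundamental function is $\phi(t)=\|\chi_{(0,t)}\|_E$, $t\in[0,\alpha)$. Standing assumption: $E$ has the Fatou property, i.e. if $(x_n)\subset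 E^+$, $\sup_n\|x_n\|_E<\infty$ and $x_n\uparrow x\in L^0$, then $x\in E$ and $\|x_n\|_E\uparrow\|x\|_E$. For $x,y\in L^1+L^\infty$, $x\prec y$ means $x^{**}(t)\le y^{**}(t)$ for all $t>0$. The condition on the limit as $s\to\infty$ concerns the case $\alpha=\infty$; it is understood to be void if $\alpha=1$. $x\in E$ is a point of order continuity if for every $(x_n)\subset E^+$ with $x_n\le|x|$ and $x_n\to0$ a.e. we have $\|x_n\|_E\to0$. $x\in E$ is a point of $K$-order continuity if for every $(x_n)\subset E$ with $x_n\prec x$ for all $n$ and $x_n^*\to0$ a.e. we have $\|x_n\|_E\to0$. $x\in E$ is an LKM point (point of lower $K$-monotonicity) if for every $y\in E$ with $x^*\ne y^*$ and $y\prec x$ we have $\|y\|_E<\|x\|_E$. $x\in E$ is an LLUKM point (point of lower local uniform $K$-monotonicity) if for every $(x_n)\subset E$ with $x_n\prec x$ for all $n$ and $\|x_n\|_E\to\|x\|_E$ we have $\|x^*-x_n^*\|_E\to0$. *)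

theory Defs
  imports "HOL-Analysis.Analysis"
begin

(* Elements of L^0 are represented by functions real => ereal that are Lebesgue measurable on
   the interval; equivalence classes are rendered by stating all relations almost everywhere
   with respect to lebesgue_on (interval \<alpha>).  Values outside the interval are irrelevant. *)

definition interval :: "ereal \<Rightarrow> real set" where
  "interval \<alpha> = {t. 0 \<le> t \<and> ereal t < \<alpha>}"

abbreviation leb :: "ereal \<Rightarrow> real measure" where
  "leb \<alpha> \<equiv> lebesgue_on (interval \<alpha>)"

definition L0 :: "ereal \<Rightarrow> (real \<Rightarrow> ereal) set" where
  "L0 \<alpha> = borel_measurable (leb \<alpha>)"

definition distr_fun :: "ereal \<Rightarrow> (real \<Rightarrow> ereal) \<Rightarrow> real \<Rightarrow> ennreal" where
  "distr_fun \<alpha> x l = emeasure (leb \<alpha>) {s \<in> interval \<alpha>. \<bar>x s\<bar> > ereal l}"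

(* x^*; the infimum of the empty set is \<infinity>.  If \<alpha> = 1 then x^*(t) = 0 for t \<ge> 1. *)
definition rearr :: "ereal \<Rightarrow> (real \<Rightarrow> ereal) \<Rightarrow> real \<Rightarrow> ereal" where
  "rearr \<alpha> x t = Inf {ereal l | l. l > 0 \<and> distr_fun \<alpha> x l \<le> ennreal t}"

(* x^** *)
definition max_rearr :: "ereal \<Rightarrow> (real \<Rightarrow> ereal) \<Rightarrow> real \<Rightarrow> ennreal" where
  "max_rearr \<alpha> x t = (\<integral>\<^sup>+ s \<in> {0..t}. e2ennreal (rearr \<alpha> x s) \<partial>lborel) / ennreal t"

definition rearr_infty :: "ereal \<Rightarrow> (real \<Rightarrow> ereal) \<Rightarrow> ereal" where
  "rearr_infty \<alpha> x = (if \<alpha> = \<infinity> then Lim at_top (rearr \<alpha> x) else 0)"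

(* The relation x \<prec> y.  It is only used between elements of symmetric spaces, which are
   contained in L^1 + L^\<infinity>. *)
definition submaj :: "ereal \<Rightarrow> (real \<Rightarrow> ereal) \<Rightarrow> (real \<Rightarrow> ereal) \<Rightarrow> bool" where
  "submaj \<alpha> x y \<longleftrightarrow> (\<forall>t>0. max_rearr \<alpha> x t \<le> max_rearr \<alpha> y t)"

(* E is the carrier and nrm the norm, whose values outside E are irrelevant.  Elements of E are
   finite a.e., so the conventions of type ereal for \<infinity> - \<infinity> affect sums and differences
   only on null sets. *)
locale banach_function_space =
  fixes \<alpha> :: ereal
    and E :: "(real \<Rightarrow> ereal) set"
    and nrm :: "(real \<Rightarrow> ereal) \<Rightarrow> real"
  assumes subset_L0: "E \<subseteq> L0 \<alpha>"
    and finite_AE: "x \<in> E \<Longrightarrow> AE t in leb \<alpha>. \<bar>x t\<bar> \<noteq> \<infinity>"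
    and add_closed: "x \<in> E \<Longrightarrow> y \<in> E \<Longrightarrow> (\<lambda>t. x t + y t) \<in> E"
    and scale_closed: "x \<in> E \<Longrightarrow> (\<lambda>t. ereal c * x t) \<in> E"
    and max_closed: "x \<in> E \<Longrightarrow> y \<in> E \<Longrightarrow> (\<lambda>t. max (x t) (y t)) \<in> E"
    and min_closed: "x \<in> E \<Longrightarrow> y \<in> E \<Longrightarrow> (\<lambda>t. min (x t) (y t)) \<in> E"
    and norm_zero_iff: "x \<in> E \<Longrightarrow> nrm x = 0 \<longleftrightarrow> (AE t in leb \<alpha>. x t = 0)"
    and norm_triangle: "x \<in> E \<Longrightarrow> y \<in> E \<Longrightarrow> nrm (\<lambda>t. x t + y t) \<le> nrm x + nrm y"
    and norm_scale: "x \<in> E \<Longrightarrow> nrm (\<lambda>t. ereal c * x t) = \<bar>c\<bar> * nrm x"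
    and norm_complete:
      "(\<And>n. X n \<in> E) \<Longrightarrow>
       (\<And>e. e > 0 \<Longrightarrow> \<exists>K. \<forall>m\<ge>K. \<forall>n\<ge>K. nrm (\<lambda>t. X m t - X n t) < e) \<Longrightarrow>
       \<exists>x\<in>E. (\<lambda>n. nrm (\<lambda>t. X n t - x t)) \<longlonglongrightarrow> 0"
    and ideal:
      "x \<in> L0 \<alpha> \<Longrightarrow> y \<in> E \<Longrightarrow> (AE t in leb \<alpha>. \<bar>x t\<bar> \<le> \<bar>y t\<bar>) \<Longrightarrow> x \<in> E \<and> nrm x \<le> nrm y"
    and strictly_positive: "\<exists>w\<in>E. AE t in leb \<alpha>. w t > 0"

locale symmetric_space = banach_function_space +
  assumes symmetric:
    "x \<in> L0 \<alpha> \<Longrightarrow> y \<in> E \<Longrightarrow> distr_fun \<alpha> x = distr_fun \<alpha> y \<Longrightarrow> x \<in> E \<and> nrm x = nrm y"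

definition pos_cone :: "ereal \<Rightarrow> (real \<Rightarrow> ereal) set \<Rightarrow> (real \<Rightarrow> ereal) set" where
  "pos_cone \<alpha> E = {x \<in> E. AE t in leb \<alpha>. x t \<ge> 0}"

definition fatou_property ::
  "ereal \<Rightarrow> (real \<Rightarrow> ereal) set \<Rightarrow> ((real \<Rightarrow> ereal) \<Rightarrow> real) \<Rightarrow> bool" where
  "fatou_property \<alpha> E nrm \<longleftrightarrow>
    (\<forall>X x. (\<forall>n. X n \<in> pos_cone \<alpha> E) \<and> bdd_above (range (\<lambda>n. nrm (X n))) \<and> x \<in> L0 \<alpha> \<and>
       (AE t in leb \<alpha>. incseq (\<lambda>n. X n t) \<and> (\<lambda>n. X n t) \<longlonglongrightarrow> x t)
     \<longrightarrow> x \<in> E \<and> incseq (\<lambda>n. nrm (X n)) \<and> (\<lambda>n. nrm (X n)) \<longlonglongrightarrow> nrm x)"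

definition fundamental_fun :: "((real \<Rightarrow> ereal) \<Rightarrow> real) \<Rightarrow> real \<Rightarrow> real" where
  "fundamental_fun nrm t = nrm (indicator {0<..<t})"

definition order_cont_point ::
  "ereal \<Rightarrow> (real \<Rightarrow> ereal) set \<Rightarrow> ((real \<Rightarrow> ereal) \<Rightarrow> real) \<Rightarrow> (real \<Rightarrow> ereal) \<Rightarrow> bool" where
  "order_cont_point \<alpha> E nrm x \<longleftrightarrow> x \<in> E \<and>
    (\<forall>X. (\<forall>n. X n \<in> pos_cone \<alpha> E) \<and> (\<forall>n. AE t in leb \<alpha>. X n t \<le> \<bar>x t\<bar>) \<and>
         (AE t in leb \<alpha>. (\<lambda>n. X n t) \<longlonglongrightarrow> 0)
       \<longrightarrow> (\<lambda>n. nrm (X n)) \<longlonglongrightarrow> 0)"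

definition K_order_cont_point ::
  "ereal \<Rightarrow> (real \<Rightarrow> ereal) set \<Rightarrow> ((real \<Rightarrow> ereal) \<Rightarrow> real) \<Rightarrow> (real \<Rightarrow> ereal) \<Rightarrow> bool" where
  "K_order_cont_point \<alpha> E nrm x \<longleftrightarrow> x \<in> E \<and>
    (\<forall>X. (\<forall>n. X n \<in> E) \<and> (\<forall>n. submaj \<alpha> (X n) x) \<and>
         (AE t in leb \<alpha>. (\<lambda>n. rearr \<alpha> (X n) t) \<longlonglongrightarrow> 0)
       \<longrightarrow> (\<lambda>n. nrm (X n)) \<longlonglongrightarrow> 0)"

definition LKM_point ::
  "ereal \<Rightarrow> (real \<Rightarrow> ereal) set \<Rightarrow> ((real \<Rightarrow> ereal) \<Rightarrow> real) \<Rightarrow> (real \<Rightarrow> ereal) \<Rightarrow> bool" where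
  "LKM_point \<alpha> E nrm x \<longleftrightarrow> x \<in> E \<and>
    (\<forall>y\<in>E. rearr \<alpha> x \<noteq> rearr \<alpha> y \<and> submaj \<alpha> y x \<longrightarrow> nrm y < nrm x)"

definition LLUKM_point ::
  "ereal \<Rightarrow> (real \<Rightarrow> ereal) set \<Rightarrow> ((real \<Rightarrow> ereal) \<Rightarrow> real) \<Rightarrow> (real \<Rightarrow> ereal) \<Rightarrow> bool" where
  "LLUKM_point \<alpha> E nrm x \<longleftrightarrow> x \<in> E \<and>
    (\<forall>X. (\<forall>n. X n \<in> E) \<and> (\<forall>n. submaj \<alpha> (X n) x) \<and> (\<lambda>n. nrm (X n)) \<longlonglongrightarrow> nrm x
       \<longrightarrow> (\<lambda>n. nrm (\<lambda>t. rearr \<alpha> x t - rearr \<alpha> (X n) t)) \<longlonglongrightarrow> 0)"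

definition fund_vanishes_at_zero ::
  "ereal \<Rightarrow> ((real \<Rightarrow> ereal) \<Rightarrow> real) \<Rightarrow> (real \<Rightarrow> ereal) \<Rightarrow> bool" where
  "fund_vanishes_at_zero \<alpha> nrm x \<longleftrightarrow>
    ((\<lambda>t. ereal (fundamental_fun nrm t) * rearr \<alpha> x t) \<longlongrightarrow> 0) (at_right 0)"

(* Void unless \<alpha> = \<infinity>. *)
definition fund_vanishes_at_infty ::
  "ereal \<Rightarrow> ((real \<Rightarrow> ereal) \<Rightarrow> real) \<Rightarrow> (real \<Rightarrow> ereal) \<Rightarrow> bool" where
  "fund_vanishes_at_infty \<alpha> nrm x \<longleftrightarrow>
    (\<alpha> = \<infinity> \<longrightarrow> ((\<lambda>s. ennreal (fundamental_fun nrm s) * max_rearr \<alpha> x s) \<longlongrightarrow> 0) at_top)"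

end

(* The Fatou property makes the norm monotone for submajorization: dyadic lower step functions
   reduce this to the Hardy-Littlewood-Polya theorem for vectors and the invariance of the norm
   under permutations of equal cells.

   (i) => (ii): by the Fatou property the truncations of x^* at height n and abscissa n have norms
   tending to the norm of x, so lower local uniform K-monotonicity makes the truncation errors W_n
   tend to 0 in norm.  If 0 <= x_k <= |x| and x_k -> 0, then x_k^* is dominated by
   W_n + n chi_(0,d) + x_k^*(d) chi_(0,n+1); here phi(0+) = 0 unless x = 0, by the condition at 0.

   (ii) => (iii): for x_n submajorized by x, the head x_n^* chi_(0,d) is submajorized by
   x^* chi_(0,d), and min(x_n^*, x_n^*(T)) by x^**(T) chi_(0,T) + x^* chi_[T,oo).  Both have small
   norm, and between d and T the function x_n^* is at most x_n^*(d), which tends to 0.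

   (iii) => (i): by Helly, a subsequence of x_n^* converges a.e. to a decreasing y, and y is
   submajorized by x.  As |x_n^* - y| / 2 is submajorized by x and its rearrangement tends to 0,
   K-order continuity gives x_n^* -> y in norm.  Hence y and x have the same norm, and y = x^*
   because x is an LKM point.  The two limits follow from K-order continuity applied to
   x^* chi_(0,1/n) and x^**(s) chi_(0,s). *)

theory Submission
  imports Defs "HOL-Probability.Helly_Selection"
begin

text \<open>Submajorization bounds integrals over initial segments, not values: if y is submajorized
  by x, then y^* need not lie below x^*, only below x^**. This is why the condition at infinity
  concerns x^**, and why finite measure of level sets is drawn from x^** and not from x^* when a
  sequence submajorized by x is studied. The norm comparison is moreover available only for
  decreasing functions, so a piece cut out of a rearrangement has to be reshaped into a decreasing
  one before it can be estimated; head segments are decreasing as they stand, tails are capped.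
  Order continuity has a different defect: it speaks of functions below |x|, whereas all estimates
  concern x^*. Equimeasurability of the cut versions of |x| and x^* bridges this gap. The work is
  done with real-valued functions on the whole line, because x^* is finite at every positive point
  of the interval while x^*(0) may be infinite.\<close>

text \<open>
  The Hardy--Littlewood--Polya argument: as long as \<open>a\<close> exceeds \<open>b\<close> somewhere, a convex combination of
  \<open>b\<close> and a transposition of \<open>b\<close> makes one more entry agree with \<open>a\<close> and keeps the partial sums above
  those of \<open>a\<close>. The sequence \<open>b\<close> need not be decreasing.
\<close>

lemma majorization_induct:
  fixes a b :: "nat \<Rightarrow> real"
  assumes mono: "\<And>u v. (\<And>i. i < n \<Longrightarrow> 0 \<le> u i \<and> u i \<le> v i) \<Longrightarrow> p u \<le> (p v :: real)"
    and transfer: "\<And>v i j l. (\<And>k. k < n \<Longrightarrow> 0 \<le> v k) \<Longrightarrow> i < n \<Longrightarrow> j < n \<Longrightarrow> 0 \<le> l \<Longrightarrow> l \<le> 1 \<Longrightarrow>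
           p (\<lambda>k. (1 - l) * v k + l * v (Transposition.transpose i j k)) \<le> p v"
    and a0: "\<And>i. i < n \<Longrightarrow> 0 \<le> a i"
    and b0: "\<And>i. i < n \<Longrightarrow> 0 \<le> b i"
    and dec: "\<And>i j. i \<le> j \<Longrightarrow> j < n \<Longrightarrow> a j \<le> a i"
    and maj: "\<And>k. k \<le> n \<Longrightarrow> (\<Sum>i<k. a i) \<le> (\<Sum>i<k. b i)"
  shows "p a \<le> p b"
  using b0 maj
proof (induction "card {k. k < n \<and> a k \<noteq> b k}" arbitrary: b rule: less_induct)
  case less
  show ?case
  proof (cases "\<forall>k<n. a k \<le> b k")
    case True
    then show ?thesis using a0 by (intro mono) auto
  next
    case False
    then have ex: "\<exists>k. k < n \<and> b k < a k" by force
    define j where "j = (LEAST k. k < n \<and> b k < a k)"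
    have j: "j < n" "b j < a j"
      using LeastI_ex[OF ex] by (auto simp: j_def)
    have jmin: "a k \<le> b k" if "k < j" for k
      using not_less_Least[of k "\<lambda>k. k < n \<and> b k < a k"] that j(1) by (auto simp: j_def)
    \<comment> \<open>Without a surplus before \<open>j\<close> both sequences would agree there,
      and the deficit at \<open>j\<close> would break the inequality for the first
      \<open>j + 1\<close> entries.\<close>
    have exi: "\<exists>i<j. a i < b i"
    proof (rule ccontr)
      assume "\<not> ?thesis"
      then have "a i = b i" if "i < j" for i using jmin[OF that] that by force
      then have "(\<Sum>i<j. a i) = (\<Sum>i<j. b i)" by simp
      then show False using less.prems(2)[of "Suc j"] j by simp
    qed
    define i where "i = Max {i. i < j \<and> a i < b i}"
    have i: "i < j" "a i < b i"
      using Max_in[of "{i. i < j \<and> a i < b i}"] exi by (auto simp: i_def)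
    have imax: "a k = b k" if "i < k" "k < j" for k
    proof (rule ccontr)
      assume "a k \<noteq> b k"
      then have "k \<in> {i. i < j \<and> a i < b i}" using jmin[OF that(2)] that by auto
      then have "k \<le> i" unfolding i_def by (intro Max_ge) auto
      then show False using that by simp
    qed
    \<comment> \<open>\<open>d\<close> is the largest transfer from \<open>i\<close> to
      \<open>j\<close> that overshoots neither target, and \<open>l\<close> makes the mixture with
      the transposed sequence move exactly this amount. Since \<open>a j \<le> a i\<close>, the
      entry \<open>b i\<close> exceeds \<open>b j\<close> by at least \<open>d\<close>.\<close>
    define d where "d = min (b i - a i) (a j - b j)"
    define l where "l = d / (b i - b j)"
    have aij: "a j \<le> a i" using dec i j by simp
    have d: "0 < d" "d \<le> b i - b j" using i j aij by (auto simp: d_def)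
    have l: "0 \<le> l" "l \<le> 1" using d by (auto simp: l_def divide_simps)
    have ld: "l * (b i - b j) = d" using d by (simp add: l_def)
    define b' where "b' = (\<lambda>k. (1 - l) * b k + l * b (Transposition.transpose i j k))"
    have b'i: "b' i = b i - d" using ld by (simp add: b'_def algebra_simps)
    have b'j: "b' j = b j + d" using ld by (simp add: b'_def algebra_simps)
    have b'k: "b' k = b k" if "k \<noteq> i" "k \<noteq> j" for k
      using that by (simp add: b'_def Transposition.transpose_def algebra_simps)
    have p': "p b' \<le> p b"
      unfolding b'_def using i j l less.prems(1) by (intro transfer) auto
    have b'pos: "0 \<le> b' k" if "k < n" for k
      using b'k[of k] b'i b'j less.prems(1)[OF that] d i a0[of i] j less.prems(1)[of j]
      by (cases "k = i"; cases "k = j") (auto simp: d_def)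
    have partial: "(\<Sum>m<k. a m) \<le> (\<Sum>m<k. b' m)" if "k \<le> n" for k
    proof -
      have eq: "(\<Sum>m<k. b' m) = (\<Sum>m<k. b m) - (if i < k then d else 0) + (if j < k then d else 0)"
      proof -
        have "b' m = b m - (if m = i then d else 0) + (if m = j then d else 0)" for m
          using b'k[of m] b'i b'j i by auto
        then have "(\<Sum>m<k. b' m) = (\<Sum>m<k. b m - (if m = i then d else 0) + (if m = j then d else 0))"
          by simp
        also have "\<dots> = (\<Sum>m<k. b m) - (if i < k then d else 0) + (if j < k then d else 0)"
          by (simp add: sum.distrib sum_subtractf sum.delta)
        finally show ?thesis .
      qed
      show ?thesis
      proof (cases "i < k \<and> k \<le> j")
        case True
        \<comment> \<open>This prefix contains \<open>i\<close> but not \<open>j\<close> and so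
          loses \<open>d\<close>; the surplus at \<open>i\<close> alone pays for it, as no entry
          before \<open>j\<close> is in deficit.\<close>
        have "(\<Sum>m<k. b m - a m) \<ge> (\<Sum>m\<in>{i}. b m - a m)"
        proof (rule sum_mono2)
          fix m assume "m \<in> {..<k} - {i}"
          then show "0 \<le> b m - a m" using jmin[of m] True by auto
        qed (use True in auto)
        then show ?thesis using eq True by (simp add: d_def sum_subtractf)
      next
        case False
        then show ?thesis using eq less.prems(2)[OF that] d(1) i by auto
      qed
    qed
    have sub: "{k. k < n \<and> a k \<noteq> b' k} \<subset> {k. k < n \<and> a k \<noteq> b k}"
    proof -
      \<comment> \<open>The minimum in \<open>d\<close> is attained by one of the two gaps, which
        closes. Both were open before, so the set of disagreements shrinks strictly.\<close>
      have "a i = b' i \<or> a j = b' j" using b'i b'j by (auto simp: d_def min_def)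
      moreover have "{k. k < n \<and> a k \<noteq> b' k} \<subseteq> {k. k < n \<and> a k \<noteq> b k}"
        using b'k i j by (auto) (metis less_irrefl)
      ultimately show ?thesis using i j by (auto simp: psubset_eq)
    qed
    have "p a \<le> p b'"
      by (rule less.hyps) (use sub b'pos partial in \<open>auto intro!: psubset_card_mono\<close>)
    then show ?thesis using p' by simp
  qed
qed

text \<open>The partial sums of the decreasing \<open>b\<close> are concave in the index and those
  of the block-constant sequence are linear on each block, so the block ends decide. Inside block
  \<open>k\<close> the gap does not shrink up to \<open>j\<close> if \<open>c k \<le> b j\<close>;
  otherwise it shrinks from \<open>j\<close> to the right end, where it is still
  nonnegative.\<close>

lemma block_partial_sums_le:
  fixes b :: "nat \<Rightarrow> real"
  assumes dec: "\<And>i j. i \<le> j \<Longrightarrow> j < n * q \<Longrightarrow> b j \<le> b i"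
    and blocks: "\<And>k. k \<le> n \<Longrightarrow> (\<Sum>i<k*q. c (i div q)) \<le> (\<Sum>i<k*q. b i)"
    and j: "j \<le> n * q" and q: "0 < q"
  shows "(\<Sum>i<j. c (i div q)) \<le> (\<Sum>i<j. b i)"
proof (cases "j = n * q")
  case True
  then show ?thesis using blocks[of n] by simp
next
  case False
  define k where "k = j div q"
  have k: "k * q \<le> j" "j < (k+1) * q" "k < n"
    using q False j by (auto simp: k_def dividend_less_div_times less_mult_imp_div_less)
  have kn: "(k+1)*q \<le> n*q" using k(3) by (intro mult_le_mono1) simp
  have div: "i div q = k" if "k*q \<le> i" "i < (k+1)*q" for i
    using that q by (intro div_nat_eqI) (auto simp: algebra_simps)
  have split: "(\<Sum>i<v. b i - c (i div q)) = (\<Sum>i<u. b i - c (i div q)) + (\<Sum>i\<in>{u..<v}. b i - c (i div q))"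
    if "u \<le> v" for u v
    using that by (simp add: lessThan_atLeast0 sum.atLeastLessThan_concat)
  show ?thesis
  proof (cases "c k \<le> b j")
    case True
    have "0 \<le> (\<Sum>i\<in>{k*q..<j}. b i - c (i div q))"
    proof (rule sum_nonneg)
      fix i assume i: "i \<in> {k*q..<j}"
      then have "b j \<le> b i" using dec k kn by auto
      then show "0 \<le> b i - c (i div q)" using i k div[of i] True by auto
    qed
    moreover have "0 \<le> (\<Sum>i<k*q. b i - c (i div q))"
      using blocks[of k] k by (simp add: sum_subtractf)
    ultimately have "0 \<le> (\<Sum>i<j. b i - c (i div q))" using split[OF k(1)] by simp
    then show ?thesis by (simp add: sum_subtractf)
  next
    case False
    have "(\<Sum>i\<in>{j..<(k+1)*q}. b i - c (i div q)) \<le> 0"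
    proof (rule sum_nonpos)
      fix i assume i: "i \<in> {j..<(k+1)*q}"
      then have "b i \<le> b j" using dec k kn by auto
      then show "b i - c (i div q) \<le> 0" using i k div[of i] False by auto
    qed
    moreover have "0 \<le> (\<Sum>i<(k+1)*q. b i - c (i div q))"
      using blocks[of "k+1"] k by (simp add: sum_subtractf)
    ultimately have "0 \<le> (\<Sum>i<j. b i - c (i div q))" using split[of j "(k+1)*q"] k(2) by simp
    then show ?thesis by (simp add: sum_subtractf)
  qed
qed

section \<open>Decreasing functions and rearrangements\<close>

text \<open>Models a decreasing rearrangement by a real function on the whole line. The value at 0
  is set to 0 because x^*(0) may be infinite, and vanishing beyond \<alpha> lets integrals over the
  line replace those over the interval.\<close>

definition decr :: "ereal \<Rightarrow> (real \<Rightarrow> real) \<Rightarrow> bool" where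
  "decr \<alpha> f \<longleftrightarrow> (\<forall>t. 0 \<le> f t) \<and> (\<forall>t\<le>0. f t = 0) \<and> (\<forall>s t. 0 < s \<longrightarrow> s \<le> t \<longrightarrow> f t \<le> f s) \<and>
     (\<forall>t. \<alpha> \<le> ereal t \<longrightarrow> f t = 0)"

text \<open>This is t x^**(t) when \<open>f\<close> is x^*. Values in \<open>ennreal\<close> permit
  comparisons before local integrability is known.\<close>

definition cumul :: "(real \<Rightarrow> real) \<Rightarrow> real \<Rightarrow> ennreal" where
  "cumul f t = (\<integral>\<^sup>+s. ennreal (f s) * indicator {0..t} s \<partial>lborel)"

definition real_rearr :: "ereal \<Rightarrow> (real \<Rightarrow> ereal) \<Rightarrow> real \<Rightarrow> real" where
  "real_rearr \<alpha> x t = (if 0 < t then real_of_ereal (rearr \<alpha> x t) else 0)"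

lemma decrD:
  assumes "decr \<alpha> f"
  shows "0 \<le> f t" "t \<le> 0 \<Longrightarrow> f t = 0" "0 < s \<Longrightarrow> s \<le> t \<Longrightarrow> f t \<le> f s" "\<alpha> \<le> ereal t \<Longrightarrow> f t = 0"
  using assms by (auto simp: decr_def)

text \<open>The jump at 0 spoils monotonicity on the line, but the superlevel sets for nonnegative
  levels remain intervals.\<close>

lemma decr_measurable:
  assumes "decr \<alpha> f" shows "f \<in> borel_measurable borel"
proof (rule borel_measurableI_greater)
  fix a
  have "is_interval {w. a < f w}" if "0 \<le> a"
    unfolding is_interval_1
  proof (intro ballI allI impI; clarsimp)
    fix p r q assume pr: "a < f p" "a < f r" "p \<le> q" "q \<le> r"
    have "0 < p" using pr(1) that decrD(2)[OF assms, of p] by force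
    then have "f r \<le> f q" using decrD(3)[OF assms, of q r] pr by auto
    then show "a < f q" using pr by simp
  qed
  moreover have "{w. a < f w} = UNIV" if "\<not> 0 \<le> a"
    using that decrD(1)[OF assms] by (auto simp: not_le intro: less_le_trans)
  ultimately show "{w \<in> space borel. a < f w} \<in> sets borel"
    by (cases "0 \<le> a") (auto intro: real_interval_borel_measurable)
qed

lemma decr_AE_isCont:
  assumes "decr \<alpha> f" shows "AE t in lborel. 0 < t \<longrightarrow> isCont f t"
proof -
  have "mono_on {0<..} (\<lambda>t. - f t)"
    using decrD(3)[OF assms] by (auto simp: mono_on_def)
  then have "countable {a\<in>{0<..}. \<not> isCont (\<lambda>t. - f t) a}"
    by (intro mono_on_ctble_discont_open) auto
  moreover have "isCont (\<lambda>t. - f t) a = isCont f a" for a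
    using continuous_minus[of "at a" f] continuous_minus[of "at a" "\<lambda>t. - f t"] by auto
  ultimately have "countable {a\<in>{0<..}. \<not> isCont f a}" by simp
  from AE_not_in[OF countable_imp_null_set_lborel[OF this]] show ?thesis by eventually_elim auto
qed

section \<open>Distribution functions and rearrangements on the interval\<close>

lemma interval_borel [measurable, simp]: "interval \<alpha> \<in> sets borel"
  unfolding interval_def by measurable

lemma interval_lebesgue [simp]: "interval \<alpha> \<in> sets lebesgue"
  using interval_borel[of \<alpha>] by (metis sets_completionI_sets sets_lborel)

lemma space_leb [simp]: "space (leb \<alpha>) = interval \<alpha>"
  by (simp add: space_restrict_space)

lemma AE_leb_iff: "(AE t in leb \<alpha>. Q t) \<longleftrightarrow> (AE t in lebesgue. t \<in> interval \<alpha> \<longrightarrow> Q t)"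
  by (subst AE_restrict_space_iff) auto

lemma AE_leb_lborel:
  assumes "AE t in lborel. t \<in> interval \<alpha> \<longrightarrow> Q t"
  shows "AE t in leb \<alpha>. Q t"
  unfolding AE_leb_iff using AE_completion[OF assms] .

lemma AE_leb_pos: "AE t in leb \<alpha>. 0 < t \<and> ereal t < \<alpha>"
  using AE_lborel_singleton[of 0] by (intro AE_leb_lborel) (auto simp: interval_def)

lemma AE_lebI: "(\<And>t. 0 < t \<Longrightarrow> ereal t < \<alpha> \<Longrightarrow> Q t) \<Longrightarrow> AE t in leb \<alpha>. Q t"
  using AE_leb_pos by eventually_elim auto

lemma borel_imp_L0:
  assumes "f \<in> borel_measurable borel" shows "f \<in> L0 \<alpha>"
  unfolding L0_def using assms
  by (intro measurable_restrict_space1 measurable_completion) auto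

lemma emeasure_leb:
  assumes "A \<in> sets borel" "A \<subseteq> interval \<alpha>" shows "emeasure (leb \<alpha>) A = emeasure lborel A"
  using assms by (subst emeasure_restrict_space) (auto simp: emeasure_completion main_part_sets)

lemma distr_set_measurable:
  assumes "x \<in> L0 \<alpha>" shows "{s \<in> interval \<alpha>. \<bar>x s\<bar> > ereal l} \<in> sets (leb \<alpha>)"
proof -
  have [measurable]: "x \<in> borel_measurable (leb \<alpha>)" using assms by (simp add: L0_def)
  have "{s \<in> space (leb \<alpha>). \<bar>x s\<bar> > ereal l} \<in> sets (leb \<alpha>)" by measurable
  then show ?thesis by simp
qed

lemma distr_fun_mono:
  assumes "y \<in> L0 \<alpha>" "AE s in leb \<alpha>. \<bar>x s\<bar> \<le> \<bar>y s\<bar>"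
  shows "distr_fun \<alpha> x l \<le> distr_fun \<alpha> y l"
  unfolding distr_fun_def
proof (rule emeasure_mono_AE)
  show "AE s in leb \<alpha>. s \<in> {s \<in> interval \<alpha>. ereal l < \<bar>x s\<bar>} \<longrightarrow> s \<in> {s \<in> interval \<alpha>. ereal l < \<bar>y s\<bar>}"
    using assms(2) by eventually_elim auto
qed (use distr_set_measurable assms in auto)

lemma distr_fun_cong_AE:
  assumes "y \<in> L0 \<alpha>" "x \<in> L0 \<alpha>" "AE s in leb \<alpha>. \<bar>x s\<bar> = \<bar>y s\<bar>"
  shows "distr_fun \<alpha> x = distr_fun \<alpha> y"
proof
  fix l
  have "AE s in leb \<alpha>. \<bar>x s\<bar> \<le> \<bar>y s\<bar>" "AE s in leb \<alpha>. \<bar>y s\<bar> \<le> \<bar>x s\<bar>"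
    using assms(3) by (eventually_elim; simp)+
  then show "distr_fun \<alpha> x l = distr_fun \<alpha> y l"
    using assms by (intro antisym distr_fun_mono) auto
qed

lemma distr_fun_antimono:
  assumes "x \<in> L0 \<alpha>" "l \<le> m" shows "distr_fun \<alpha> x m \<le> distr_fun \<alpha> x l"
  unfolding distr_fun_def using assms distr_set_measurable[OF assms(1)]
  by (intro emeasure_mono) (auto intro: le_less_trans[of "ereal l" "ereal m"])

text \<open>Right continuity of the distribution function: the level sets increase as the level
  falls to \<open>l\<close>. A strict inequality at \<open>l\<close> thereby survives at a slightly
  higher level.\<close>

lemma distr_fun_eq_SUP:
  assumes "x \<in> L0 \<alpha>"
  shows "distr_fun \<alpha> x l = (SUP n. distr_fun \<alpha> x (l + 1 / real (Suc n)))"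
proof -
  let ?A = "\<lambda>n. {s \<in> interval \<alpha>. ereal (l + 1 / real (Suc n)) < \<bar>x s\<bar>}"
  have "(SUP n. emeasure (leb \<alpha>) (?A n)) = emeasure (leb \<alpha>) (\<Union>n. ?A n)"
  proof (rule SUP_emeasure_incseq)
    show "incseq ?A"
    proof (rule incseq_SucI, safe)
      fix n s assume "ereal (l + 1 / real (Suc n)) < \<bar>x s\<bar>"
      moreover have "ereal (l + 1 / real (Suc (Suc n))) \<le> ereal (l + 1 / real (Suc n))"
        by (simp add: frac_le)
      ultimately show "ereal (l + 1 / real (Suc (Suc n))) < \<bar>x s\<bar>" by (rule order.strict_trans1[rotated])
    qed
  qed (use distr_set_measurable[OF assms] in auto)
  also have "(\<Union>n. ?A n) = {s \<in> interval \<alpha>. ereal l < \<bar>x s\<bar>}"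
  proof safe
    fix n s assume "ereal (l + 1 / real (Suc n)) < \<bar>x s\<bar>"
    moreover have "ereal l < ereal (l + 1 / real (Suc n))" by simp
    ultimately show "ereal l < \<bar>x s\<bar>" by (rule less_trans[rotated])
  next
    fix s assume s: "s \<in> interval \<alpha>" "ereal l < \<bar>x s\<bar>"
    then obtain m where m: "ereal l < ereal m" "ereal m < \<bar>x s\<bar>" using ereal_dense2 by blast
    then obtain n where "inverse (real (Suc n)) < m - l" using reals_Archimedean[of "m - l"] by auto
    then have "ereal (l + 1 / real (Suc n)) < ereal m" by (simp add: inverse_eq_divide)
    then show "s \<in> (\<Union>n. ?A n)" using m(2) s(1) less_trans by blast
  qed
  finally show ?thesis by (simp add: distr_fun_def)
qed

lemma le_erealI:
  assumes "\<And>m. l < m \<Longrightarrow> z \<le> ereal m" shows "z \<le> ereal l"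
proof (rule dense_ge)
  fix y assume "ereal l < y"
  then show "z \<le> y" using assms by (cases y) auto
qed

text \<open>x^* is the generalized inverse of the distribution function. By right continuity
  \<open>ennreal t < distr_fun \<alpha> x l\<close> persists at some level above \<open>l\<close>,
  which then bounds the infimum from below. The level \<open>l\<close> is nonnegative because the
  infimum runs over positive levels only.\<close>

lemma rearr_gt_iff:
  assumes x: "x \<in> L0 \<alpha>" and l: "0 \<le> l"
  shows "ereal l < rearr \<alpha> x t \<longleftrightarrow> ennreal t < distr_fun \<alpha> x l"
proof
  assume *: "ereal l < rearr \<alpha> x t"
  show "ennreal t < distr_fun \<alpha> x l"
  proof (rule ccontr)
    assume "\<not> ?thesis"
    then have le: "distr_fun \<alpha> x l \<le> ennreal t" by simp
    have "rearr \<alpha> x t \<le> ereal m" if "l < m" for m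
      unfolding rearr_def
      using that l order_trans[OF distr_fun_antimono[OF x, of l m] le] by (intro Inf_lower) auto
    then have "rearr \<alpha> x t \<le> ereal l" by (rule le_erealI)
    then show False using * by simp
  qed
next
  assume "ennreal t < distr_fun \<alpha> x l"
  then obtain n where n: "ennreal t < distr_fun \<alpha> x (l + 1 / real (Suc n))"
    unfolding distr_fun_eq_SUP[OF x, of l] less_SUP_iff by auto
  have "ereal (l + 1 / real (Suc n)) \<le> rearr \<alpha> x t"
    unfolding rearr_def
  proof (intro Inf_greatest, safe)
    fix m assume m: "distr_fun \<alpha> x m \<le> ennreal t" 
    show "ereal (l + 1 / real (Suc n)) \<le> ereal m"
      using distr_fun_antimono[OF x, of m "l + 1 / real (Suc n)"] n m
      by (metis ereal_less_eq(3) leD le_cases order_trans)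
  qed
  moreover have "ereal l < ereal (l + 1 / real (Suc n))" by simp
  ultimately show "ereal l < rearr \<alpha> x t" by (rule order.strict_trans2[rotated])
qed

lemma rearr_nonneg: "0 \<le> rearr \<alpha> x t"
  unfolding rearr_def by (intro Inf_greatest) auto

lemma rearr_antimono: "s \<le> t \<Longrightarrow> rearr \<alpha> x t \<le> rearr \<alpha> x s"
  unfolding rearr_def by (intro Inf_superset_mono) (auto intro: order_trans[OF _ ennreal_leI])

lemma rearr_measurable:
  assumes "x \<in> L0 \<alpha>" shows "rearr \<alpha> x \<in> borel_measurable borel"
  unfolding borel_measurable_ereal_iff_Ioi
proof
  fix a
  have [simp]: "\<not> \<infinity> < a" for a :: ereal by simp
  have "rearr \<alpha> x -` {a<..} \<in> sets borel"
  proof (cases "0 \<le> a \<and> a \<noteq> \<infinity>")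
    case True
    then obtain l where l: "a = ereal l" "0 \<le> l" by (cases a) auto
    have "{t. ennreal t < distr_fun \<alpha> x l} \<in> sets borel" by measurable
    then show ?thesis using rearr_gt_iff[OF assms l(2)] by (simp add: l vimage_def)
  next
    case False
    then consider "a = \<infinity>" | "a < 0" by force
    then show ?thesis
    proof cases
      case 2
      then have "rearr \<alpha> x -` {a<..} = UNIV" using rearr_nonneg[of \<alpha> x] by (auto intro: less_le_trans)
      then show ?thesis by simp
    qed (auto simp: vimage_def)
  qed
  then show "rearr \<alpha> x -` {a<..} \<inter> space borel \<in> sets borel" by simp
qed

lemma emeasure_lborel_Ici: "emeasure lborel {0::real..} = top"
proof (rule ccontr)
  assume "\<not> ?thesis"
  then obtain n where n: "emeasure lborel {0::real..} < of_nat n"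
    using ennreal_Ex_less_of_nat by (auto simp: less_top)
  have "of_nat n = emeasure lborel {0..real n}" by (simp add: ennreal_of_nat_eq_real_of_nat)
  also have "\<dots> \<le> emeasure lborel {0::real..}" by (intro emeasure_mono) auto
  finally show False using n by simp
qed

lemma emeasure_interval:
  assumes "0 \<le> \<alpha>" shows "emeasure (leb \<alpha>) (interval \<alpha>) = e2ennreal \<alpha>"
proof (cases \<alpha>)
  case (real r)
  then have "interval \<alpha> = {0..<r}" by (auto simp: interval_def)
  then show ?thesis using assms real emeasure_leb[of "interval \<alpha>" \<alpha>] by simp
next
  case PInf
  then have "interval \<alpha> = {0..}" by (auto simp: interval_def)
  then show ?thesis using PInf emeasure_leb[of "interval \<alpha>" \<alpha>] by (simp add: emeasure_lborel_Ici)
qed (use assms in auto)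

text \<open>By \<open>rearr_gt_iff\<close> the level set of x^* is an initial segment of length
  \<open>distr_fun \<alpha> x l\<close>. It fits into the interval because this length is the
  measure of a subset of the interval.\<close>

lemma distr_fun_rearr:
  assumes x: "x \<in> L0 \<alpha>" and "0 \<le> \<alpha>"
  shows "distr_fun \<alpha> (rearr \<alpha> x) = distr_fun \<alpha> x"
proof
  fix l
  let ?d = "distr_fun \<alpha> x l"
  show "distr_fun \<alpha> (rearr \<alpha> x) l = ?d"
  proof (cases "0 \<le> l")
    case True
    have "?d \<le> emeasure (leb \<alpha>) (interval \<alpha>)"
      unfolding distr_fun_def by (intro emeasure_mono) (auto simp: sets_restrict_space_iff)
    then have d: "?d \<le> e2ennreal \<alpha>" using emeasure_interval[OF assms(2)] by simp
    have "distr_fun \<alpha> (rearr \<alpha> x) l = emeasure (leb \<alpha>) {s \<in> interval \<alpha>. ennreal s < ?d}"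
      using rearr_gt_iff[OF x True] rearr_nonneg[of \<alpha> x] by (simp add: distr_fun_def abs_of_nonneg)
    also have "\<dots> = emeasure lborel {s \<in> interval \<alpha>. ennreal s < ?d}"
    proof (rule emeasure_leb)
      have "{s. s \<in> interval \<alpha> \<and> ennreal s < ?d} \<in> sets borel" by measurable
      then show "{s \<in> interval \<alpha>. ennreal s < ?d} \<in> sets borel" .
    qed auto
    also have "\<dots> = ?d"
    proof (cases ?d)
      case (real r)
      have "ereal r \<le> \<alpha>" 
      proof (cases \<alpha>)
        case (real q)
        then show ?thesis using d \<open>?d = ennreal r\<close> \<open>0 \<le> r\<close> assms(2) by (simp add: e2ennreal_ereal)
      qed (use assms in auto)
      then have "{s \<in> interval \<alpha>. ennreal s < ?d} = {0..<r}"
        using real by (auto simp: interval_def ennreal_less_iff intro: less_le_trans[of _ "ereal r"])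
      then show ?thesis using real by simp
    next
      case top
      then have "\<alpha> = \<infinity>" using d assms(2) by (cases \<alpha>) (auto simp: e2ennreal_ereal top_unique)
      then have "{s \<in> interval \<alpha>. ennreal s < ?d} = {0..}"
        using top by (auto simp: interval_def)
      then show ?thesis using top by (simp only: emeasure_lborel_Ici)
    qed
    finally show ?thesis .
  next
    case False
    \<comment> \<open>At a negative level both level sets are the whole interval.\<close>
    then have "ereal l < \<bar>z\<bar>" for z :: ereal by (cases z) auto
    then show ?thesis by (simp add: distr_fun_def)
  qed
qed

lemma rearr_cong_distr: "distr_fun \<alpha> x = distr_fun \<alpha> y \<Longrightarrow> rearr \<alpha> x = rearr \<alpha> y"
  by (auto simp: rearr_def)

lemma rearr_mono:
  assumes "y \<in> L0 \<alpha>" "AE s in leb \<alpha>. \<bar>x s\<bar> \<le> \<bar>y s\<bar>"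
  shows "rearr \<alpha> x t \<le> rearr \<alpha> y t"
  unfolding rearr_def using distr_fun_mono[OF assms]
  by (intro Inf_superset_mono) (auto intro: order_trans)

lemma rearr_beyond:
  assumes "0 \<le> \<alpha>" "\<alpha> \<le> ereal t" shows "rearr \<alpha> x t = 0"
proof -
  have "distr_fun \<alpha> x l \<le> ennreal t" for l
  proof -
    have "distr_fun \<alpha> x l \<le> emeasure (leb \<alpha>) (interval \<alpha>)"
      unfolding distr_fun_def by (intro emeasure_mono) (auto simp: sets_restrict_space_iff)
    also have "\<dots> \<le> ennreal t" unfolding emeasure_interval[OF assms(1)]
      using assms by (cases \<alpha>) (auto simp: e2ennreal_ereal ennreal_leI)
    finally show ?thesis .
  qed
  then have "rearr \<alpha> x t \<le> ereal e" if "0 < e" for e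
    unfolding rearr_def using that by (intro Inf_lower) auto
  then have "rearr \<alpha> x t \<le> ereal 0" by (rule le_erealI)
  then show ?thesis using rearr_nonneg[of \<alpha> x t] by (simp add: zero_ereal_def)
qed

text \<open>At a jump \<open>f\<close> may take any value between its one-sided limits while the
  rearrangement is right-continuous, so agreement can hold only almost everywhere. At a continuity
  point \<open>t\<close> the set where \<open>f\<close> exceeds \<open>f t\<close> lies in [0,t),
  and a level below \<open>f t\<close> is still exceeded slightly to the right of \<open>t\<close>,
  hence on a set of measure larger than \<open>t\<close>.\<close>

lemma rearr_decr_AE:
  assumes f: "decr \<alpha> f"
  shows "AE t in lborel. 0 < t \<longrightarrow> rearr \<alpha> (\<lambda>s. ereal (f s)) t = ereal (f t)"
  using decr_AE_isCont[OF f]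
proof eventually_elim
  case (elim t)
  have [measurable]: "f \<in> borel_measurable borel" using decr_measurable[OF f] .
  have L0: "(\<lambda>s. ereal (f s)) \<in> L0 \<alpha>" by (rule borel_imp_L0) measurable
  note f0 = decrD(1)[OF f]
  show ?case
  proof (rule impI, rule antisym)
    assume t: "0 < t"
    show "rearr \<alpha> (\<lambda>s. ereal (f s)) t \<le> ereal (f t)"
    proof (rule ccontr)
      assume "\<not> ?thesis"
      then have "ennreal t < distr_fun \<alpha> (\<lambda>s. ereal (f s)) (f t)"
        using rearr_gt_iff[OF L0 f0] by (simp add: not_le)
      also have "\<dots> \<le> emeasure (leb \<alpha>) ({0..<t} \<inter> interval \<alpha>)"
        unfolding distr_fun_def
      proof (rule emeasure_mono)
        show "{s \<in> interval \<alpha>. ereal (f t) < \<bar>ereal (f s)\<bar>} \<subseteq> {0..<t} \<inter> interval \<alpha>"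
          using decrD(3)[OF f t] f0 by (force simp: interval_def not_le[symmetric])
      qed (auto simp: sets_restrict_space_iff)
      also have "\<dots> = emeasure lborel ({0..<t} \<inter> interval \<alpha>)" by (intro emeasure_leb) auto
      also have "\<dots> \<le> emeasure lborel {0..<t}" by (intro emeasure_mono) auto
      also have "\<dots> = ennreal t" using t by simp
      finally show False by simp
    qed
    show "ereal (f t) \<le> rearr \<alpha> (\<lambda>s. ereal (f s)) t"
    proof (rule ccontr)
      assume "\<not> ?thesis"
      then have "rearr \<alpha> (\<lambda>s. ereal (f s)) t < ereal (f t)" by simp
      then obtain l where l: "rearr \<alpha> (\<lambda>s. ereal (f s)) t < ereal l" "ereal l < ereal (f t)"
        using ereal_dense2 by blast
      have l0: "0 \<le> l" using l(1) rearr_nonneg[of \<alpha> "\<lambda>s. ereal (f s)" t]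
        by (metis ereal_less(2) less_eq_ereal_def order.strict_trans1 order_less_imp_le)
      have "\<forall>\<^sub>F s in at t. l < f s"
        using elim t l(2) by (intro order_tendstoD[of f "f t"]) (auto simp: isCont_def)
      then obtain d where d: "0 < d" "\<And>s. s \<noteq> t \<Longrightarrow> dist s t < d \<Longrightarrow> l < f s"
        unfolding eventually_at by auto
      define t' where "t' = t + d/2"
      have t': "t < t'" "l < f t'" using d(1) d(2)[of t'] by (auto simp: t'_def dist_real_def)
      have "{0<..t'} \<subseteq> {s \<in> interval \<alpha>. ereal l < \<bar>ereal (f s)\<bar>}"
      proof
        fix s assume s: "s \<in> {0<..t'}"
        then have "l < f s" using decrD(3)[OF f, of s t'] t' by auto
        moreover from this have "ereal s < \<alpha>" using decrD(4)[OF f, of s] l0 by force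
        ultimately show "s \<in> {s \<in> interval \<alpha>. ereal l < \<bar>ereal (f s)\<bar>}" using s by (auto simp: interval_def)
      qed
      then have "emeasure (leb \<alpha>) {0<..t'} \<le> distr_fun \<alpha> (\<lambda>s. ereal (f s)) l"
        "{0<..t'} \<subseteq> interval \<alpha>"
        unfolding distr_fun_def using distr_set_measurable[OF L0] by (auto intro!: emeasure_mono)
      then have "ennreal t' \<le> distr_fun \<alpha> (\<lambda>s. ereal (f s)) l"
        using t t' by (simp add: emeasure_leb)
      moreover have "ennreal t < ennreal t'" using t' t by (simp add: ennreal_less_iff)
      ultimately show False using l(1) rearr_gt_iff[OF L0 l0, of t] by (metis less_asym order.strict_trans2)
    qed
  qed
qed

lemma cumul_cong_AE:
  assumes "AE s in lborel. 0 < s \<longrightarrow> f s = g s" "\<And>s. s \<le> 0 \<Longrightarrow> f s = g s"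
  shows "cumul f t = cumul g t"
  unfolding cumul_def using assms
  by (intro nn_integral_cong_AE) (auto elim!: eventually_mono simp: not_less[symmetric])

lemma max_rearr_eq_cumul:
  assumes "\<And>t. 0 < t \<Longrightarrow> rearr \<alpha> x t \<noteq> \<infinity>"
  shows "max_rearr \<alpha> x t = cumul (real_rearr \<alpha> x) t / ennreal t"
proof -
  have "AE s in lborel. s \<noteq> (0::real)" by (rule AE_lborel_singleton)
  then have "(\<integral>\<^sup>+ s \<in> {0..t}. e2ennreal (rearr \<alpha> x s) \<partial>lborel) = cumul (real_rearr \<alpha> x) t"
    unfolding cumul_def
  proof (intro nn_integral_cong_AE, eventually_elim)
    case (elim s)
    have "e2ennreal (rearr \<alpha> x s) = ennreal (real_of_ereal (rearr \<alpha> x s))" if "0 < s"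
      using assms[OF that] rearr_nonneg[of \<alpha> x s] by (cases "rearr \<alpha> x s") (auto simp: e2ennreal_ereal)
    then show ?case using elim by (auto simp: real_rearr_def indicator_def)
  qed
  then show ?thesis by (simp add: max_rearr_def)
qed

lemma ennreal_divide_le_iff:
  assumes "0 < t" shows "a / ennreal t \<le> b / ennreal t \<longleftrightarrow> a \<le> b"
proof
  assume "a / ennreal t \<le> b / ennreal t"
  then have "a / ennreal t * ennreal t \<le> b / ennreal t * ennreal t" by (rule mult_right_mono) simp
  then show "a \<le> b" using assms by (simp only: ennreal_divide_times) simp
next
  show "a \<le> b \<Longrightarrow> a / ennreal t \<le> b / ennreal t" by (rule divide_right_mono_ennreal)
qed

lemma ereal_borel_L0: "f \<in> borel_measurable borel \<Longrightarrow> (\<lambda>t. ereal (f t)) \<in> L0 \<alpha>"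
  by (intro borel_imp_L0) measurable

section \<open>Step functions on a grid of equal cells\<close>

definition stepf :: "real \<Rightarrow> nat \<Rightarrow> (nat \<Rightarrow> real) \<Rightarrow> real \<Rightarrow> real" where
  "stepf h n b s = (\<Sum>k<n. b k * indicator {real k * h..<(real k + 1) * h} s)"

lemma grid_cell_iff:
  assumes "0 < h" "0 \<le> s"
  shows "s \<in> {real k * h..<(real k + 1) * h} \<longleftrightarrow> nat \<lfloor>s / h\<rfloor> = k"
proof -
  have "s \<in> {real k * h..<(real k + 1) * h} \<longleftrightarrow> real_of_int (int k) \<le> s / h \<and> s / h < real_of_int (int k) + 1"
    using assms(1) by (simp add: field_simps)
  also have "\<dots> \<longleftrightarrow> \<lfloor>s / h\<rfloor> = int k" by (simp add: floor_eq_iff)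
  also have "\<dots> \<longleftrightarrow> nat \<lfloor>s / h\<rfloor> = k" using assms by auto
  finally show ?thesis .
qed

lemma grid_index_less:
  assumes "0 < h" "0 \<le> s" shows "nat \<lfloor>s / h\<rfloor> < n \<longleftrightarrow> s < real n * h"
proof -
  have "nat \<lfloor>s / h\<rfloor> < n \<longleftrightarrow> \<lfloor>s / h\<rfloor> < int n" using assms by (auto simp: nat_less_iff)
  also have "\<dots> \<longleftrightarrow> s / h < real n" by (simp add: floor_less_iff)
  also have "\<dots> \<longleftrightarrow> s < real n * h" using assms by (simp add: field_simps)
  finally show ?thesis .
qed

lemma stepf_eq:
  assumes h: "0 < h"
  shows "stepf h n b s = (if 0 \<le> s \<and> s < real n * h then b (nat \<lfloor>s / h\<rfloor>) else 0)"
proof (cases "0 \<le> s")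
  case True
  have "stepf h n b s = (\<Sum>k<n. if k = nat \<lfloor>s / h\<rfloor> then b k else 0)"
    unfolding stepf_def indicator_def using grid_cell_iff[OF h True] by (intro sum.cong) auto
  then show ?thesis using True grid_index_less[OF h True] by simp
next
  case False
  have "indicator {real k * h..<(real k + 1) * h} s = (0::real)" for k
  proof -
    have "0 \<le> real k * h" using h by simp
    then show ?thesis using False by auto
  qed
  then show ?thesis using False by (simp add: stepf_def)
qed

lemma stepf_measurable [measurable]: "stepf h n b \<in> borel_measurable borel"
  unfolding stepf_def by measurable

lemma nn_integral_stepf:
  assumes h: "0 < h" and b: "\<And>k. 0 \<le> b k"
  shows "(\<integral>\<^sup>+s. ennreal (stepf h n b s) \<partial>lborel) = ennreal (h * (\<Sum>k<n. b k))"
proof -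
  have "(\<integral>\<^sup>+s. ennreal (stepf h n b s) \<partial>lborel) =
      (\<integral>\<^sup>+s. (\<Sum>k<n. ennreal (b k) * indicator {real k * h..<(real k + 1) * h} s) \<partial>lborel)"
  proof (rule nn_integral_cong)
    fix s
    have "ennreal (stepf h n b s) = (\<Sum>k<n. ennreal (b k * indicator {real k * h..<(real k + 1) * h} s))"
      unfolding stepf_def using b by (intro sum_ennreal[symmetric]) simp
    also have "\<dots> = (\<Sum>k<n. ennreal (b k) * indicator {real k * h..<(real k + 1) * h} s)"
      by (intro sum.cong) (auto simp: indicator_def)
    finally show "ennreal (stepf h n b s) = (\<Sum>k<n. ennreal (b k) * indicator {real k * h..<(real k + 1) * h} s)" .
  qed
  also have "\<dots> = (\<Sum>k<n. ennreal (b k) * ennreal h)"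
  proof (subst nn_integral_sum)
    show "(\<Sum>k<n. \<integral>\<^sup>+s. ennreal (b k) * indicator {real k * h..<(real k + 1) * h} s \<partial>lborel) =
        (\<Sum>k<n. ennreal (b k) * ennreal h)"
      using h by (intro sum.cong refl, subst nn_integral_cmult_indicator) (auto simp: algebra_simps)
  qed auto
  also have "\<dots> = (\<Sum>k<n. ennreal (h * b k))"
    using b h by (intro sum.cong refl) (simp add: mult.commute flip: ennreal_mult)
  also have "\<dots> = ennreal (h * (\<Sum>k<n. b k))"
    using b h by (subst sum_ennreal) (auto simp: sum_distrib_left)
  finally show ?thesis .
qed

text \<open>Because \<open>real n * h \<le> \<alpha>\<close>, every cell lies inside the interval
  and counts with its full length.\<close>

lemma distr_fun_stepf:
  assumes h: "0 < h" and n: "ereal (real n * h) \<le> \<alpha>" and l: "0 \<le> l"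
  shows "distr_fun \<alpha> (\<lambda>s. ereal (stepf h n b s)) l = of_nat (card {k. k < n \<and> l < \<bar>b k\<bar>}) * ennreal h"
proof -
  let ?I = "\<lambda>k. {real k * h..<(real k + 1) * h}"
  let ?K = "{k. k < n \<and> l < \<bar>b k\<bar>}"
  have set: "{s \<in> interval \<alpha>. ereal l < \<bar>ereal (stepf h n b s)\<bar>} = (\<Union>k\<in>?K. ?I k)" (is "?S = ?U")
  proof
    show "?S \<subseteq> ?U"
    proof
      fix s assume "s \<in> ?S"
      then have s: "0 \<le> s" "l < \<bar>stepf h n b s\<bar>" by (auto simp: interval_def)
      then have "s < real n * h" "l < \<bar>b (nat \<lfloor>s / h\<rfloor>)\<bar>"
        using l by (auto simp: stepf_eq[OF h] split: if_splits)
      then show "s \<in> ?U" using grid_cell_iff[OF h s(1), of "nat \<lfloor>s / h\<rfloor>"] grid_index_less[OF h s(1), of n] by auto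
    qed
    show "?U \<subseteq> ?S"
    proof
      fix s assume "s \<in> ?U"
      then obtain k where k: "k < n" "l < \<bar>b k\<bar>" "s \<in> ?I k" by auto
      have "0 \<le> real k * h" using h by simp
      then have s0: "0 \<le> s" using k(3) by auto
      have eq: "nat \<lfloor>s / h\<rfloor> = k" using grid_cell_iff[OF h s0] k(3) by simp
      then have lt: "s < real n * h" using grid_index_less[OF h s0, of n] k(1) by simp
      then have "ereal s < ereal (real n * h)" by simp
      then have "ereal s < \<alpha>" using n by (rule less_le_trans)
      then show "s \<in> ?S" using s0 lt k eq by (simp add: interval_def stepf_eq[OF h])
    qed
  qed
  have "distr_fun \<alpha> (\<lambda>s. ereal (stepf h n b s)) l = emeasure lborel ?U"
    unfolding distr_fun_def set using set by (intro emeasure_leb) auto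
  also have "\<dots> = (\<Sum>k\<in>?K. emeasure lborel (?I k))"
  proof (rule sum_emeasure[symmetric])
    show "disjoint_family_on ?I ?K"
      unfolding disjoint_family_on_def
    proof (intro ballI impI)
      fix k m :: nat assume km: "k \<noteq> m"
      show "?I k \<inter> ?I m = {}"
      proof (rule equals0I)
        fix s assume s: "s \<in> ?I k \<inter> ?I m"
        have "0 \<le> real k * h" using h by simp
        then have "0 \<le> s" using s by auto
        then show False using grid_cell_iff[OF h, of s k] grid_cell_iff[OF h, of s m] s km by auto
      qed
    qed
  qed auto
  also have "\<dots> = (\<Sum>k\<in>?K. ennreal h)" using h by (intro sum.cong) (auto simp: algebra_simps)
  finally show ?thesis by simp
qed

text \<open>The cells have equal length, so only the number of coefficients above a level matters,
  and a permutation keeps it. Transpositions are what \<open>majorization_induct\<close> asks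
  for.\<close>

lemma distr_fun_stepf_transpose:
  assumes h: "0 < h" and n: "ereal (real n * h) \<le> \<alpha>" and ij: "i < n" "j < n"
  shows "distr_fun \<alpha> (\<lambda>s. ereal (stepf h n (\<lambda>k. b (Transposition.transpose i j k)) s)) =
    distr_fun \<alpha> (\<lambda>s. ereal (stepf h n b s))"
proof
  fix l
  let ?t = "Transposition.transpose i j"
  show "distr_fun \<alpha> (\<lambda>s. ereal (stepf h n (\<lambda>k. b (?t k)) s)) l = distr_fun \<alpha> (\<lambda>s. ereal (stepf h n b s)) l"
  proof (cases "0 \<le> l")
    case True
    have "bij_betw ?t {k. k < n \<and> l < \<bar>b (?t k)\<bar>} {k. k < n \<and> l < \<bar>b k\<bar>}"
      by (rule bij_betw_byWitness[where f' = ?t]) (use ij in \<open>auto simp: Transposition.transpose_def\<close>)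
    from bij_betw_same_card[OF this] show ?thesis by (simp add: distr_fun_stepf[OF h n True])
  next
    case False
    then have "l < \<bar>z\<bar>" for z :: real by linarith
    then show ?thesis by (simp add: distr_fun_def)
  qed
qed

section \<open>Symmetric spaces with the Fatou property\<close>

locale fatou_symmetric_space = symmetric_space +
  assumes alpha: "\<alpha> = 1 \<or> \<alpha> = \<infinity>"
    and fatou: "fatou_property \<alpha> E nrm"
begin

text \<open>Elements of \<open>E\<close> are finite a.e., so real-valued representatives suffice,
  and arithmetic on them avoids the conventions of \<open>ereal\<close> for infinite values.\<close>

abbreviation rE :: "(real \<Rightarrow> real) \<Rightarrow> bool" where
  "rE f \<equiv> (\<lambda>t. ereal (f t)) \<in> E"

abbreviation nr :: "(real \<Rightarrow> real) \<Rightarrow> real" where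
  "nr f \<equiv> nrm (\<lambda>t. ereal (f t))"

abbreviation phi :: "real \<Rightarrow> real" where
  "phi t \<equiv> nr (indicator {0<..<t})"

lemma alpha_nonneg [simp]: "0 \<le> \<alpha>"
  using alpha by auto

lemma less_alpha: "t < 1 \<Longrightarrow> ereal t < \<alpha>"
  using alpha by auto

lemma E_L0: "x \<in> E \<Longrightarrow> x \<in> L0 \<alpha>"
  using subset_L0 by auto

lemma E_cong_AE:
  assumes "x \<in> L0 \<alpha>" "y \<in> E" "AE t in leb \<alpha>. x t = y t"
  shows "x \<in> E \<and> nrm x = nrm y"
proof -
  have "AE t in leb \<alpha>. \<bar>x t\<bar> \<le> \<bar>y t\<bar>" "AE t in leb \<alpha>. \<bar>y t\<bar> \<le> \<bar>x t\<bar>"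
    using assms(3) by (eventually_elim; simp)+
  then show ?thesis using ideal[of x y] ideal[of y x] assms E_L0 by force
qed

text \<open>The zero multiple of \<open>x\<close> has norm 0 and lies below |x|, so the ideal
  property gives the sign.\<close>

lemma nrm_nonneg: "x \<in> E \<Longrightarrow> 0 \<le> nrm x"
  using ideal[of "\<lambda>t. ereal 0 * x t" x] E_L0[OF scale_closed[of x 0]] norm_scale[of x 0]
  by (simp flip: zero_ereal_def)

lemma rE_mono:
  assumes "f \<in> borel_measurable borel" "rE g" "\<And>t. 0 < t \<Longrightarrow> ereal t < \<alpha> \<Longrightarrow> \<bar>f t\<bar> \<le> \<bar>g t\<bar>"
  shows "rE f" "nr f \<le> nr g"
  using ideal[OF ereal_borel_L0[OF assms(1)] assms(2) AE_lebI] assms(3) by auto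

lemma rE_add:
  assumes "rE f" "rE g"
  shows "rE (\<lambda>t. f t + g t)" "nr (\<lambda>t. f t + g t) \<le> nr f + nr g"
  using add_closed[OF assms] norm_triangle[OF assms] by auto

lemma rE_scale:
  assumes "rE f"
  shows "rE (\<lambda>t. c * f t)" "nr (\<lambda>t. c * f t) = \<bar>c\<bar> * nr f"
  using scale_closed[OF assms, of c] norm_scale[OF assms, of c] by auto

lemma AE_leb_ex:
  assumes "AE t in leb \<alpha>. Q t" "0 < u" shows "\<exists>s. 0 < s \<and> s < u \<and> Q s"
proof (rule ccontr)
  assume no: "\<not> ?thesis"
  \<comment> \<open>Capping at 1 keeps (0,v) inside the interval for both values of
    \<alpha>.\<close>
  define v where "v = min u 1"
  have v: "0 < v" "v \<le> u" "v \<le> 1" using assms(2) by (auto simp: v_def)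
  have "AE s in leb \<alpha>. \<not> s \<in> {0<..<v}"
    using assms(1) by (rule eventually_mono) (use no v in auto)
  moreover have sub: "{0<..<v} \<subseteq> interval \<alpha>" using less_alpha v by (auto simp: interval_def)
  moreover have "{s \<in> space (leb \<alpha>). \<not> (\<not> s \<in> {0<..<v})} = {0<..<v}" using sub by auto
  moreover have "{0<..<v} \<in> sets (leb \<alpha>)" using sub by (auto simp: sets_restrict_space_iff)
  ultimately have "emeasure (leb \<alpha>) {0<..<v} = 0" by (subst (asm) AE_iff_measurable) auto
  then show False using v sub by (simp add: emeasure_leb)
qed

lemma rearr_in_E:
  assumes "x \<in> E" shows "rearr \<alpha> x \<in> E" "nrm (rearr \<alpha> x) = nrm x"
  using symmetric[of "rearr \<alpha> x" x] assms E_L0[OF assms]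
    borel_imp_L0[OF rearr_measurable[OF E_L0[OF assms]]] distr_fun_rearr[OF E_L0[OF assms]]
  by auto

text \<open>The rearrangement belongs to \<open>E\<close> and is finite a.e., hence at some point
  left of \<open>t\<close>; monotonicity does the rest.\<close>

lemma rearr_finite:
  assumes "x \<in> E" "0 < t" shows "rearr \<alpha> x t \<noteq> \<infinity>"
proof
  assume inf: "rearr \<alpha> x t = \<infinity>"
  from AE_leb_ex[OF finite_AE[OF rearr_in_E(1)[OF assms(1)]] assms(2)]
  obtain s where "s < t" "\<bar>rearr \<alpha> x s\<bar> \<noteq> \<infinity>" by (elim exE conjE)
  then show False using rearr_antimono[of s t \<alpha> x] inf by simp
qed

lemma real_rearr_eq: "x \<in> E \<Longrightarrow> 0 < t \<Longrightarrow> ereal (real_rearr \<alpha> x t) = rearr \<alpha> x t"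
  using rearr_finite[of x t] rearr_nonneg[of \<alpha> x t] by (auto simp: real_rearr_def ereal_real)

lemma real_rearr_decr:
  assumes "x \<in> E" shows "decr \<alpha> (real_rearr \<alpha> x)"
  unfolding decr_def
proof (intro conjI allI impI)
  fix s t :: real
  show "0 \<le> real_rearr \<alpha> x t"
    using rearr_nonneg[of \<alpha> x t] by (auto simp: real_rearr_def real_of_ereal_pos)
  show "t \<le> 0 \<Longrightarrow> real_rearr \<alpha> x t = 0" by (simp add: real_rearr_def)
  show "0 < s \<Longrightarrow> s \<le> t \<Longrightarrow> real_rearr \<alpha> x t \<le> real_rearr \<alpha> x s"
    using real_rearr_eq[OF assms, of s] real_rearr_eq[OF assms, of t] rearr_antimono[of s t \<alpha> x]
    by (metis ereal_less_eq(3) order.strict_trans2)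
  show "\<alpha> \<le> ereal t \<Longrightarrow> real_rearr \<alpha> x t = 0"
    using rearr_beyond[of \<alpha> t x] by (simp add: real_rearr_def)
qed

lemma real_rearr_rE:
  assumes "x \<in> E" shows "rE (real_rearr \<alpha> x)" "nr (real_rearr \<alpha> x) = nrm x"
proof -
  have "rE (real_rearr \<alpha> x) \<and> nr (real_rearr \<alpha> x) = nrm (rearr \<alpha> x)"
    using real_rearr_eq[OF assms] decr_measurable[OF real_rearr_decr[OF assms]]
    by (intro E_cong_AE ereal_borel_L0 rearr_in_E assms AE_lebI) auto
  then show "rE (real_rearr \<alpha> x)" "nr (real_rearr \<alpha> x) = nrm x"
    using rearr_in_E[OF assms] by auto
qed

lemma submaj_iff:
  assumes "x \<in> E" "y \<in> E"
  shows "submaj \<alpha> x y \<longleftrightarrow> (\<forall>t>0. cumul (real_rearr \<alpha> x) t \<le> cumul (real_rearr \<alpha> y) t)"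
  using assms rearr_finite
  by (simp add: submaj_def max_rearr_eq_cumul ennreal_divide_le_iff cong: imp_cong)

lemma real_rearr_of_decr:
  assumes "decr \<alpha> f"
  shows "AE t in lborel. 0 < t \<longrightarrow> real_rearr \<alpha> (\<lambda>s. ereal (f s)) t = f t"
  using rearr_decr_AE[OF assms]
  by eventually_elim (auto simp: real_rearr_def)

lemma cumul_real_rearr_of_decr:
  assumes "decr \<alpha> f"
  shows "cumul (real_rearr \<alpha> (\<lambda>s. ereal (f s))) t = cumul f t"
  using real_rearr_of_decr[OF assms] decrD(2)[OF assms]
  by (intro cumul_cong_AE) (auto simp: real_rearr_def)

section \<open>Indicators of initial segments and the fundamental function\<close>

lemma rearr_positive:
  assumes "w \<in> E" "AE t in leb \<alpha>. w t > 0" "t < 1 \<or> \<alpha> = \<infinity>"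
  shows "0 < rearr \<alpha> w t"
proof -
  have "distr_fun \<alpha> w 0 = emeasure (leb \<alpha>) (interval \<alpha>)"
    unfolding distr_fun_def
    by (intro emeasure_eq_AE distr_set_measurable E_L0[OF assms(1), THEN distr_set_measurable[of w \<alpha> 0]])
      (use assms(2) in \<open>auto simp: sets_restrict_space_iff zero_ereal_def[symmetric] elim: eventually_mono\<close>)
  also have "\<dots> = e2ennreal \<alpha>" by (intro emeasure_interval) simp
  finally have "ennreal t < distr_fun \<alpha> w 0" using assms(3) alpha
    by (auto simp: one_ereal_def e2ennreal_ereal)
  then show ?thesis using rearr_gt_iff[OF E_L0[OF assms(1)], of 0 t] by (simp add: zero_ereal_def)
qed

text \<open>On (0,t) the rearrangement of a strictly positive element is at least its value at
  \<open>t\<close>, which is positive, so a multiple of it dominates the indicator. For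
  \<open>\<alpha> = 1\<close> this stops short of \<open>t = 1\<close>, where the rearrangement
  vanishes.\<close>

lemma indicator_rE_less:
  assumes "t < 1 \<or> \<alpha> = \<infinity>" shows "rE (indicator {0<..<t})"
proof (cases "0 < t")
  case True
  obtain w where w: "w \<in> E" "AE t in leb \<alpha>. w t > 0" using strictly_positive by auto
  let ?r = "real_rearr \<alpha> w"
  have pos: "0 < ?r t" using rearr_positive[OF w assms] real_rearr_eq[OF w(1) True]
    by (metis ereal_less(2))
  have "rE (\<lambda>s. (1 / ?r t) * ?r s)" using rE_scale(1)[OF real_rearr_rE(1)[OF w(1)]] .
  then show ?thesis
  proof (rule rE_mono(1)[rotated])
    fix s :: real assume s: "0 < s"
    have "?r t \<le> ?r s" if "s < t" using decrD(3)[OF real_rearr_decr[OF w(1)] s] that by simp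
    then show "\<bar>indicator {0<..<t} s\<bar> \<le> \<bar>1 / ?r t * ?r s\<bar>"
      using pos by (auto simp: indicator_def)
  qed measurable
next
  case False
  have "rE (\<lambda>s. 0 * real_rearr \<alpha> w s)" if "w \<in> E" for w
    using rE_scale(1)[OF real_rearr_rE(1)[OF that]] .
  then show ?thesis using False strictly_positive by (auto simp: indicator_def)
qed

text \<open>In the case left open by \<open>indicator_rE_less\<close> the interval (0,1) is cut into
  halves. The first half is already settled, and the second is equimeasurable with it by swapping
  two cells.\<close>

lemma indicator_rE: "rE (indicator {0<..<t})"
proof (cases "t < 1 \<or> \<alpha> = \<infinity>")
  case False
  then have a1: "\<alpha> = 1" "1 \<le> t" using alpha by auto
  define b where "b = (\<lambda>k::nat. if k = 0 then 1 else 0 :: real)"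
  let ?b' = "\<lambda>k. b (Transposition.transpose 0 1 k)"
  have "rE (stepf (1/2) 2 b)"
    by (rule rE_mono(1)[OF _ indicator_rE_less[of "1/2"]])
      (auto simp: stepf_def b_def indicator_def numeral_2_eq_2)
  moreover have "rE (stepf (1/2) 2 ?b')"
    using symmetric[OF ereal_borel_L0[OF stepf_measurable] calculation distr_fun_stepf_transpose] a1 by simp
  ultimately have "rE (\<lambda>s. stepf (1/2) 2 b s + stepf (1/2) 2 ?b' s)" by (rule rE_add)
  then show ?thesis
    by (rule rE_mono(1)[rotated])
      (auto simp: a1 one_ereal_def stepf_def b_def indicator_def numeral_2_eq_2 Transposition.transpose_def)
qed (rule indicator_rE_less)

lemma bounded_support_rE:
  assumes [measurable]: "f \<in> borel_measurable borel"
    and "\<And>s. 0 < s \<Longrightarrow> \<bar>f s\<bar> \<le> c * indicator {0<..<t} s"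
  shows "rE f" "nr f \<le> \<bar>c\<bar> * phi t"
proof -
  have "rE f \<and> nr f \<le> nr (\<lambda>s. c * indicator {0<..<t} s)"
  proof (intro conjI rE_mono[OF _ rE_scale(1)[OF indicator_rE]])
    fix s :: real assume "0 < s"
    from assms(2)[OF this] show "\<bar>f s\<bar> \<le> \<bar>c * indicator {0<..<t} s\<bar>"
      by linarith
    then show "\<bar>f s\<bar> \<le> \<bar>c * indicator {0<..<t} s\<bar>" .
  qed auto
  then show "rE f" "nr f \<le> \<bar>c\<bar> * phi t" using rE_scale(2)[OF indicator_rE] by auto
qed

lemma phi_pos:
  assumes "0 < t" shows "0 < phi t"
proof (rule ccontr)
  assume "\<not> ?thesis"
  then have "phi t = 0" using nrm_nonneg[OF indicator_rE, of t] by simp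
  then have "AE s in leb \<alpha>. ereal (indicator {0<..<t} s) = 0"
    using norm_zero_iff[OF indicator_rE] by simp
  from AE_leb_ex[OF this assms] show False by (auto simp: indicator_def)
qed

lemma phi_mono: "s \<le> t \<Longrightarrow> phi s \<le> phi t"
  by (rule rE_mono(2)[OF _ indicator_rE]) (auto simp: indicator_def)

lemma stepf_rE:
  assumes "0 < h" shows "rE (stepf h n b)"
proof (rule bounded_support_rE(1))
  fix s :: real assume "0 < s"
  have "\<bar>b k\<bar> \<le> (\<Sum>k<n. \<bar>b k\<bar>)" if "k < n" for k
    using that by (intro member_le_sum) auto
  then show "\<bar>stepf h n b s\<bar> \<le> (\<Sum>k<n. \<bar>b k\<bar>) * indicator {0<..<real n * h} s"
    using \<open>0 < s\<close> assms grid_index_less[of h s n] by (auto simp: stepf_eq)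
qed simp

text \<open>The norm of a step function meets both hypotheses of \<open>majorization_induct\<close>:
  the ideal property gives monotonicity in the coefficients, and the triangle inequality with
  invariance under transpositions handles the convex mixtures.\<close>

lemma nr_stepf_mono:
  assumes h: "0 < h" and n: "ereal (real n * h) \<le> \<alpha>"
    and a: "\<And>i. i < n \<Longrightarrow> 0 \<le> a i" and b: "\<And>i. i < n \<Longrightarrow> 0 \<le> b i"
    and dec: "\<And>i j. i \<le> j \<Longrightarrow> j < n \<Longrightarrow> a j \<le> a i"
    and maj: "\<And>k. k \<le> n \<Longrightarrow> (\<Sum>i<k. a i) \<le> (\<Sum>i<k. b i)"
  shows "nr (stepf h n a) \<le> nr (stepf h n b)"
proof (rule majorization_induct[where p = "\<lambda>v. nr (stepf h n v)" and n = n])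
  fix u v :: "nat \<Rightarrow> real" assume uv: "\<And>i. i < n \<Longrightarrow> 0 \<le> u i \<and> u i \<le> v i"
  show "nr (stepf h n u) \<le> nr (stepf h n v)"
  proof (rule rE_mono(2)[OF stepf_measurable stepf_rE[OF h]])
    fix s :: real assume "0 < s"
    then show "\<bar>stepf h n u s\<bar> \<le> \<bar>stepf h n v s\<bar>"
      using uv[of "nat \<lfloor>s/h\<rfloor>"] grid_index_less[OF h, of s n] by (auto simp: stepf_eq[OF h])
  qed
next
  fix v :: "nat \<Rightarrow> real" and i j l
  assume v: "\<And>k. k < n \<Longrightarrow> 0 \<le> v k" and ij: "i < n" "j < n" and l: "0 \<le> l" "l \<le> (1::real)"
  let ?v = "\<lambda>k. v (Transposition.transpose i j k)"
  have eq: "stepf h n (\<lambda>k. (1 - l) * v k + l * ?v k) = (\<lambda>s. (1 - l) * stepf h n v s + l * stepf h n ?v s)"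
    by (simp add: stepf_eq[OF h] fun_eq_iff)
  have "nr (stepf h n (\<lambda>k. (1 - l) * v k + l * ?v k)) \<le> (1 - l) * nr (stepf h n v) + l * nr (stepf h n ?v)"
  proof -
    have "nr (stepf h n (\<lambda>k. (1 - l) * v k + l * ?v k))
        \<le> nr (\<lambda>s. (1 - l) * stepf h n v s) + nr (\<lambda>s. l * stepf h n ?v s)"
      unfolding eq by (rule rE_add(2)[OF rE_scale(1) rE_scale(1), OF stepf_rE[OF h] stepf_rE[OF h]])
    also have "\<dots> = \<bar>1 - l\<bar> * nr (stepf h n v) + \<bar>l\<bar> * nr (stepf h n ?v)"
      by (simp only: rE_scale(2)[OF stepf_rE[OF h]])
    finally show ?thesis using l by simp
  qed
  also have "nr (stepf h n ?v) = nr (stepf h n v)"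
    using symmetric[OF ereal_borel_L0[OF stepf_measurable] stepf_rE[OF h] distr_fun_stepf_transpose[OF h n ij]] by simp
  finally show "nr (stepf h n (\<lambda>k. (1 - l) * v k + l * ?v k)) \<le> nr (stepf h n v)"
    by (simp add: algebra_simps)
qed (use assms in auto)

end

section \<open>Monotonicity of the norm under submajorization\<close>

text \<open>
  The value is taken at the next grid point to the right, so that these approximations of a
  decreasing function lie below it and increase to it at points of continuity.
\<close>

definition dyad :: "nat \<Rightarrow> (real \<Rightarrow> real) \<Rightarrow> real \<Rightarrow> real" where
  "dyad M f s = (if 0 < s then f ((of_int \<lfloor>s * 2^M\<rfloor> + 1) / 2^M) else 0)"

lemma dyad_point:
  fixes s :: real
  shows "s < (of_int \<lfloor>s * 2^M\<rfloor> + 1) / 2^M" "(of_int \<lfloor>s * 2^M\<rfloor> + 1) / 2^M \<le> s + 1 / 2^M"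
proof -
  have "s * 2^M < of_int \<lfloor>s * 2^M\<rfloor> + 1" by linarith
  then show "s < (of_int \<lfloor>s * 2^M\<rfloor> + 1) / 2^M" by (simp add: field_simps)
  have "of_int \<lfloor>s * 2^M\<rfloor> + 1 \<le> s * 2^M + 1" by linarith
  then have "(of_int \<lfloor>s * 2^M\<rfloor> + 1) / 2^M \<le> (s * 2^M + 1) / 2^M" by (rule divide_right_mono) simp
  also have "\<dots> = s + 1 / 2^M" by (simp add: field_simps)
  finally show "(of_int \<lfloor>s * 2^M\<rfloor> + 1) / 2^M \<le> s + 1 / 2^M" .
qed

text \<open>The grids are nested, so refining can only bring the next grid point closer. This makes
  the approximations of a decreasing function increase.\<close>

lemma dyad_point_decreasing:
  fixes s :: real
  shows "(of_int \<lfloor>s * 2^Suc M\<rfloor> + 1) / 2^Suc M \<le> (of_int \<lfloor>s * 2^M\<rfloor> + 1) / (2^M :: real)"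
proof -
  define u where "u = s * 2^M"
  have "2 * u < of_int (2 * \<lfloor>u\<rfloor> + 2)" by (simp add: algebra_simps) linarith
  then have "\<lfloor>2 * u\<rfloor> < 2 * \<lfloor>u\<rfloor> + 2" by (simp only: floor_less_iff)
  then have "\<lfloor>2 * u\<rfloor> + 1 \<le> 2 * \<lfloor>u\<rfloor> + 2" by simp
  then have "real_of_int (\<lfloor>2 * u\<rfloor> + 1) \<le> real_of_int (2 * \<lfloor>u\<rfloor> + 2)" by (simp only: of_int_le_iff)
  then have "(of_int \<lfloor>2 * u\<rfloor> + 1) / 2^Suc M \<le> (2 * (of_int \<lfloor>u\<rfloor> + 1)) / (2^Suc M :: real)"
    by (intro divide_right_mono) auto
  also have "\<dots> = (of_int \<lfloor>u\<rfloor> + 1) / 2^M" by (simp add: field_simps)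
  finally show ?thesis by (simp only: u_def power_Suc mult_ac)
qed

context
  fixes \<alpha> f assumes f: "decr \<alpha> f"
begin

lemma dyad_le: "dyad M f s \<le> f s"
  using decrD(3)[OF f, of s] decrD(1)[OF f, of s] dyad_point(1)[of s M] by (auto simp: dyad_def)

lemma dyad_nonneg: "0 \<le> dyad M f s"
  using decrD(1)[OF f] by (auto simp: dyad_def)

lemma dyad_mono: "dyad M f s \<le> dyad (Suc M) f s"
proof -
  have "0 < s \<Longrightarrow> 0 < (of_int \<lfloor>s * 2^Suc M\<rfloor> + 1) / (2^Suc M :: real)"
    using dyad_point(1)[of s "Suc M"] by linarith
  then show ?thesis
    unfolding dyad_def using decrD(3)[OF f _ dyad_point_decreasing[of s M]] by auto
qed

lemma dyad_measurable [measurable]: "dyad M f \<in> borel_measurable borel"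
proof -
  note decr_measurable[OF f, measurable]
  show ?thesis unfolding dyad_def[abs_def] by measurable
qed

lemma dyad_tendsto:
  assumes "isCont f s" "0 < s" shows "(\<lambda>M. dyad M f s) \<longlonglongrightarrow> f s"
proof -
  have "(\<lambda>M. s + (1/2)^M) \<longlonglongrightarrow> s + 0" by (rule tendsto_add[OF tendsto_const LIMSEQ_power_zero]) simp
  then have "(\<lambda>M. s + 1/2^M) \<longlonglongrightarrow> s" by (simp only: power_divide power_one add_0_right)
  then have "(\<lambda>M. (of_int \<lfloor>s * 2^M\<rfloor> + 1) / 2^M) \<longlonglongrightarrow> s"
    by (rule tendsto_sandwich[OF _ _ tendsto_const, rotated 2])
      (intro always_eventually allI less_imp_le[OF dyad_point(1)] dyad_point(2))+
  then show ?thesis using isCont_tendsto_compose[OF assms(1)] assms(2) by (simp add: dyad_def)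
qed

lemma dyad_eq_stepf:
  assumes "0 < s" "s < real n / 2^M"
  shows "dyad M f s = stepf (1/2^M) n (\<lambda>i. f ((real i + 1) / 2^M)) s"
  using assms by (simp add: dyad_def stepf_eq)

lemma cumul_dyad:
  "cumul (dyad M f) (real j / 2^M) = ennreal ((\<Sum>i<j. f ((real i + 1) / 2^M)) / 2^M)"
proof -
  have "AE s in lborel. s \<noteq> (0::real) \<and> s \<noteq> real j / 2^M"
    using AE_lborel_singleton[of 0] AE_lborel_singleton[of "real j / 2^M"] by eventually_elim auto
  then have "cumul (dyad M f) (real j / 2^M)
      = (\<integral>\<^sup>+s. ennreal (stepf (1/2^M) j (\<lambda>i. f ((real i + 1) / 2^M)) s) \<partial>lborel)"
    unfolding cumul_def
  proof (intro nn_integral_cong_AE, eventually_elim)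
    case (elim s)
    show ?case
    proof (cases "0 < s \<and> s < real j / 2^M")
      case True
      then show ?thesis using dyad_eq_stepf[of s j M] by (simp add: indicator_def)
    next
      case False
      then show ?thesis using elim by (auto simp: stepf_eq indicator_def)
    qed
  qed
  also have "\<dots> = ennreal ((\<Sum>i<j. f ((real i + 1) / 2^M)) / 2^M)"
    using decrD(1)[OF f] by (subst nn_integral_stepf) auto
  finally show ?thesis .
qed

lemma cumul_dyad_tendsto: "(\<lambda>M. cumul (dyad M f) t) \<longlonglongrightarrow> cumul f t"
proof -
  let ?F = "\<lambda>M s. ennreal (dyad M f s) * indicator {0..t} s"
  have inc: "incseq ?F"
    using dyad_mono by (intro incseq_SucI le_funI mult_right_mono ennreal_leI) auto
  have "(\<lambda>M. cumul (dyad M f) t) \<longlonglongrightarrow> (SUP M. cumul (dyad M f) t)"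
    unfolding cumul_def using incseq_nn_integral[OF inc] by (intro LIMSEQ_SUP) 
  also have "(SUP M. cumul (dyad M f) t) = (\<integral>\<^sup>+s. (SUP M. ?F M s) \<partial>lborel)"
    unfolding cumul_def by (rule nn_integral_monotone_convergence_SUP[symmetric, OF inc]) measurable
  also have "\<dots> = cumul f t"
    unfolding cumul_def
  proof (intro nn_integral_cong_AE, use decr_AE_isCont[OF f] AE_lborel_singleton[of 0] in eventually_elim)
    case (elim s)
    have "(SUP M. ?F M s) = ennreal (f s) * indicator {0..t} s" if "s \<le> 0"
    proof -
      have z: "indicator {0..t} s = (0 :: ennreal)" using that elim by (auto simp: indicator_def)
      show ?thesis unfolding z by simp
    qed
    moreover have "(SUP M. ?F M s) = ennreal (f s) * indicator {0..t} s" if "0 < s"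
    proof (rule LIMSEQ_unique[OF LIMSEQ_SUP])
      show "incseq (\<lambda>M. ?F M s)" using inc by (auto simp: incseq_def le_fun_def)
      show "(\<lambda>M. ?F M s) \<longlonglongrightarrow> ennreal (f s) * indicator {0..t} s"
        using dyad_tendsto[of s] elim that by (cases "s \<in> {0..t}") auto
    qed
    ultimately show ?case by linarith
  qed
  finally show ?thesis .
qed

end

section \<open>Integrals of decreasing functions over initial segments\<close>

lemma cumul_mono:
  assumes "\<And>s. 0 < s \<Longrightarrow> s < t \<Longrightarrow> f s \<le> g s" shows "cumul f t \<le> cumul g t"
  unfolding cumul_def
  by (intro nn_integral_mono_AE, use AE_lborel_singleton[of 0] AE_lborel_singleton[of t] in eventually_elim)
    (use assms in \<open>auto simp: indicator_def intro!: ennreal_leI\<close>)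

lemma cumul_mono_right: "s \<le> t \<Longrightarrow> cumul f s \<le> cumul f t"
  unfolding cumul_def by (intro nn_integral_mono) (auto simp: indicator_def)

lemma nn_integral_const_segment: 
  assumes "0 \<le> t" "0 \<le> c" shows "(\<integral>\<^sup>+s. ennreal c * indicator {0..t} s \<partial>lborel) = ennreal (c * t)"
  using assms by (simp add: nn_integral_cmult_indicator ennreal_mult)

lemma cumul_ge:
  assumes f: "decr \<alpha> f" and t: "0 < t" shows "ennreal (f t * t) \<le> cumul f t"
proof -
  have "ennreal (f t * t) = (\<integral>\<^sup>+s. ennreal (f t) * indicator {0..t} s \<partial>lborel)"
    using t decrD(1)[OF f] by (simp add: nn_integral_const_segment)
  also have "\<dots> \<le> cumul f t"
    unfolding cumul_def
    by (intro nn_integral_mono_AE, use AE_lborel_singleton[of 0] in eventually_elim)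
      (auto simp: indicator_def intro!: ennreal_leI decrD(3)[OF f])
  finally show ?thesis .
qed

text \<open>Beyond \<open>s\<close> the integrand is at most \<open>f s\<close>. An infinite
  integral can therefore only come from a neighbourhood of 0.\<close>

lemma cumul_le_add:
  assumes f: "decr \<alpha> f" and s: "0 < s" "s \<le> t"
  shows "cumul f t \<le> cumul f s + ennreal (f s * (t - s))"
proof -
  note decr_measurable[OF f, measurable]
  have "cumul f t \<le> (\<integral>\<^sup>+r. ennreal (f r) * indicator {0..s} r + ennreal (f s) * indicator {s..t} r \<partial>lborel)"
    unfolding cumul_def using s decrD(3)[OF f s(1)]
    by (intro nn_integral_mono) (auto simp: indicator_def intro!: ennreal_leI)
  also have "\<dots> = cumul f s + (\<integral>\<^sup>+r. ennreal (f s) * indicator {s..t} r \<partial>lborel)"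
    unfolding cumul_def by (rule nn_integral_add) measurable
  also have "(\<integral>\<^sup>+r. ennreal (f s) * indicator {s..t} r \<partial>lborel) = ennreal (f s * (t - s))"
    using s decrD(1)[OF f] by (simp add: nn_integral_cmult_indicator ennreal_mult)
  finally show ?thesis .
qed

lemma sum_blocks: "(\<Sum>i<k*q. c (i div q)) = real q * (\<Sum>i<k. c i :: real)"
proof (cases "q = 0")
  case False
  have "(\<Sum>i<k*q. c (i div q)) = (\<Sum>m<k. \<Sum>i\<in>{m*q..<m*q+q}. c (i div q))"
    by (rule sum.nat_group[symmetric])
  also have "\<dots> = (\<Sum>m<k. \<Sum>i\<in>{m*q..<m*q+q}. c m)"
  proof (intro sum.cong refl)
    fix m i assume "i \<in> {m*q..<m*q+q}"
    then have "i div q = m" by (intro div_nat_eqI) (auto simp: algebra_simps)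
    then show "c (i div q) = c m" by simp
  qed
  also have "\<dots> = real q * (\<Sum>i<k. c i)" by (simp add: sum_distrib_left)
  finally show ?thesis .
qed simp

text \<open>A coarse cell consists of \<open>2^(M-N)\<close> fine ones; this rewrites the coarse
  step function as a block-constant one on the fine grid.\<close>

lemma dyadic_index_div:
  assumes "0 \<le> s" "N \<le> M"
  shows "nat \<lfloor>s / (1/2^M)\<rfloor> div 2^(M-N) = nat \<lfloor>s / (1/2^N :: real)\<rfloor>"
proof -
  have "s / (1/2^N) = (s * 2^M) / of_int (2^(M-N))"
    using assms(2) by (simp add: field_simps flip: power_add)
  then have "\<lfloor>s / (1/2^N)\<rfloor> = \<lfloor>s * 2^M\<rfloor> div 2^(M-N)"
    by (metis floor_divide_real_eq_div zero_le_numeral zero_le_power)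
  then show ?thesis using assms(1) by (simp add: nat_div_distrib nat_power_eq)
qed

context fatou_symmetric_space
begin

text \<open>
  The factor \<open>c < 1\<close> makes room for replacing the integrals of \<open>g\<close> by lower sums at the finitely many
  points of the coarse grid; at the other points of the fine grid the partial sums then compare by
  concavity.
\<close>

lemma nr_dyad_le:
  assumes f: "decr \<alpha> f" and g: "decr \<alpha> g" and gE: "rE g"
    and maj: "\<And>t. 0 < t \<Longrightarrow> cumul f t \<le> cumul g t"
    and n: "ereal (real n * (1/2^N)) \<le> \<alpha>"
  shows "nr (stepf (1/2^N) n (\<lambda>i. f ((real i + 1) / 2^N))) \<le> nr g"
proof -
  define a where "a = (\<lambda>i::nat. f ((real i + 1) / 2^N))"
  let ?F = "stepf (1/2^N) n a"
  have a0: "0 \<le> a i" for i using decrD(1)[OF f] by (simp add: a_def)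
  have scaled: "c * nr ?F \<le> nr g" if c: "0 < c" "c < 1" for c
  proof -
    \<comment> \<open>\<open>L k\<close> is the integral of the coarse lower step function of
      \<open>f\<close> up to the grid point k / 2^N.\<close>
    define L where "L = (\<lambda>k. (\<Sum>i<k. a i) / 2^N)"
    have ev: "\<forall>\<^sub>F M in sequentially. ennreal (c * L k) \<le> cumul (dyad M g) (real k / 2^N)" for k
    \<comment> \<open>If the sum vanishes, the factor \<open>c\<close> opens no strict gap, but then
      the claim is trivial.\<close>
    proof (cases "L k = 0")
      case True
      then show ?thesis by simp
    next
      case False
      have "0 \<le> L k" unfolding L_def using a0 by (intro divide_nonneg_nonneg sum_nonneg) auto
      then have L0: "0 < L k" using False by linarith
      have "k \<noteq> 0" using False by (intro notI) (simp add: L_def)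
      have "ennreal (c * L k) < ennreal (L k)" using L0 c by (simp add: ennreal_less_iff)
      also have "\<dots> = cumul (dyad N f) (real k / 2^N)"
        by (simp add: cumul_dyad[OF f] L_def a_def)
      also have "\<dots> \<le> cumul f (real k / 2^N)"
        using dyad_le[OF f] by (intro cumul_mono) auto
      also have "\<dots> \<le> cumul g (real k / 2^N)" using \<open>k \<noteq> 0\<close> by (intro maj) simp
      finally have "\<forall>\<^sub>F M in sequentially. ennreal (c * L k) < cumul (dyad M g) (real k / 2^N)"
        using cumul_dyad_tendsto[OF g] by (rule order_tendstoD(1)[rotated])
      then show ?thesis by (rule eventually_mono) simp
    qed
    have "\<forall>\<^sub>F M in sequentially. N \<le> M \<and> (\<forall>k\<in>{..n}. ennreal (c * L k) \<le> cumul (dyad M g) (real k / 2^N))"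
      using ev by (intro eventually_conj eventually_ge_at_top eventually_ball_finite) auto
    then obtain M where M: "N \<le> M" "\<And>k. k \<le> n \<Longrightarrow> ennreal (c * L k) \<le> cumul (dyad M g) (real k / 2^N)"
      unfolding eventually_sequentially by auto
    define q where "q = (2::nat)^(M-N)"
    define h where "h = 1 / (2::real)^M"
    define b where "b = (\<lambda>i::nat. g ((real i + 1) / 2^M))"
    have q: "0 < q" "real q * 2^N = 2^M" using M(1) by (auto simp: q_def simp flip: power_add)
    have h: "0 < h" by (simp add: h_def)
    have b0: "0 \<le> b i" for i using decrD(1)[OF g] by (simp add: b_def)
    have bdec: "b j \<le> b i" if "i \<le> j" for i j
      unfolding b_def using that by (intro decrD(3)[OF g]) (auto simp: divide_simps)
    have grid: "real k / 2^N = real (k * q) / 2^M" for k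
    proof -
      have "real k / 2^N = (real k * real q) / (real q * 2^N)" using q(1) by simp
      then show ?thesis using q(2) by simp
    qed
    have blocks: "(\<Sum>i<k*q. c * a (i div q)) \<le> (\<Sum>i<k*q. b i)" if "k \<le> n" for k
    proof -
      have "ennreal (c * L k) \<le> ennreal ((\<Sum>i<k*q. b i) / 2^M)"
        using M(2)[OF that] unfolding grid cumul_dyad[OF g] b_def .
      then have "c * L k \<le> (\<Sum>i<k*q. b i) / 2^M"
        using b0 by (subst (asm) ennreal_le_iff) (auto intro!: divide_nonneg_nonneg sum_nonneg)
      then have "c * L k * 2^M \<le> (\<Sum>i<k*q. b i)" by (simp add: field_simps)
      moreover have "c * L k * 2^M = real q * (\<Sum>i<k. c * a i)"
        unfolding L_def q(2)[symmetric] by (simp add: sum_distrib_left[symmetric])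
      ultimately show ?thesis by (simp add: sum_blocks[where c = "\<lambda>i. c * a i"])
    qed
    have nh: "real (n * q) * h = real n * (1/2^N)"
      using grid[of n] by (simp add: h_def)
    have maj': "(\<Sum>i<k. c * a (i div q)) \<le> (\<Sum>i<k. b i)" if "k \<le> n * q" for k
      using block_partial_sums_le[of n q b "\<lambda>i. c * a i" k] bdec blocks that q by auto
    have "nr (stepf h (n*q) (\<lambda>i. c * a (i div q))) \<le> nr (stepf h (n*q) b)"
    proof (rule nr_stepf_mono[OF h])
      show "ereal (real (n * q) * h) \<le> \<alpha>" unfolding nh using n .
      fix i j :: nat assume ij: "i \<le> j"
      have "a (j div q) \<le> a (i div q)" unfolding a_def
        using div_le_mono[OF ij, of q] by (intro decrD(3)[OF f]) (auto simp: divide_simps)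
      then show "c * a (j div q) \<le> c * a (i div q)" using c by simp
    qed (use a0 b0 c maj' in auto)
    also have "\<dots> \<le> nr g"
    proof (rule rE_mono(2)[OF _ gE])
      fix s :: real assume s: "0 < s"
      show "\<bar>stepf h (n*q) b s\<bar> \<le> \<bar>g s\<bar>"
      proof (cases "s < real (n*q) * h")
        case True
        then have "stepf h (n*q) b s = dyad M g s"
          using dyad_eq_stepf[OF g, of s "n*q" M] s by (simp add: h_def b_def)
        then show ?thesis using dyad_le[OF g, of M s] dyad_nonneg[OF g, of M s] by simp
      next
        case False
        then show ?thesis by (simp add: stepf_eq[OF h])
      qed
    qed simp
    also have "stepf h (n*q) (\<lambda>i. c * a (i div q)) = (\<lambda>s. c * ?F s)"
    proof
      fix s
      show "stepf h (n*q) (\<lambda>i. c * a (i div q)) s = c * ?F s"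
        using dyadic_index_div[of s N M] M(1) nh
        by (subst stepf_eq[OF h], subst stepf_eq) (auto simp: h_def q_def)
    qed
    also have "nr (\<lambda>s. c * ?F s) = c * nr ?F"
      using c by (subst rE_scale(2)[OF stepf_rE]) auto
    finally show ?thesis .
  qed
  \<comment> \<open>The refinement \<open>M\<close>, chosen for each \<open>c\<close>, has
    disappeared from the inequality, so \<open>c\<close> may tend to 1.\<close>
  have "((\<lambda>c. c * nr ?F) \<longlongrightarrow> 1 * nr ?F) (at_left 1)" by (intro tendsto_intros)
  moreover have "\<forall>\<^sub>F c::real in at_left 1. 0 < c \<and> c < 1"
    using eventually_at_left_real[of 0 1] by simp
  then have "\<forall>\<^sub>F c in at_left 1. c * nr ?F \<le> nr g" by (rule eventually_mono) (use scaled in auto)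
  ultimately have "1 * nr ?F \<le> nr g" by (rule tendsto_upperbound) simp
  then show ?thesis by (simp add: a_def)
qed

theorem nr_mono_cumul:
  assumes f: "decr \<alpha> f" and g: "decr \<alpha> g" and fE: "rE f" and gE: "rE g"
    and maj: "\<And>t. 0 < t \<Longrightarrow> cumul f t \<le> cumul g t"
  shows "nr f \<le> nr g"
proof -
  \<comment> \<open>The grid has to stay inside the interval and yet exhaust it: it covers the unit
    interval when \<open>\<alpha> = 1\<close> and the segment up to \<open>N\<close>
    otherwise.\<close>
  define n where "n = (\<lambda>N::nat. if \<alpha> = 1 then 2^N else N * 2^N :: nat)"
  define F where "F = (\<lambda>N. stepf (1/2^N) (n N) (\<lambda>i. f ((real i + 1) / 2^N)))"
  have n: "ereal (real (n N) * (1/2^N)) \<le> \<alpha>" for N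
    using alpha by (auto simp: n_def one_ereal_def)
  have le: "nr (F N) \<le> nr g" for N
    unfolding F_def by (rule nr_dyad_le[OF f g gE maj n])
  have F0: "0 \<le> F N s" for N s
    using decrD(1)[OF f] by (simp add: F_def stepf_eq)
  have FE: "rE (F N)" for N unfolding F_def by (rule stepf_rE) simp
  define T where "T = (\<lambda>N. real (n N) / 2^N)"
  have T: "T N = (if \<alpha> = 1 then 1 else real N)" for N by (simp add: T_def n_def)
  have F_dyad: "F N s = (if s < T N then dyad N f s else 0)" if "0 < s" for N s
    using dyad_eq_stepf[OF f that, of "n N" N] that by (simp add: F_def T_def stepf_eq)
  have Finc: "incseq (\<lambda>N. F N s)" if "0 < s" for s
    using dyad_mono[OF f, of _ s] dyad_nonneg[OF f] by (intro incseq_SucI) (auto simp: F_dyad[OF that] T)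
  have lim: "AE t in leb \<alpha>. incseq (\<lambda>N. ereal (F N t)) \<and> (\<lambda>N. ereal (F N t)) \<longlonglongrightarrow> ereal (f t)"
  proof (rule AE_leb_lborel, use decr_AE_isCont[OF f] AE_lborel_singleton[of 0] in eventually_elim)
    case (elim s)
    show ?case
    proof
      assume s: "s \<in> interval \<alpha>"
      then have s0: "0 < s" using elim by (auto simp: interval_def)
      have "\<forall>\<^sub>F N in sequentially. s < T N"
      proof (cases "\<alpha> = 1")
        case False
        obtain m where "s < real m" using reals_Archimedean2 by blast
        then have "\<forall>\<^sub>F N in sequentially. s < real N"
          by (intro eventually_sequentiallyI[of m]) simp
        then show ?thesis using False by (simp add: T)
      qed (use s in \<open>auto simp: T interval_def one_ereal_def\<close>)
      then have "\<forall>\<^sub>F N in sequentially. dyad N f s = F N s" by (rule eventually_mono) (simp add: F_dyad[OF s0])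
      then have "(\<lambda>N. F N s) \<longlonglongrightarrow> f s"
        using elim s0 by (intro Lim_transform_eventually[OF dyad_tendsto[OF f]]) auto
      then show "incseq (\<lambda>N. ereal (F N s)) \<and> (\<lambda>N. ereal (F N s)) \<longlonglongrightarrow> ereal (f s)"
        using Finc[OF s0] by (auto simp: incseq_def)
    qed
  qed
  have "\<forall>N. (\<lambda>t. ereal (F N t)) \<in> pos_cone \<alpha> E"
    using FE F0 by (simp add: pos_cone_def)
  moreover have "bdd_above (range (\<lambda>N. nr (F N)))" using le by (intro bdd_aboveI2)
  ultimately have "(\<lambda>N. nr (F N)) \<longlonglongrightarrow> nr f"
    using fatou[unfolded fatou_property_def, THEN spec, THEN spec, THEN mp, of "\<lambda>N t. ereal (F N t)" "\<lambda>t. ereal (f t)"]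
      lim ereal_borel_L0[OF decr_measurable[OF f]] by blast
  then show ?thesis using le by (intro LIMSEQ_le_const2) auto
qed

lemma decr_const_indicator:
  assumes "0 \<le> c" "ereal t \<le> \<alpha>" shows "decr \<alpha> (\<lambda>s. c * indicator {0<..<t} s)"
  using assms by (auto simp: decr_def indicator_def) (metis ereal_less_eq(3) not_less order_trans)

text \<open>Only a neighbourhood of 0 can make the integral infinite, so it would be infinite over
  every initial segment. Every multiple of the indicator of (0,1/2) would then be submajorized by
  \<open>g\<close>, and \<open>nr g\<close> would bound the norms of all of them.\<close>

lemma cumul_finite:
  assumes g: "decr \<alpha> g" and gE: "rE g" shows "cumul g t < \<infinity>"
proof (rule ccontr)
  assume "\<not> ?thesis"
  then have inf: "cumul g t = \<infinity>" by (metis infinity_ennreal_def top.not_eq_extremum)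
  have all: "cumul g s = \<infinity>" if "0 < s" for s
  proof (cases "t \<le> s")
    case True
    then show ?thesis using cumul_mono_right[OF True, of g] inf by (simp add: top_unique)
  next
    case False
    then have "\<infinity> \<le> cumul g s + ennreal (g s * (t - s))" using cumul_le_add[OF g that, of t] inf by simp
    then show ?thesis by (simp add: top_unique ennreal_add_eq_top)
  qed
  have "c * phi (1/2) \<le> nr g" if "0 < c" for c
  proof -
    have "nr (\<lambda>s. c * indicator {0<..<1/2} s) \<le> nr g"
      using that all less_alpha[of "1/2"]
      by (intro nr_mono_cumul[OF decr_const_indicator g rE_scale(1)[OF indicator_rE] gE]) auto
    then show ?thesis using rE_scale(2)[OF indicator_rE] that by simp
  qed
  \<comment> \<open>This multiple of the indicator has norm \<open>nr g + 1\<close>.\<close>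
  from this[of "(nr g + 1) / phi (1/2)"] show False
    using phi_pos[of "1/2"] nrm_nonneg[OF gE] by simp
qed

end

section \<open>Order continuity of LLUKM points\<close>

definition avg :: "(real \<Rightarrow> real) \<Rightarrow> real \<Rightarrow> real" where
  "avg f t = (if 0 < t then enn2real (cumul f t) / t else 0)"

lemma avg_nonneg: "0 \<le> avg f t"
  by (simp add: avg_def)

lemma cumul_const_indicator:
  assumes "0 \<le> c" "0 < s" "0 < t"
  shows "cumul (\<lambda>r. c * indicator {0<..<s} r) t = ennreal (c * min s t)"
proof -
  have "AE r in lborel. r \<noteq> 0 \<and> r \<noteq> s \<and> r \<noteq> t"
    using AE_lborel_singleton[of 0] AE_lborel_singleton[of s] AE_lborel_singleton[of t]
    by eventually_elim auto
  then have "cumul (\<lambda>r. c * indicator {0<..<s} r) t = (\<integral>\<^sup>+r. ennreal c * indicator {0..min s t} r \<partial>lborel)"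
    unfolding cumul_def by (intro nn_integral_cong_AE, eventually_elim) (auto simp: indicator_def)
  also have "\<dots> = ennreal (c * min s t)" using assms by (intro nn_integral_const_segment) auto
  finally show ?thesis .
qed

text \<open>Dominated convergence for the indicators of level sets. The level set of
  \<open>w\<close> serves as the integrable majorant, hence the finiteness assumption.\<close>

lemma distr_fun_tendsto_0:
  assumes X: "\<And>n. X n \<in> L0 \<alpha>" and w: "w \<in> L0 \<alpha>" and fin: "distr_fun \<alpha> w l < \<infinity>" and l: "0 < l"
    and le: "\<And>n. AE t in leb \<alpha>. \<bar>X n t\<bar> \<le> \<bar>w t\<bar>"
    and lim: "AE t in leb \<alpha>. (\<lambda>n. X n t) \<longlonglongrightarrow> 0"
  shows "(\<lambda>n. distr_fun \<alpha> (X n) l) \<longlonglongrightarrow> 0"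
proof -
  let ?A = "\<lambda>z. {s \<in> interval \<alpha>. ereal l < \<bar>z s\<bar>}"
  have A: "distr_fun \<alpha> z l = (\<integral>\<^sup>+s. indicator (?A z) s \<partial>leb \<alpha>)" if "z \<in> L0 \<alpha>" for z
    using distr_set_measurable[OF that] by (simp add: distr_fun_def)
  have "(\<lambda>n. \<integral>\<^sup>+s. indicator (?A (X n)) s \<partial>leb \<alpha>) \<longlonglongrightarrow> (\<integral>\<^sup>+s. 0 \<partial>leb \<alpha>)"
  proof (rule nn_integral_dominated_convergence[where w = "indicator (?A w)"])
    show "AE s in leb \<alpha>. indicator (?A (X n)) s \<le> (indicator (?A w) s :: ennreal)" for n
      using le[of n] by eventually_elim (auto simp: indicator_def intro: less_le_trans)
    show "(\<integral>\<^sup>+s. indicator (?A w) s \<partial>leb \<alpha>) < \<infinity>" using fin A[OF w] by simp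
    show "AE s in leb \<alpha>. (\<lambda>n. indicator (?A (X n)) s) \<longlonglongrightarrow> (0 :: ennreal)"
      using lim
    proof eventually_elim
      case (elim s)
      have "(\<lambda>n. \<bar>X n s\<bar>) \<longlonglongrightarrow> \<bar>0\<bar>" using elim by (rule tendsto_abs_ereal)
      then have "\<forall>\<^sub>F n in sequentially. \<bar>X n s\<bar> < ereal l"
        using l by (intro order_tendstoD(2)) auto
      then have "\<forall>\<^sub>F n in sequentially. indicator (?A (X n)) s = (0 :: ennreal)"
        by (rule eventually_mono) (auto simp: indicator_def)
      then show ?case by (rule tendsto_eventually)
    qed
  qed (use distr_set_measurable X w in auto)
  then show ?thesis using A[OF X] by simp
qed

text \<open>Once the distribution function of \<open>X n\<close> at a small level \<open>l\<close>
  drops below \<open>t\<close>, the rearrangement at \<open>t\<close> is at most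
  \<open>l\<close>.\<close>

lemma rearr_tendsto_0:
  assumes X: "\<And>n. X n \<in> L0 \<alpha>" and w: "w \<in> L0 \<alpha>" and fin: "\<And>l. 0 < l \<Longrightarrow> distr_fun \<alpha> w l < \<infinity>"
    and le: "\<And>n. AE t in leb \<alpha>. \<bar>X n t\<bar> \<le> \<bar>w t\<bar>"
    and lim: "AE t in leb \<alpha>. (\<lambda>n. X n t) \<longlonglongrightarrow> 0" and t: "0 < t"
  shows "(\<lambda>n. rearr \<alpha> (X n) t) \<longlonglongrightarrow> 0"
proof (rule order_tendstoI)
  fix a :: ereal assume "0 < a"
  then obtain l where l: "0 < ereal l" "ereal l < a" using ereal_dense2 by blast
  have "\<forall>\<^sub>F n in sequentially. distr_fun \<alpha> (X n) l < ennreal t"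
    using distr_fun_tendsto_0[OF X w fin _ le lim, of l] l(1) t by (intro order_tendstoD(2)) auto
  then show "\<forall>\<^sub>F n in sequentially. rearr \<alpha> (X n) t < a"
  proof (rule eventually_mono)
    fix n assume "distr_fun \<alpha> (X n) l < ennreal t"
    then have "\<not> ereal l < rearr \<alpha> (X n) t" using rearr_gt_iff[OF X, of l n t] l(1) by simp
    then show "rearr \<alpha> (X n) t < a" using l(2) by (metis le_less_trans not_le)
  qed
next
  fix a :: ereal assume "a < 0"
  then show "\<forall>\<^sub>F n in sequentially. a < rearr \<alpha> (X n) t"
    using rearr_nonneg by (intro always_eventually allI) (rule less_le_trans)
qed

context fatou_symmetric_space
begin

lemma cumul_eq_avg:
  assumes "decr \<alpha> g" "rE g" "0 < t" shows "cumul g t = ennreal (avg g t * t)"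
  using cumul_finite[OF assms(1,2), of t] assms(3) by (simp add: avg_def)

lemma le_avg:
  assumes g: "decr \<alpha> g" "rE g" and f: "decr \<alpha> f" and t: "0 < t" and le: "cumul f t \<le> cumul g t"
  shows "f t \<le> avg g t"
proof -
  have "ennreal (f t * t) \<le> ennreal (avg g t * t)"
    using cumul_ge[OF f t] le cumul_eq_avg[OF g t] by simp
  then show ?thesis using t avg_nonneg[of g t] by (simp add: ennreal_le_iff)
qed

lemma avg_antimono:
  assumes g: "decr \<alpha> g" "rE g" and s: "0 < s" "s \<le> t"
  shows "avg g t \<le> avg g s"
proof -
  have "ennreal (avg g t * t) \<le> ennreal (avg g s * s) + ennreal (g s * (t - s))"
    using cumul_le_add[OF g(1) s] cumul_eq_avg[OF g] s by simp
  also have "\<dots> = ennreal (avg g s * s + g s * (t - s))"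
    using avg_nonneg[of g s] decrD(1)[OF g(1)] s by (intro ennreal_plus[symmetric]) auto
  finally have "avg g t * t \<le> avg g s * s + g s * (t - s)"
    using avg_nonneg[of g s] decrD(1)[OF g(1)] s by (subst (asm) ennreal_le_iff) auto
  also have "\<dots> \<le> avg g s * s + avg g s * (t - s)"
    using le_avg[OF g g(1) s(1)] s by (intro add_left_mono mult_right_mono) auto
  also have "\<dots> = avg g s * t" by (simp add: algebra_simps)
  finally show ?thesis using s by simp
qed

text \<open>The mass before a fixed \<open>s\<close> is finite and gets divided by \<open>t\<close>,
  while beyond \<open>s\<close> the function stays below \<open>a / 2\<close>.\<close>

lemma avg_tendsto_0:
  assumes g: "decr \<alpha> g" "rE g" and lim: "(g \<longlongrightarrow> 0) at_top"
  shows "(avg g \<longlongrightarrow> 0) at_top"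
proof (rule order_tendstoI)
  fix a :: real assume "a < 0"
  then show "\<forall>\<^sub>F t in at_top. a < avg g t"
    using avg_nonneg by (intro always_eventually allI) (rule less_le_trans)
next
  fix a :: real assume a: "0 < a"
  have "\<forall>\<^sub>F t in at_top. g t < a / 2 \<and> 0 < t"
    using a order_tendstoD(2)[OF lim, of "a/2"] eventually_gt_at_top[of 0] by (auto intro: eventually_conj)
  then obtain s where s: "g s < a / 2" "0 < s" using eventually_happens'[OF trivial_limit_at_top_linorder] by blast
  have bound: "avg g t \<le> avg g s * s / t + a / 2" if "s \<le> t" for t
  proof -
    have t: "0 < t" using that s by simp
    have "ennreal (avg g t * t) \<le> ennreal (avg g s * s) + ennreal (g s * (t - s))"
      using cumul_le_add[OF g(1) s(2) that] cumul_eq_avg[OF g] s t by simp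
    also have "\<dots> = ennreal (avg g s * s + g s * (t - s))"
      using avg_nonneg[of g s] decrD(1)[OF g(1)] s that by (intro ennreal_plus[symmetric]) auto
    finally have "avg g t * t \<le> avg g s * s + g s * (t - s)"
      using avg_nonneg[of g s] decrD(1)[OF g(1)] s that by (subst (asm) ennreal_le_iff) auto
    also have "\<dots> \<le> avg g s * s + a / 2 * t"
      using s decrD(1)[OF g(1), of s] that t by (intro add_left_mono mult_mono) auto
    finally show ?thesis using t by (simp add: field_simps)
  qed
  have "((\<lambda>t. avg g s * s / t + a / 2) \<longlongrightarrow> 0 + a / 2) at_top"
    by (intro tendsto_add tendsto_const tendsto_divide_0[OF tendsto_const] filterlim_at_top_imp_at_infinity filterlim_ident)
  then have "\<forall>\<^sub>F t in at_top. avg g s * s / t + a / 2 < a"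
    by (rule order_tendstoD(2)) (use a in simp)
  then show "\<forall>\<^sub>F t in at_top. avg g t < a"
    using eventually_ge_at_top[of s] by eventually_elim (use bound in force)
qed

section \<open>The boundary conditions in terms of real-valued functions\<close>

lemma fundamental_fun_eq: "fundamental_fun nrm t = phi t"
proof -
  have "(indicator {0<..<t} :: real \<Rightarrow> ereal) = (\<lambda>s. ereal (indicator {0<..<t} s))"
    by (auto simp: indicator_def fun_eq_iff)
  then show ?thesis by (simp add: fundamental_fun_def)
qed

lemma phi_nonneg: "0 \<le> phi t"
  using nrm_nonneg[OF indicator_rE] .

lemma fund_vanishes_at_zero_iff:
  assumes "x \<in> E"
  shows "fund_vanishes_at_zero \<alpha> nrm x \<longleftrightarrow> ((\<lambda>t. phi t * real_rearr \<alpha> x t) \<longlongrightarrow> 0) (at_right 0)"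
proof -
  have "fund_vanishes_at_zero \<alpha> nrm x \<longleftrightarrow> ((\<lambda>t. ereal (phi t * real_rearr \<alpha> x t)) \<longlongrightarrow> ereal 0) (at_right 0)"
    unfolding fund_vanishes_at_zero_def fundamental_fun_eq zero_ereal_def[symmetric]
  proof (rule tendsto_cong)
    show "\<forall>\<^sub>F t in at_right 0. ereal (phi t) * rearr \<alpha> x t = ereal (phi t * real_rearr \<alpha> x t)"
      using real_rearr_eq[OF assms, symmetric] by (auto simp: eventually_at_filter)
  qed
  then show ?thesis by (simp only: lim_ereal)
qed

lemma fund_vanishes_at_infty_iff:
  assumes "x \<in> E"
  shows "fund_vanishes_at_infty \<alpha> nrm x \<longleftrightarrow>
    (\<alpha> = \<infinity> \<longrightarrow> ((\<lambda>s. phi s * avg (real_rearr \<alpha> x) s) \<longlongrightarrow> 0) at_top)"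
proof -
  have "((\<lambda>s. ennreal (fundamental_fun nrm s) * max_rearr \<alpha> x s) \<longlongrightarrow> 0) at_top \<longleftrightarrow>
     ((\<lambda>s. ennreal (phi s * avg (real_rearr \<alpha> x) s)) \<longlongrightarrow> ennreal 0) at_top"
    unfolding ennreal_0
  proof (rule tendsto_cong)
    show "\<forall>\<^sub>F s in at_top. ennreal (fundamental_fun nrm s) * max_rearr \<alpha> x s =
        ennreal (phi s * avg (real_rearr \<alpha> x) s)"
      using eventually_gt_at_top[of 0]
    proof eventually_elim
      case (elim s)
      have "max_rearr \<alpha> x s = ennreal (avg (real_rearr \<alpha> x) s * s) / ennreal s"
        using max_rearr_eq_cumul[OF rearr_finite[OF assms]]
          cumul_eq_avg[OF real_rearr_decr[OF assms] real_rearr_rE(1)[OF assms] elim] by simp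
      also have "\<dots> = ennreal (avg (real_rearr \<alpha> x) s)"
        using elim avg_nonneg by (subst divide_ennreal) auto
      finally show ?case using phi_nonneg avg_nonneg by (simp add: fundamental_fun_eq ennreal_mult)
    qed
  qed
  also have "\<dots> \<longleftrightarrow> ((\<lambda>s. phi s * avg (real_rearr \<alpha> x) s) \<longlongrightarrow> 0) at_top"
    using phi_nonneg avg_nonneg by (intro tendsto_ennreal_iff always_eventually) auto
  finally show ?thesis by (simp only: fund_vanishes_at_infty_def)
qed

text \<open>\<open>Lim\<close> in \<open>rearr_infty\<close> is a definite description, so it
  acquires a meaning only through the existence of the limit; for a decreasing function this is the
  infimum.\<close>

lemma rearr_tendsto_INF: "(rearr \<alpha> x \<longlongrightarrow> (INF t. rearr \<alpha> x t)) at_top"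
proof (rule order_tendstoI)
  fix a assume "a < (INF t. rearr \<alpha> x t)"
  then show "\<forall>\<^sub>F t in at_top. a < rearr \<alpha> x t"
    by (intro always_eventually allI) (rule less_le_trans[OF _ INF_lower], auto)
next
  fix a assume "(INF t. rearr \<alpha> x t) < a"
  then obtain s where "rearr \<alpha> x s < a" by (auto simp: INF_less_iff)
  show "\<forall>\<^sub>F t in at_top. rearr \<alpha> x t < a"
    using eventually_ge_at_top[of s]
  proof eventually_elim
    case (elim t)
    show ?case using rearr_antimono[OF elim] \<open>rearr \<alpha> x s < a\<close> by (rule le_less_trans)
  qed
qed

lemma decr_tendsto_0_finite:
  assumes "decr \<alpha> f" "\<alpha> = 1" shows "(f \<longlongrightarrow> 0) at_top"
proof (rule tendsto_eventually)
  show "\<forall>\<^sub>F t in at_top. f t = 0"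
    using eventually_ge_at_top[of 1] by eventually_elim (use assms decrD(4) in \<open>auto simp: one_ereal_def\<close>)
qed

lemma rearr_infty_iff:
  assumes x: "x \<in> E"
  shows "rearr_infty \<alpha> x = 0 \<longleftrightarrow> (real_rearr \<alpha> x \<longlongrightarrow> 0) at_top"
proof (cases "\<alpha> = \<infinity>")
  case True
  have "(real_rearr \<alpha> x \<longlongrightarrow> 0) at_top \<longleftrightarrow> ((\<lambda>t. ereal (real_rearr \<alpha> x t)) \<longlongrightarrow> ereal 0) at_top"
    by (simp only: lim_ereal)
  also have "\<dots> \<longleftrightarrow> (rearr \<alpha> x \<longlongrightarrow> 0) at_top"
    unfolding zero_ereal_def
    by (rule tendsto_cong, rule eventually_mono[OF eventually_gt_at_top[of 0]], rule real_rearr_eq[OF x])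
  also have "\<dots> \<longleftrightarrow> (INF t. rearr \<alpha> x t) = 0"
  proof
    assume "(rearr \<alpha> x \<longlongrightarrow> 0) at_top"
    from tendsto_unique[OF trivial_limit_at_top_linorder rearr_tendsto_INF this]
    show "(INF t. rearr \<alpha> x t) = 0" .
  next
    assume "(INF t. rearr \<alpha> x t) = 0"
    then show "(rearr \<alpha> x \<longlongrightarrow> 0) at_top" using rearr_tendsto_INF[of x] by simp
  qed
  also have "\<dots> \<longleftrightarrow> rearr_infty \<alpha> x = 0"
    using tendsto_Lim[OF trivial_limit_at_top_linorder rearr_tendsto_INF[of x]] True by (simp only: rearr_infty_def simp_thms if_True)
  finally show ?thesis by simp
next
  case False
  then show ?thesis using decr_tendsto_0_finite[OF real_rearr_decr[OF x]] alpha by (auto simp: rearr_infty_def)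
qed

text \<open>From 1 on the fundamental function is at least \<open>phi 1 > 0\<close>, so x^*, which
  lies below x^**, is bounded by a multiple of the vanishing product.\<close>

lemma fund_vanishes_at_infty_imp_tendsto:
  assumes x: "x \<in> E" and v: "fund_vanishes_at_infty \<alpha> nrm x"
  shows "(real_rearr \<alpha> x \<longlongrightarrow> 0) at_top"
proof (cases "\<alpha> = \<infinity>")
  case True
  note g = real_rearr_decr[OF x] real_rearr_rE(1)[OF x]
  have lim: "((\<lambda>s. phi s * avg (real_rearr \<alpha> x) s / phi 1) \<longlongrightarrow> 0) at_top"
    using v True unfolding fund_vanishes_at_infty_iff[OF x] by (auto intro: tendsto_divide_zero)
  show ?thesis
  proof (rule tendsto_sandwich[OF _ _ tendsto_const lim])
    show "\<forall>\<^sub>F s in at_top. real_rearr \<alpha> x s \<le> phi s * avg (real_rearr \<alpha> x) s / phi 1"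
      using eventually_ge_at_top[of 1]
    proof eventually_elim
      case (elim s)
      have "phi 1 * real_rearr \<alpha> x s \<le> phi s * avg (real_rearr \<alpha> x) s"
        using le_avg[OF g g(1), of s] phi_mono[OF elim] elim phi_nonneg decrD(1)[OF g(1)] by (intro mult_mono) auto
      then show ?case using phi_pos[of 1] by (simp add: field_simps)
    qed
  qed (use decrD(1)[OF g(1)] in auto)
next
  case False
  then show ?thesis using decr_tendsto_0_finite[OF real_rearr_decr[OF x]] alpha by auto
qed

text \<open>If x^*(t) < l, the level set at \<open>l\<close> has measure at most t. This supplies
  the finiteness required for dominated convergence in \<open>distr_fun_tendsto_0\<close>.\<close>

lemma distr_fun_finite:
  assumes x: "x \<in> E" and lim: "(real_rearr \<alpha> x \<longlongrightarrow> 0) at_top" and l: "0 < l"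
  shows "distr_fun \<alpha> x l < \<infinity>"
proof -
  have "\<forall>\<^sub>F t in at_top. real_rearr \<alpha> x t < l \<and> 0 < t"
    using l order_tendstoD(2)[OF lim, of l] eventually_gt_at_top[of 0] by (auto intro: eventually_conj)
  then obtain t where t: "real_rearr \<alpha> x t < l" "0 < t"
    using eventually_happens'[OF trivial_limit_at_top_linorder] by blast
  then have "\<not> ereal l < rearr \<alpha> x t" using real_rearr_eq[OF x, of t] by (metis ereal_less_eq(3) leD less_imp_le)
  then have "distr_fun \<alpha> x l \<le> ennreal t" using rearr_gt_iff[OF E_L0[OF x], of l t] l by simp
  then show ?thesis by (rule le_less_trans) simp
qed

lemma rearr_diff:
  assumes "x \<in> E" "y \<in> E"
  shows "(\<lambda>t. rearr \<alpha> x t - rearr \<alpha> y t) \<in> E"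
    "nrm (\<lambda>t. rearr \<alpha> x t - rearr \<alpha> y t) = nr (\<lambda>t. real_rearr \<alpha> x t - real_rearr \<alpha> y t)"
proof -
  note [measurable] = rearr_measurable[OF E_L0[OF assms(1)]] rearr_measurable[OF E_L0[OF assms(2)]]
  have "rE (\<lambda>t. real_rearr \<alpha> x t + (-1) * real_rearr \<alpha> y t)"
    by (intro rE_add(1) rE_scale(1) real_rearr_rE(1) assms)
  then have "rE (\<lambda>t. real_rearr \<alpha> x t - real_rearr \<alpha> y t)" by simp
  then have "(\<lambda>t. rearr \<alpha> x t - rearr \<alpha> y t) \<in> E \<and>
    nrm (\<lambda>t. rearr \<alpha> x t - rearr \<alpha> y t) = nr (\<lambda>t. real_rearr \<alpha> x t - real_rearr \<alpha> y t)"
    using real_rearr_eq assms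
    by (intro E_cong_AE borel_imp_L0 AE_lebI) (auto simp flip: ereal_minus(1))
  then show "(\<lambda>t. rearr \<alpha> x t - rearr \<alpha> y t) \<in> E"
    "nrm (\<lambda>t. rearr \<alpha> x t - rearr \<alpha> y t) = nr (\<lambda>t. real_rearr \<alpha> x t - real_rearr \<alpha> y t)" by auto
qed

lemma submaj_nrm_le:
  assumes "x \<in> E" "y \<in> E" "submaj \<alpha> y x" shows "nrm y \<le> nrm x"
  using nr_mono_cumul[OF real_rearr_decr real_rearr_decr real_rearr_rE(1) real_rearr_rE(1), OF assms(2,1,2,1)]
    assms submaj_iff[of y x] real_rearr_rE(2) by simp

section \<open>Consequences of lower local uniform K-monotonicity\<close>

lemma LLUKM_D:
  assumes "LLUKM_point \<alpha> E nrm x" "\<And>n. X n \<in> E" "\<And>n. submaj \<alpha> (X n) x" "(\<lambda>n. nrm (X n)) \<longlonglongrightarrow> nrm x"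
  shows "(\<lambda>n. nrm (\<lambda>t. rearr \<alpha> x t - rearr \<alpha> (X n) t)) \<longlonglongrightarrow> 0"
  using assms unfolding LLUKM_point_def by (elim conjE allE[of _ X]) blast

text \<open>For a constant sequence \<open>y\<close> with the norm of \<open>x\<close> the
  convergence says that x^* - y^* has norm 0.\<close>

lemma LLUKM_imp_LKM:
  assumes "LLUKM_point \<alpha> E nrm x" shows "LKM_point \<alpha> E nrm x"
proof -
  have x: "x \<in> E" using assms by (simp add: LLUKM_point_def)
  have "nrm y < nrm x" if y: "y \<in> E" "rearr \<alpha> x \<noteq> rearr \<alpha> y" "submaj \<alpha> y x" for y
  proof (rule ccontr)
    assume "\<not> ?thesis"
    then have "nrm y = nrm x" using submaj_nrm_le[OF x y(1,3)] by simp
    then have "(\<lambda>n::nat. nrm (\<lambda>t. rearr \<alpha> x t - rearr \<alpha> y t)) \<longlonglongrightarrow> 0"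
      using y by (intro LLUKM_D[OF assms]) auto
    then have "nrm (\<lambda>t. rearr \<alpha> x t - rearr \<alpha> y t) = 0" by (simp add: LIMSEQ_const_iff)
    then have "AE t in leb \<alpha>. rearr \<alpha> x t - rearr \<alpha> y t = 0"
      using norm_zero_iff[OF rearr_diff(1)[OF x y(1)]] by simp
    then have eq: "AE t in leb \<alpha>. \<bar>rearr \<alpha> x t\<bar> = \<bar>rearr \<alpha> y t\<bar>"
      using AE_leb_pos
    proof eventually_elim
      case (elim t)
      then show ?case using rearr_finite[OF x, of t] rearr_finite[OF y(1), of t] rearr_nonneg[of \<alpha> x t] rearr_nonneg[of \<alpha> y t]
        by (cases "rearr \<alpha> x t"; cases "rearr \<alpha> y t") auto
    qed
    \<comment> \<open>The rearrangements have to agree at every point, but so far they agree only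
      a.e. Distribution functions repair this, since a function shares its distribution function
      with its rearrangement.\<close>
    have "distr_fun \<alpha> (rearr \<alpha> x) = distr_fun \<alpha> (rearr \<alpha> y)"
      by (rule distr_fun_cong_AE[OF _ _ eq]) (intro borel_imp_L0 rearr_measurable E_L0 x y(1))+
    then show False using y(2) rearr_cong_distr[of \<alpha> x y] x y(1) by (simp add: distr_fun_rearr E_L0)
  qed
  then show ?thesis using x by (auto simp: LKM_point_def)
qed

text \<open>Cutting in height and in abscissa keeps a decreasing function decreasing, so the result
  is a.e. its own rearrangement.\<close>

definition trunc :: "nat \<Rightarrow> (real \<Rightarrow> real) \<Rightarrow> real \<Rightarrow> real" where
  "trunc n g t = min (g t) (real n) * indicator {0<..real n} t"

lemma trunc_decr: "decr \<alpha> g \<Longrightarrow> decr \<alpha> (trunc n g)"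
  unfolding decr_def trunc_def by (auto simp: indicator_def min_le_iff_disj)

lemma trunc_bounds: "decr \<alpha> g \<Longrightarrow> 0 \<le> trunc n g t" "decr \<alpha> g \<Longrightarrow> trunc n g t \<le> g t"
  unfolding trunc_def using decrD(1)[of \<alpha> g t] by (auto simp: indicator_def)

lemma trunc_abs_le:
  assumes "decr \<alpha> g" shows "\<bar>trunc n g t\<bar> \<le> \<bar>g t\<bar>"
  using trunc_bounds[OF assms, of n t] by linarith

lemma trunc_rE: "decr \<alpha> g \<Longrightarrow> rE g \<Longrightarrow> rE (trunc n g)"
  by (rule rE_mono(1)[OF decr_measurable[OF trunc_decr] _ trunc_abs_le])

lemma nr_trunc_tendsto:
  assumes g: "decr \<alpha> g" "rE g" shows "(\<lambda>n. nr (trunc n g)) \<longlonglongrightarrow> nr g"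
proof -
  have "\<forall>n. (\<lambda>t. ereal (trunc n g t)) \<in> pos_cone \<alpha> E"
    using trunc_rE[OF g] trunc_bounds(1)[OF g(1)] by (simp add: pos_cone_def)
  moreover have "nr (trunc n g) \<le> nr g" for n
    by (rule rE_mono(2)[OF decr_measurable[OF trunc_decr[OF g(1)]] g(2) trunc_abs_le[OF g(1)]])
  then have "bdd_above (range (\<lambda>n. nr (trunc n g)))" by (intro bdd_aboveI2)
  moreover have "AE t in leb \<alpha>. incseq (\<lambda>n. ereal (trunc n g t)) \<and> (\<lambda>n. ereal (trunc n g t)) \<longlonglongrightarrow> ereal (g t)"
  proof (rule AE_lebI)
    fix t :: real assume t: "0 < t"
    have "incseq (\<lambda>n. ereal (trunc n g t))"
      using decrD(1)[OF g(1), of t] by (intro incseq_SucI) (auto simp: trunc_def indicator_def)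
    moreover obtain m where "max t (g t) < real m" using reals_Archimedean2 by blast
    then have "\<forall>\<^sub>F n in sequentially. trunc n g t = g t"
      using t by (intro eventually_sequentiallyI[of m]) (auto simp: trunc_def indicator_def)
    then have "(\<lambda>n. ereal (trunc n g t)) \<longlonglongrightarrow> ereal (g t)"
      by (intro tendsto_eventually) (auto elim: eventually_mono)
    ultimately show "incseq (\<lambda>n. ereal (trunc n g t)) \<and> (\<lambda>n. ereal (trunc n g t)) \<longlonglongrightarrow> ereal (g t)" by simp
  qed
  ultimately show ?thesis
    using fatou[unfolded fatou_property_def, THEN spec, THEN spec, THEN mp, of "\<lambda>n t. ereal (trunc n g t)" "\<lambda>t. ereal (g t)"]
      E_L0[OF g(2)] by blast
qed

lemma nr_diff_real_rearr:
  assumes x: "x \<in> E" and f: "decr \<alpha> f" "rE f"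
  shows "nrm (\<lambda>t. rearr \<alpha> x t - rearr \<alpha> (\<lambda>s. ereal (f s)) t) = nr (\<lambda>t. real_rearr \<alpha> x t - f t)"
proof -
  note [measurable] = decr_measurable[OF real_rearr_decr[OF x]] decr_measurable[OF real_rearr_decr[OF f(2)]]
  have "AE t in leb \<alpha>. real_rearr \<alpha> (\<lambda>s. ereal (f s)) t = f t"
    using real_rearr_of_decr[OF f(1)] AE_lborel_singleton[of 0]
    by (intro AE_leb_lborel, eventually_elim) (auto simp: interval_def)
  then have ae: "AE t in leb \<alpha>. ereal (real_rearr \<alpha> x t - real_rearr \<alpha> (\<lambda>s. ereal (f s)) t)
     = ereal (real_rearr \<alpha> x t - f t)" by eventually_elim simp
  have "rE (\<lambda>t. real_rearr \<alpha> x t + (-1) * f t)"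
    by (intro rE_add(1) rE_scale(1) real_rearr_rE(1) x f)
  then have "rE (\<lambda>t. real_rearr \<alpha> x t - f t)" by simp
  then have "nr (\<lambda>t. real_rearr \<alpha> x t - real_rearr \<alpha> (\<lambda>s. ereal (f s)) t) = nr (\<lambda>t. real_rearr \<alpha> x t - f t)"
    using E_cong_AE[OF ereal_borel_L0 _ ae] by auto
  then show ?thesis using rearr_diff(2)[OF x f(2)] by simp
qed

lemma LLUKM_trunc:
  assumes "LLUKM_point \<alpha> E nrm x"
  shows "(\<lambda>n. nr (\<lambda>t. real_rearr \<alpha> x t - trunc n (real_rearr \<alpha> x) t)) \<longlonglongrightarrow> 0"
proof -
  have x: "x \<in> E" using assms by (simp add: LLUKM_point_def)
  note g = real_rearr_decr[OF x] real_rearr_rE(1)[OF x]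
  let ?X = "\<lambda>n t. ereal (trunc n (real_rearr \<alpha> x) t)"
  have "submaj \<alpha> (?X n) x" for n
    using trunc_bounds(2)[OF g(1)]
    by (auto simp: submaj_iff[OF trunc_rE[OF g] x] cumul_real_rearr_of_decr[OF trunc_decr[OF g(1)]] intro!: cumul_mono)
  moreover have "(\<lambda>n. nrm (?X n)) \<longlonglongrightarrow> nrm x"
    using nr_trunc_tendsto[OF g] real_rearr_rE(2)[OF x] by simp
  ultimately have "(\<lambda>n. nrm (\<lambda>t. rearr \<alpha> x t - rearr \<alpha> (?X n) t)) \<longlonglongrightarrow> 0"
    using trunc_rE[OF g] by (intro LLUKM_D[OF assms])
  then show ?thesis
    by (simp only: nr_diff_real_rearr[OF x trunc_decr[OF g(1)] trunc_rE[OF g]])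
qed

text \<open>The common pattern of both order continuity arguments. A part \<open>u\<close>, small
  uniformly in \<open>k\<close>, takes care of 0 and of infinity; in between the decreasing
  \<open>f k\<close> is at most \<open>f k d\<close>, a constant on a fixed bounded segment that
  tends to 0.\<close>

lemma nr_tendsto_0_split:
  assumes f: "\<And>k. decr \<alpha> (f k)" "\<And>k. rE (f k)" and lim: "\<And>t. 0 < t \<Longrightarrow> (\<lambda>k. f k t) \<longlonglongrightarrow> 0"
    and split: "\<And>e. 0 < e \<Longrightarrow> \<exists>d>0. \<exists>T. \<forall>k. \<exists>u. rE u \<and> nr u \<le> e \<and>
        (\<forall>t>0. f k t \<le> u t + f k d * indicator {0<..<T} t)"
  shows "(\<lambda>k. nr (f k)) \<longlonglongrightarrow> 0"
proof (rule LIMSEQ_I)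
  fix r :: real assume r: "0 < r"
  obtain d T where d: "0 < d" and u: "\<forall>k. \<exists>u. rE u \<and> nr u \<le> r / 2 \<and>
        (\<forall>t>0. f k t \<le> u t + f k d * indicator {0<..<T} t)"
    using split[of "r/2"] r by auto
  have le: "nr (f k) \<le> r / 2 + f k d * phi T" for k
  proof -
    obtain u where u: "rE u" "nr u \<le> r / 2" "\<And>t. 0 < t \<Longrightarrow> f k t \<le> u t + f k d * indicator {0<..<T} t"
      using u by meson
    have v: "rE (\<lambda>t. f k d * indicator {0<..<T} t)" by (rule rE_scale(1)[OF indicator_rE])
    have "nr (f k) \<le> nr (\<lambda>t. u t + f k d * indicator {0<..<T} t)"
      using u(3) decrD(1)[OF f(1)] by (intro rE_mono(2) decr_measurable[OF f(1)] rE_add(1) u v) (metis abs_ge_self abs_of_nonneg order_trans)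
    also have "\<dots> \<le> nr u + nr (\<lambda>t. f k d * indicator {0<..<T} t)" by (rule rE_add(2)[OF u(1) v])
    also have "nr (\<lambda>t. f k d * indicator {0<..<T} t) = f k d * phi T"
      using rE_scale(2)[OF indicator_rE] decrD(1)[OF f(1)] by simp
    finally show ?thesis using u(2) by simp
  qed
  have "(\<lambda>k. f k d * phi T) \<longlonglongrightarrow> 0 * phi T" by (intro tendsto_intros lim d)
  then have "\<forall>\<^sub>F k in sequentially. f k d * phi T < r / 2" using r by (intro order_tendstoD(2)) auto
  then show "\<exists>no. \<forall>k\<ge>no. norm (nr (f k) - 0) < r"
    unfolding eventually_sequentially
  proof (elim exE, intro exI allI impI)
    fix N k assume "\<forall>n\<ge>N. f n d * phi T < r / 2" "N \<le> k"
    then have "f k d * phi T < r / 2" by simp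
    then show "norm (nr (f k) - 0) < r" using le[of k] nrm_nonneg[OF f(2), of k] by simp
  qed
qed

lemma LLUKM_imp_order_cont:
  assumes L: "LLUKM_point \<alpha> E nrm x" and z: "fund_vanishes_at_zero \<alpha> nrm x" and i: "fund_vanishes_at_infty \<alpha> nrm x"
  shows "order_cont_point \<alpha> E nrm x"
proof -
  have x: "x \<in> E" using L by (simp add: LLUKM_point_def)
  define g where "g = real_rearr \<alpha> x"
  have g: "decr \<alpha> g" "rE g" using real_rearr_decr[OF x] real_rearr_rE(1)[OF x] by (auto simp: g_def)
  have ginf: "(g \<longlongrightarrow> 0) at_top" using fund_vanishes_at_infty_imp_tendsto[OF x i] by (simp add: g_def)
  have "(\<lambda>n. nrm (X n)) \<longlonglongrightarrow> 0"
    if X: "\<And>n. X n \<in> pos_cone \<alpha> E" "\<And>n. AE t in leb \<alpha>. X n t \<le> \<bar>x t\<bar>" and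
      lim: "AE t in leb \<alpha>. (\<lambda>n. X n t) \<longlonglongrightarrow> 0" for X
  proof -
    have XE: "X n \<in> E" for n using X(1) by (simp add: pos_cone_def)
    have Xle: "AE t in leb \<alpha>. \<bar>X n t\<bar> \<le> \<bar>x t\<bar>" for n
    proof -
      have "AE t in leb \<alpha>. 0 \<le> X n t" using X(1)[of n] by (simp add: pos_cone_def)
      then show ?thesis using X(2)[of n] by eventually_elim simp
    qed
    define f where "f = (\<lambda>n. real_rearr \<alpha> (X n))"
    have f: "decr \<alpha> (f n)" "rE (f n)" "nr (f n) = nrm (X n)" for n
      using real_rearr_decr[OF XE] real_rearr_rE[OF XE] by (auto simp: f_def)
    have fg: "f n t \<le> g t" if "0 < t" for n t
    proof -
      have "ereal (f n t) \<le> ereal (g t)"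
        using real_rearr_eq[OF XE that] real_rearr_eq[OF x that] rearr_mono[OF E_L0[OF x] Xle, of n t]
        by (simp add: f_def g_def)
      then show ?thesis by simp
    qed
    have flim: "(\<lambda>n. f n t) \<longlonglongrightarrow> 0" if t: "0 < t" for t
    proof -
      have "(\<lambda>n. rearr \<alpha> (X n) t) \<longlonglongrightarrow> 0"
        using distr_fun_finite[OF x ginf[unfolded g_def]] Xle lim t
        by (intro rearr_tendsto_0[where w = x] E_L0 XE x) auto
      then have "(\<lambda>n. ereal (f n t)) \<longlonglongrightarrow> ereal 0"
        using real_rearr_eq[OF XE t] by (simp add: f_def zero_ereal_def)
      then show ?thesis by (simp only: lim_ereal)
    qed
    have "(\<lambda>n. nr (f n)) \<longlonglongrightarrow> 0"
    proof (rule nr_tendsto_0_split[OF f(1,2) flim])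
      fix e :: real assume e: "0 < e"
      define W where "W = (\<lambda>n t. g t - trunc n g t)"
      have WE: "rE (W n)" for n
      proof (rule rE_mono(1)[OF _ g(2)])
        show "W n \<in> borel_measurable borel"
          unfolding W_def using decr_measurable[OF g(1)] decr_measurable[OF trunc_decr[OF g(1)]]
          by (intro borel_measurable_diff)
        show "\<bar>W n t\<bar> \<le> \<bar>g t\<bar>" for t
          using trunc_bounds[OF g(1), of n t] unfolding W_def by linarith
      qed
      have "\<forall>\<^sub>F n in sequentially. nr (W n) < e / 2"
        using LLUKM_trunc[OF L] e by (intro order_tendstoD(2)[of _ 0]) (auto simp: W_def g_def)
      then obtain n where n: "nr (W n) < e / 2" using eventually_happens'[OF trivial_limit_sequentially] by blast
      show "\<exists>d>0. \<exists>T. \<forall>k. \<exists>u. rE u \<and> nr u \<le> e \<and> (\<forall>t>0. f k t \<le> u t + f k d * indicator {0<..<T} t)"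
      \<comment> \<open>What the truncation keeps near 0 has height at most \<open>n\<close>, so its
        restriction to (0,d) has norm at most \<open>real n * phi d\<close>.\<close>
      proof (cases "\<exists>d>0. real n * phi d < e / 2")
        case True
        then obtain d where d: "0 < d" "real n * phi d < e / 2" by auto
        let ?u = "\<lambda>t. W n t + real n * indicator {0<..<d} t"
        have v: "rE (\<lambda>t. real n * indicator {0<..<d} t)" by (rule rE_scale(1)[OF indicator_rE])
        have "nr ?u \<le> nr (W n) + real n * phi d"
          using rE_add(2)[OF WE v] rE_scale(2)[OF indicator_rE] by simp
        then have "nr ?u \<le> e" using n d by simp
        \<comment> \<open>The flat piece extends to \<open>n + 1\<close> because the open interval
          has to contain the point \<open>n\<close>.\<close>
        moreover have "f k t \<le> ?u t + f k d * indicator {0<..<real n + 1} t" if t: "0 < t" for k t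
        proof -
          have W0: "0 \<le> W n t" using trunc_bounds(2)[OF g(1)] by (simp add: W_def)
          have fd: "0 \<le> f k d" using decrD(1)[OF f(1)] .
          consider "real n < t" | "t < d" "t \<le> real n" | "d \<le> t" "t \<le> real n" by linarith
          then show ?thesis
          proof cases
            case 1
            then have "W n t = g t" by (simp add: W_def trunc_def)
            moreover have "0 \<le> f k d * indicator {0<..<real n + 1} t" using fd by simp
            ultimately show ?thesis using fg[OF t, of k] by (simp add: add_increasing2)
          next
            case 2
            then have "g t \<le> W n t + real n" using t by (simp add: W_def trunc_def)
            then show ?thesis using fg[OF t, of k] 2 t fd by simp
          next
            case 3
            then have "f k t \<le> f k d" using decrD(3)[OF f(1) d(1)] by blast
            then show ?thesis using 3 W0 d(1) by simp
          qed
        qed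
        ultimately show ?thesis using d(1) rE_add(1)[OF WE v]
          by (intro exI[of _ d] conjI exI[of _ "real n + 1"] allI exI[of _ ?u] impI)
      next
        case False
        \<comment> \<open>Here \<open>phi\<close> is bounded below by a positive constant, so the
          condition at 0 forces x^*(t) to tend to 0 as t tends to 0, and a decreasing x^* must then
          vanish.\<close>
        then have ph0: "e / 2 \<le> real n * phi d" if "0 < d" for d
          using that not_less by blast
        have n0: "0 < real n" using ph0[of 1] e by (cases n) auto
        have ph: "e / (2 * real n) \<le> phi d" if "0 < d" for d
          using ph0[OF that] n0 by (simp add: field_simps)
        define c where "c = e / (2 * real n)"
        have c: "0 < c" using e n0 by (simp add: c_def)
        have "((\<lambda>t. phi t * g t) \<longlongrightarrow> 0) (at_right 0)"
          using z unfolding fund_vanishes_at_zero_iff[OF x] g_def .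
        then have glim: "((\<lambda>t. phi t * g t / c) \<longlongrightarrow> 0) (at_right 0)" by (rule tendsto_divide_zero)
        have g0: "g t = 0" if t: "0 < t" for t
        proof -
          have "\<forall>\<^sub>F s in at_right 0. g t \<le> phi s * g s / c"
            using eventually_at_right_real[OF t]
          proof eventually_elim
            case (elim s)
            then have "c * g t \<le> phi s * g s"
              using ph[of s] decrD(1,3)[OF g(1)] c phi_nonneg by (intro mult_mono) (auto simp: c_def)
            then show ?case using c by (simp add: field_simps)
          qed
          then have "g t \<le> 0" by (rule tendsto_lowerbound[OF glim]) simp
          then show ?thesis using decrD(1)[OF g(1), of t] by simp
        qed
        have "f k t = 0" for k t
          using fg[of t k] g0[of t] decrD(1,2)[OF f(1)[of k], of t] by (cases "0 < t") auto
        then show ?thesis using WE[of n] n e by (intro exI[of _ 1] conjI exI[of _ 0] allI exI[of _ "W n"])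
            (auto simp: W_def trunc_bounds(2)[OF g(1)])
      qed
    qed
    then show ?thesis by (simp add: f(3))
  qed
  then show ?thesis using x by (auto simp: order_cont_point_def)
qed

end

section \<open>From order continuity to K-order continuity\<close>

lemma distr_fun_neg: "l < 0 \<Longrightarrow> distr_fun \<alpha> z l = emeasure (leb \<alpha>) (interval \<alpha>)"
proof -
  assume "l < 0"
  then have "ereal l < \<bar>z s\<bar>" for s by (cases "z s") auto
  then show ?thesis by (simp add: distr_fun_def)
qed

text \<open>The excess over a level is determined, up to equimeasurability, by the distribution
  function. Hence the excesses of |x| and of x^* are equimeasurable; caps behave alike in
  \<open>distr_fun_cap\<close>.\<close>

lemma distr_fun_excess:
  assumes "0 \<le> l" shows "distr_fun \<alpha> (\<lambda>t. max (\<bar>z t\<bar> - ereal m) 0) l = distr_fun \<alpha> z (m + l)"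
proof -
  have "ereal l < \<bar>max (\<bar>v\<bar> - ereal m) 0\<bar> \<longleftrightarrow> ereal (m + l) < \<bar>v\<bar>" for v :: ereal
    using assms by (cases v) (auto simp: max_def zero_ereal_def)
  then show ?thesis by (simp add: distr_fun_def)
qed

lemma distr_fun_cap:
  assumes "0 \<le> l" "0 \<le> c"
  shows "distr_fun \<alpha> (\<lambda>t. min \<bar>z t\<bar> (ereal c)) l = (if l < c then distr_fun \<alpha> z l else 0)"
proof -
  have "ereal l < \<bar>min \<bar>v\<bar> (ereal c)\<bar> \<longleftrightarrow> l < c \<and> ereal l < \<bar>v\<bar>" for v :: ereal
    using assms by (cases v) (auto simp: min_def)
  then show ?thesis by (simp add: distr_fun_def)
qed

lemma cumul_split:
  assumes [measurable]: "f \<in> borel_measurable borel" and s: "0 \<le> s" "s \<le> t"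
  shows "cumul f t = cumul f s + cumul (\<lambda>r. f r * indicator {s..} r) t"
proof -
  have "cumul f t = (\<integral>\<^sup>+r. ennreal (f r) * indicator {0..s} r + ennreal (f r * indicator {s..} r) * indicator {0..t} r \<partial>lborel)"
    unfolding cumul_def
    by (intro nn_integral_cong_AE, use AE_lborel_singleton[of s] in eventually_elim)
      (use s in \<open>auto simp: indicator_def\<close>)
  also have "\<dots> = cumul f s + cumul (\<lambda>r. f r * indicator {s..} r) t"
    unfolding cumul_def by (rule nn_integral_add) measurable
  finally show ?thesis .
qed

lemma cumul_restrict:
  assumes "0 < d"
  shows "cumul (\<lambda>r. f r * indicator {0<..<d} r) t = cumul f (min t d)"
proof -
  have "AE r in lborel. r \<noteq> 0 \<and> r \<noteq> d"
    using AE_lborel_singleton[of 0] AE_lborel_singleton[of d] by eventually_elim auto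
  then show ?thesis
    unfolding cumul_def
    by (intro nn_integral_cong_AE, eventually_elim) (auto simp: indicator_def)
qed

context fatou_symmetric_space
begin

section \<open>Order continuity carried over from |x| to x^*\<close>

lemma order_cont_D:
  assumes "order_cont_point \<alpha> E nrm x" "\<And>n. X n \<in> L0 \<alpha>" "\<And>n t. 0 \<le> X n t" "\<And>n t. X n t \<le> \<bar>x t\<bar>"
    "AE t in leb \<alpha>. (\<lambda>n. X n t) \<longlonglongrightarrow> 0"
  shows "\<And>n. X n \<in> E" "(\<lambda>n. nrm (X n)) \<longlonglongrightarrow> 0"
proof -
  have x: "x \<in> E" using assms(1) by (simp add: order_cont_point_def)
  show E: "X n \<in> E" for n
    using ideal[OF assms(2) x, of n] assms(3,4) by (simp add: abs_of_nonneg)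
  have "\<forall>n. X n \<in> pos_cone \<alpha> E" using E assms(3) by (simp add: pos_cone_def)
  moreover have "\<forall>n. AE t in leb \<alpha>. X n t \<le> \<bar>x t\<bar>" using assms(4) by simp
  ultimately show "(\<lambda>n. nrm (X n)) \<longlonglongrightarrow> 0"
    using assms(1,5) unfolding order_cont_point_def by (elim conjE allE[of _ X]) blast
qed

lemma nr_eq_of_distr:
  assumes x: "x \<in> E" and X: "X \<in> E" and h: "h \<in> borel_measurable borel"
    and Y: "Y \<in> L0 \<alpha>" and d: "distr_fun \<alpha> Y = distr_fun \<alpha> X"
    and eq: "\<And>t. 0 < t \<Longrightarrow> ereal (h t) = Y t"
  shows "rE h" "nr h = nrm X"
  using symmetric[OF Y X d] E_cong_AE[OF ereal_borel_L0[OF h], of Y] eq AE_lebI by auto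

text \<open>The excess of |x| over \<open>m\<close> lies below |x| and vanishes for large
  \<open>m\<close> wherever \<open>x\<close> is finite; the excess of x^* is equimeasurable with it.
  This controls x^* near 0.\<close>

lemma order_cont_excess:
  assumes oc: "order_cont_point \<alpha> E nrm x"
  shows "\<And>m. rE (\<lambda>t. max (real_rearr \<alpha> x t - real m) 0)"
    "(\<lambda>m. nr (\<lambda>t. max (real_rearr \<alpha> x t - real m) 0)) \<longlonglongrightarrow> 0"
proof -
  have x: "x \<in> E" using oc by (simp add: order_cont_point_def)
  have [measurable]: "x \<in> borel_measurable (leb \<alpha>)" using E_L0[OF x] by (simp add: L0_def)
  note [measurable] = rearr_measurable[OF E_L0[OF x]] decr_measurable[OF real_rearr_decr[OF x]]
  define X where "X = (\<lambda>(m::nat) t. max (\<bar>x t\<bar> - ereal (real m)) 0)"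
  have XL: "X m \<in> L0 \<alpha>" for m unfolding X_def L0_def by measurable
  have X0: "0 \<le> X m t" for m t by (simp add: X_def)
  have Xle: "X m t \<le> \<bar>x t\<bar>" for m t
    unfolding X_def by (cases "x t") (auto simp: zero_ereal_def)
  have Xlim: "AE t in leb \<alpha>. (\<lambda>m. X m t) \<longlonglongrightarrow> 0"
    using finite_AE[OF x]
  proof eventually_elim
    case (elim t)
    then obtain r where r: "\<bar>x t\<bar> = ereal r" by (cases "x t") auto
    obtain m where "r < real m" using reals_Archimedean2 by blast
    then have "\<forall>\<^sub>F n in sequentially. X n t = 0"
      by (intro eventually_sequentiallyI[of m]) (auto simp: X_def r zero_ereal_def)
    then show ?case by (rule tendsto_eventually)
  qed
  note X = order_cont_D[OF oc XL X0 Xle Xlim]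
  have "rE (\<lambda>t. max (real_rearr \<alpha> x t - real m) 0) \<and> nr (\<lambda>t. max (real_rearr \<alpha> x t - real m) 0) = nrm (X m)" for m
  proof -
    define Y where "Y = (\<lambda>t. max (\<bar>rearr \<alpha> x t\<bar> - ereal (real m)) 0)"
    have "Y \<in> L0 \<alpha>" unfolding Y_def by (rule borel_imp_L0) measurable
    moreover have "distr_fun \<alpha> Y l = distr_fun \<alpha> (X m) l" for l
      by (cases "0 \<le> l") (simp_all add: Y_def X_def distr_fun_excess distr_fun_rearr[OF E_L0[OF x]] distr_fun_neg)
    moreover have "ereal (max (real_rearr \<alpha> x t - real m) 0) = Y t" if "0 < t" for t
      using rearr_nonneg[of \<alpha> x t] by (simp add: Y_def real_rearr_eq[OF x that, symmetric] max_def zero_ereal_def)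
    ultimately show ?thesis
      by (intro conjI nr_eq_of_distr[OF x X(1), of _ Y m] ext) auto
  qed
  then show "\<And>m. rE (\<lambda>t. max (real_rearr \<alpha> x t - real m) 0)"
    "(\<lambda>m. nr (\<lambda>t. max (real_rearr \<alpha> x t - real m) 0)) \<longlonglongrightarrow> 0"
    using X(2) by auto
qed

text \<open>The counterpart for small values: the caps lie below |x| and tend to 0 everywhere. This
  controls x^* near infinity.\<close>

lemma order_cont_cap:
  assumes oc: "order_cont_point \<alpha> E nrm x"
  shows "\<And>m. rE (\<lambda>t. min (real_rearr \<alpha> x t) (1 / real (Suc m)))"
    "(\<lambda>m. nr (\<lambda>t. min (real_rearr \<alpha> x t) (1 / real (Suc m)))) \<longlonglongrightarrow> 0"
proof -
  have x: "x \<in> E" using oc by (simp add: order_cont_point_def)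
  have [measurable]: "x \<in> borel_measurable (leb \<alpha>)" using E_L0[OF x] by (simp add: L0_def)
  note [measurable] = rearr_measurable[OF E_L0[OF x]] decr_measurable[OF real_rearr_decr[OF x]]
  define X where "X = (\<lambda>m t. min \<bar>x t\<bar> (ereal (1 / real (Suc m))))"
  have XL: "X m \<in> L0 \<alpha>" for m unfolding X_def L0_def by measurable
  have X0: "0 \<le> X m t" for m t by (simp add: X_def)
  have Xle: "X m t \<le> \<bar>x t\<bar>" for m t by (simp add: X_def)
  have Xlim: "AE t in leb \<alpha>. (\<lambda>m. X m t) \<longlonglongrightarrow> 0"
  proof (intro always_eventually allI)
    fix t
    have lim: "(\<lambda>m. ereal (1 / real (Suc m))) \<longlonglongrightarrow> 0"
      unfolding lim_ereal zero_ereal_def using LIMSEQ_Suc[OF lim_1_over_n] .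
    show "(\<lambda>m. X m t) \<longlonglongrightarrow> 0"
    proof (rule tendsto_sandwich[OF _ _ tendsto_const lim])
      show "\<forall>\<^sub>F n in sequentially. 0 \<le> X n t" by (intro always_eventually allI X0)
      show "\<forall>\<^sub>F n in sequentially. X n t \<le> ereal (1 / real (Suc n))"
        unfolding X_def by (intro always_eventually allI min.cobounded2)
    qed
  qed
  note X = order_cont_D[OF oc XL X0 Xle Xlim]
  have "rE (\<lambda>t. min (real_rearr \<alpha> x t) (1 / real (Suc m))) \<and> nr (\<lambda>t. min (real_rearr \<alpha> x t) (1 / real (Suc m))) = nrm (X m)" for m
  proof -
    define Y where "Y = (\<lambda>t. min \<bar>rearr \<alpha> x t\<bar> (ereal (1 / real (Suc m))))"
    have "Y \<in> L0 \<alpha>" unfolding Y_def by (rule borel_imp_L0) measurable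
    moreover have "distr_fun \<alpha> Y l = distr_fun \<alpha> (X m) l" for l
      by (cases "0 \<le> l") (simp_all add: Y_def X_def distr_fun_cap distr_fun_rearr[OF E_L0[OF x]] distr_fun_neg)
    moreover have "ereal (min (real_rearr \<alpha> x t) (1 / real (Suc m))) = Y t" if "0 < t" for t
      using decrD(1)[OF real_rearr_decr[OF x], of t] by (simp add: Y_def real_rearr_eq[OF x that, symmetric] min_def)
    ultimately show ?thesis
      by (intro conjI nr_eq_of_distr[OF x X(1), of _ Y m] ext) auto
  qed
  then show "\<And>m. rE (\<lambda>t. min (real_rearr \<alpha> x t) (1 / real (Suc m)))"
    "(\<lambda>m. nr (\<lambda>t. min (real_rearr \<alpha> x t) (1 / real (Suc m)))) \<longlonglongrightarrow> 0"
    using X(2) by auto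
qed

text \<open>Let \<open>a\<close> be the infimum of those r for which \<open>A\<close> has positive
  measure up to r. Then \<open>A\<close> has no mass up to \<open>a\<close> but some in every right
  neighbourhood. Leaving out \<open>a\<close> itself makes these neighbourhoods shrink to the empty
  set.\<close>

lemma shrinking_subsets:
  assumes A: "A \<in> sets (leb \<alpha>)" and pos: "emeasure (leb \<alpha>) A \<noteq> 0"
  shows "\<exists>a. \<forall>n. emeasure (leb \<alpha>) (A \<inter> {a<..a + 1 / real (Suc n)}) \<noteq> 0"
proof -
  have I: "A \<subseteq> {0..}" using sets.sets_into_space[OF A] by (auto simp: interval_def)
  have bs: "A \<inter> B \<in> sets (leb \<alpha>)" if "B \<in> sets borel" for B
  proof -
    have "A \<inter> B = A \<inter> (B \<inter> interval \<alpha>)" using sets.sets_into_space[OF A] by auto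
    moreover have "B \<inter> interval \<alpha> \<in> sets (leb \<alpha>)"
      using that by (auto simp: sets_restrict_space_iff)
    ultimately show ?thesis using A by (metis sets.Int)
  qed
  let ?M = "\<lambda>B. emeasure (leb \<alpha>) (A \<inter> B)"
  define S where "S = {r. ?M {..r} \<noteq> 0}"
  have S_lower: "bdd_below S"
  proof (rule bdd_belowI)
    fix r assume "r \<in> S"
    then have "A \<inter> {..r} \<noteq> {}" by (auto simp: S_def)
    then show "0 \<le> r" using I by force
  qed
  have Sne: "S \<noteq> {}"
  proof
    assume "S = {}"
    then have "\<And>n::nat. A \<inter> {..real n} \<in> null_sets (leb \<alpha>)" using bs by (auto simp: S_def null_sets_def)
    then have "(\<Union>n::nat. A \<inter> {..real n}) \<in> null_sets (leb \<alpha>)" by (rule null_sets_UN)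
    moreover have "(\<Union>n::nat. A \<inter> {..real n}) = A" using real_arch_simple by auto
    ultimately show False using pos by auto
  qed
  define a where "a = Inf S"
  have "A \<inter> {..a - 1 / real (Suc n)} \<in> null_sets (leb \<alpha>)" for n
  proof -
    have "a - 1 / real (Suc n) \<notin> S"
    proof
      assume "a - 1 / real (Suc n) \<in> S"
      from cInf_lower[OF this S_lower] show False by (simp add: a_def)
    qed
    then show ?thesis using bs by (auto simp: S_def null_sets_def)
  qed
  then have "(\<Union>n. A \<inter> {..a - 1 / real (Suc n)}) \<in> null_sets (leb \<alpha>)" by (rule null_sets_UN)
  moreover have "(\<Union>n. A \<inter> {..a - 1 / real (Suc n)}) = A \<inter> {..<a}"
  proof safe
    fix s n assume "s \<le> a - 1 / real (Suc n)"
    moreover have "0 < 1 / real (Suc n)" by simp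
    ultimately show "s < a" by linarith
  next
    fix s assume s: "s \<in> A" "s < a"
    then obtain n where "inverse (real (Suc n)) < a - s" using reals_Archimedean[of "a - s"] by auto
    then have "s \<le> a - 1 / real (Suc n)" by (simp add: inverse_eq_divide)
    then show "s \<in> (\<Union>n. A \<inter> {..a - 1 / real (Suc n)})" using s(1) by blast
  qed
  ultimately have n1: "A \<inter> {..<a} \<in> null_sets (leb \<alpha>)" by simp
  have n2: "A \<inter> {a} \<in> null_sets (leb \<alpha>)"
  proof -
    have "emeasure (leb \<alpha>) (A \<inter> {a}) = emeasure lborel (A \<inter> {a})"
      using sets.sets_into_space[OF A] by (intro emeasure_leb) (auto simp: Int_insert_right)
    also have "\<dots> = 0" by (simp add: Int_insert_right)
    finally show ?thesis using bs by (auto simp: null_sets_def)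
  qed
  have "?M {a<..a + 1 / real (Suc n)} \<noteq> 0" for n
  proof
    assume "?M {a<..a + 1 / real (Suc n)} = 0"
    then have n3: "A \<inter> {a<..a + 1 / real (Suc n)} \<in> null_sets (leb \<alpha>)" using bs by (auto simp: null_sets_def)
    have "Inf S < a + 1 / real (Suc n)" by (simp add: a_def)
    then obtain r where r: "r \<in> S" "r < a + 1 / real (Suc n)" using cInf_lessD[OF Sne] by blast
    have "A \<inter> {..r} \<subseteq> (A \<inter> {..<a} \<union> A \<inter> {a}) \<union> A \<inter> {a<..a + 1 / real (Suc n)}" using r(2) by auto
    then have "A \<inter> {..r} \<in> null_sets (leb \<alpha>)"
      using null_sets_subset[OF null_sets.Un[OF null_sets.Un[OF n1 n2] n3] bs[of "{..r}"]] by simp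
    then show False using r(1) by (auto simp: S_def)
  qed
  then show ?thesis by blast
qed

text \<open>If |x| > c on a set of positive measure, then c times the indicators of subsets
  shrinking to the empty set lie below |x| and tend to 0, so their norms do. Each subset has measure
  above some \<open>d > 0\<close>, so \<open>c / 2 * phi d\<close> is at most such a norm.\<close>

lemma order_cont_phi_small:
  assumes oc: "order_cont_point \<alpha> E nrm x" and nz: "\<not> (AE t in leb \<alpha>. x t = 0)" and e: "0 < e"
  shows "\<exists>d>0. phi d < e"
proof -
  have x: "x \<in> E" using oc by (simp add: order_cont_point_def)
  have meas: "{s \<in> interval \<alpha>. ereal l < \<bar>x s\<bar>} \<in> sets (leb \<alpha>)" for l
    by (rule distr_set_measurable[OF E_L0[OF x]])
  have "\<exists>n. distr_fun \<alpha> x (0 + 1 / real (Suc n)) \<noteq> 0"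
  proof (rule ccontr)
    assume "\<not> ?thesis"
    then have "distr_fun \<alpha> x 0 = 0" by (subst distr_fun_eq_SUP[OF E_L0[OF x]]) simp
    then have "{s \<in> interval \<alpha>. ereal 0 < \<bar>x s\<bar>} \<in> null_sets (leb \<alpha>)"
      using meas[of 0] by (auto simp: null_sets_def distr_fun_def)
    then have "AE s in leb \<alpha>. s \<notin> {s \<in> interval \<alpha>. ereal 0 < \<bar>x s\<bar>}" by (rule AE_not_in)
    moreover have "AE s in leb \<alpha>. s \<in> interval \<alpha>" using AE_space[of "leb \<alpha>"] by simp
    ultimately have "AE s in leb \<alpha>. x s = 0"
    proof eventually_elim
      case (elim s)
      then show ?case by (cases "x s") auto
    qed
    then show False using nz by simp
  qed
  then obtain n where n: "distr_fun \<alpha> x (1 / real (Suc n)) \<noteq> 0" by auto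
  define c where "c = 1 / real (Suc n)"
  have c: "0 < c" by (simp add: c_def)
  define A where "A = {s \<in> interval \<alpha>. ereal c < \<bar>x s\<bar>}"
  have A: "A \<in> sets (leb \<alpha>)" "emeasure (leb \<alpha>) A \<noteq> 0"
    using meas n by (auto simp: A_def c_def distr_fun_def)
  obtain a where a: "\<And>n. emeasure (leb \<alpha>) (A \<inter> {a<..a + 1 / real (Suc n)}) \<noteq> 0"
    using shrinking_subsets[OF A] by blast
  define B where "B = (\<lambda>n. A \<inter> {a<..a + 1 / real (Suc n)})"
  have B: "B n \<in> sets (leb \<alpha>)" for n
  proof (rule ccontr)
    assume "B n \<notin> sets (leb \<alpha>)"
    then show False using a[of n] by (simp add: B_def emeasure_notin_sets)
  qed
  define X where "X = (\<lambda>n s. ereal (c * indicator (B n) s))"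
  have [measurable]: "indicator (B n) \<in> borel_measurable (leb \<alpha>)" for n
    using B by (rule borel_measurable_indicator)
  have XL: "X n \<in> L0 \<alpha>" for n unfolding X_def L0_def by measurable
  have X0: "0 \<le> X n t" for n t using c by (simp add: X_def)
  have Xle: "X n t \<le> \<bar>x t\<bar>" for n t
  proof (cases "t \<in> B n")
    case True
    then show ?thesis using c by (auto simp: X_def B_def A_def)
  qed (simp add: X_def zero_ereal_def[symmetric])
  have Xlim: "AE t in leb \<alpha>. (\<lambda>m. X m t) \<longlonglongrightarrow> 0"
  proof (intro always_eventually allI)
    fix t
    show "(\<lambda>m. X m t) \<longlonglongrightarrow> 0"
    proof (cases "a < t")
      case True
      then obtain m where m: "inverse (real (Suc m)) < t - a" using reals_Archimedean[of "t - a"] by auto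
      have "X k t = 0" if "m \<le> k" for k
      proof -
        have "1 / real (Suc k) \<le> 1 / real (Suc m)" using that by (simp add: frac_le)
        then have "a + 1 / real (Suc k) < t" using m unfolding inverse_eq_divide by linarith
        then have "t \<notin> B k" unfolding B_def by simp
        then show ?thesis by (simp add: X_def zero_ereal_def[symmetric])
      qed
      then have "\<forall>\<^sub>F k in sequentially. X k t = 0" by (rule eventually_sequentiallyI)
      then show ?thesis by (rule tendsto_eventually)
    next
      case False
      then show ?thesis by (simp add: X_def B_def zero_ereal_def[symmetric])
    qed
  qed
  note X = order_cont_D[OF oc XL X0 Xle Xlim]
  have "\<forall>\<^sub>F n in sequentially. nrm (X n) < c * (e / 2)"
    using X(2) c e by (intro order_tendstoD(2)) auto
  then obtain m where m: "nrm (X m) < c * (e / 2)" using eventually_happens'[OF trivial_limit_sequentially] by blast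
  have "0 < emeasure (leb \<alpha>) (B m)" using a[of m] by (simp add: B_def zero_less_iff_neq_zero)
  then obtain d' where "0 < d'" "d' < emeasure (leb \<alpha>) (B m)" using dense by blast
  moreover from this obtain d where "d' = ennreal d" "0 < d" by (cases d') auto
  ultimately have d: "0 < d" "ennreal d < emeasure (leb \<alpha>) (B m)" by auto
  \<comment> \<open>The level is halved because level sets are strict: \<open>X m\<close> has height
    \<open>c\<close> and never exceeds it.\<close>
  have "c / 2 \<le> real_rearr \<alpha> (X m) s" if s: "0 < s" "s < d" for s
  proof -
    have "{r \<in> interval \<alpha>. ereal (c / 2) < \<bar>X m r\<bar>} = B m"
      using c sets.sets_into_space[OF B[of m]] by (auto simp: X_def indicator_def)
    then have "ennreal d < distr_fun \<alpha> (X m) (c / 2)" using d by (simp add: distr_fun_def)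
    moreover have "ennreal s < ennreal d" using s by (simp add: ennreal_less_iff)
    ultimately have "ennreal s < distr_fun \<alpha> (X m) (c / 2)" by (rule less_trans[rotated])
    then have "ereal (c / 2) < rearr \<alpha> (X m) s" using rearr_gt_iff[OF XL, of "c/2" m s] c by simp
    then show ?thesis using real_rearr_eq[OF X(1) s(1), of m] by (metis ereal_less_eq(3) less_imp_le)
  qed
  then have "nr (\<lambda>s. (c / 2) * indicator {0<..<d} s) \<le> nr (real_rearr \<alpha> (X m))"
    using c decrD(1)[OF real_rearr_decr[OF X(1)]] by (intro rE_mono(2) real_rearr_rE(1) X(1)) (auto simp: indicator_def)
  then have "c / 2 * phi d \<le> nrm (X m)"
    unfolding rE_scale(2)[OF indicator_rE] real_rearr_rE(2)[OF X(1)] using c by simp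
  then have "c * (phi d / 2) < c * (e / 2)" using m by simp
  then have "phi d < e" using c by simp
  then show ?thesis using d(1) by blast
qed

text \<open>Replacing \<open>g\<close> on (0,T) by its mean preserves the integral up to
  \<open>T\<close>, hence also the integrals up to all later points.\<close>

lemma cumul_le_split_avg:
  assumes g: "decr \<alpha> g" "rE g" and T: "0 < T" "T \<le> t"
  shows "cumul g t \<le> cumul (\<lambda>r. avg g T * indicator {0<..<T} r + g r * indicator {T..} r) t"
proof -
  let ?G = "\<lambda>r. avg g T * indicator {0<..<T} r + g r * indicator {T..} r"
  note [measurable] = decr_measurable[OF g(1)]
  have "cumul g T = cumul (\<lambda>r. avg g T * indicator {0<..<T} r) T"
    using cumul_eq_avg[OF g T(1)] cumul_const_indicator[OF avg_nonneg T(1) T(1), of g T] by simp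
  also have "\<dots> \<le> cumul ?G T" by (rule cumul_mono) (auto simp: indicator_def)
  finally have le: "cumul g T \<le> cumul ?G T" .
  have eq: "(\<lambda>r. g r * indicator {T..} r) = (\<lambda>r. ?G r * indicator {T..} r)"
    by (auto simp: indicator_def fun_eq_iff)
  have "cumul g t = cumul g T + cumul (\<lambda>r. g r * indicator {T..} r) t"
    using T by (intro cumul_split) auto
  also have "\<dots> \<le> cumul ?G T + cumul (\<lambda>r. ?G r * indicator {T..} r) t"
    unfolding eq using le by (rule add_right_mono)
  also have "\<dots> = cumul ?G t"
    using T by (intro cumul_split[symmetric]) auto
  finally show ?thesis .
qed

lemma order_cont_imp_K_order_cont:
  assumes oc: "order_cont_point \<alpha> E nrm x" and i: "fund_vanishes_at_infty \<alpha> nrm x"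
  shows "K_order_cont_point \<alpha> E nrm x"
proof -
  have x: "x \<in> E" using oc by (simp add: order_cont_point_def)
  define g where "g = real_rearr \<alpha> x"
  have g: "decr \<alpha> g" "rE g" using real_rearr_decr[OF x] real_rearr_rE(1)[OF x] by (auto simp: g_def)
  note [measurable] = decr_measurable[OF g(1)]
  note g0 = decrD(1)[OF g(1)]
  have ginf: "(g \<longlongrightarrow> 0) at_top" using fund_vanishes_at_infty_imp_tendsto[OF x i] by (simp add: g_def)
  have "(\<lambda>n. nrm (X n)) \<longlonglongrightarrow> 0"
    if X: "\<And>n. X n \<in> E" "\<And>n. submaj \<alpha> (X n) x"
      and lim: "AE t in leb \<alpha>. (\<lambda>n. rearr \<alpha> (X n) t) \<longlonglongrightarrow> 0" for X
  \<comment> \<open>A null \<open>x\<close> is treated apart because \<open>phi\<close> need not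
    tend to 0 at 0 in that case.\<close>
  proof (cases "AE t in leb \<alpha>. x t = 0")
    case True
    then have "nrm x = 0" using norm_zero_iff[OF x] by simp
    then have "nrm (X n) = 0" for n using submaj_nrm_le[OF x X] nrm_nonneg[OF X(1)] by (metis antisym)
    then show ?thesis by simp
  next
    case False
    define f where "f = (\<lambda>n. real_rearr \<alpha> (X n))"
    have f: "decr \<alpha> (f n)" "rE (f n)" "nr (f n) = nrm (X n)" for n
      using real_rearr_decr[OF X(1)] real_rearr_rE[OF X(1)] by (auto simp: f_def)
    note [measurable] = decr_measurable[OF f(1)]
    have f0: "0 \<le> f n t" for n t using decrD(1)[OF f(1)] .
    have maj: "cumul (f n) t \<le> cumul g t" if "0 < t" for n t
      using X(2)[of n] that unfolding submaj_iff[OF X(1) x] f_def g_def by blast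
    \<comment> \<open>Convergence a.e. becomes convergence at every \<open>t\<close>: there is a
      good point \<open>s < t\<close>, and \<open>f n\<close> decreases.\<close>
    have flim: "(\<lambda>n. f n t) \<longlonglongrightarrow> 0" if t: "0 < t" for t
    proof -
      obtain s where s: "0 < s" "s < t" "(\<lambda>n. rearr \<alpha> (X n) s) \<longlonglongrightarrow> 0"
        using AE_leb_ex[OF lim t] by blast
      then have "(\<lambda>n. ereal (f n s)) \<longlonglongrightarrow> ereal 0"
        using real_rearr_eq[OF X(1) s(1)] by (simp add: f_def zero_ereal_def)
      then have lim: "(\<lambda>n. f n s) \<longlonglongrightarrow> 0" by (simp only: lim_ereal)
      show ?thesis
      proof (rule tendsto_sandwich[OF _ _ tendsto_const lim])
        show "\<forall>\<^sub>F n in sequentially. 0 \<le> f n t" by (intro always_eventually allI f0)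
        show "\<forall>\<^sub>F n in sequentially. f n t \<le> f n s"
          using s(2) by (intro always_eventually allI decrD(3)[OF f(1) s(1)]) simp
      qed
    qed
    have "(\<lambda>n. nr (f n)) \<longlonglongrightarrow> 0"
    proof (rule nr_tendsto_0_split[OF f(1,2) flim])
      fix e :: real assume e: "0 < e"
      define H where "H = (\<lambda>m t. max (g t - real m) 0)"
      have H: "rE (H m)" "(\<lambda>m. nr (H m)) \<longlonglongrightarrow> 0" for m
        using order_cont_excess[OF oc] by (auto simp: H_def g_def)
      have "\<forall>\<^sub>F m in sequentially. nr (H m) < e / 4" using e by (intro order_tendstoD(2)[OF H(2)]) simp
      then obtain m where m: "nr (H m) < e / 4" using eventually_happens'[OF trivial_limit_sequentially] by blast
      \<comment> \<open>On (0,d) x^* is at most its excess over \<open>m\<close> plus the constant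
        \<open>m\<close>, and each of the two has norm below \<open>e / 4\<close>. Using
        \<open>m + 1\<close> avoids a zero denominator.\<close>
      obtain d where d: "0 < d" "phi d < e / (4 * (real m + 1))"
        using order_cont_phi_small[OF oc False, of "e / (4 * (real m + 1))"] e by auto
      have "real m * phi d \<le> (real m + 1) * phi d" using phi_nonneg by (intro mult_right_mono) auto
      also have "\<dots> < e / 4" using d(2) by (simp add: field_simps)
      finally have md: "real m * phi d < e / 4" .
      let ?gd = "\<lambda>t. g t * indicator {0<..<d} t"
      have gdE: "rE ?gd" by (rule rE_mono(1)[OF _ g(2)]) (use g0 in \<open>auto simp: indicator_def\<close>)
      have v: "rE (\<lambda>t. real m * indicator {0<..<d} t)" by (rule rE_scale(1)[OF indicator_rE])
      have "nr ?gd \<le> nr (\<lambda>t. H m t + real m * indicator {0<..<d} t)"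
        by (rule rE_mono(2)[OF _ rE_add(1)[OF H(1) v]]) (use g0 in \<open>auto simp: indicator_def H_def\<close>)
      also have "\<dots> \<le> nr (H m) + real m * phi d"
        using rE_add(2)[OF H(1) v] rE_scale(2)[OF indicator_rE] by simp
      finally have head_g: "nr ?gd \<le> e / 2" using m md by simp
      have gd_decr: "decr \<alpha> (\<lambda>t. h t * indicator {0<..<d} t)" if "decr \<alpha> h" for h
        using decrD[OF that] by (auto simp: decr_def indicator_def)
      have fdE: "rE (\<lambda>t. f k t * indicator {0<..<d} t)" for k
        by (rule rE_mono(1)[OF _ f(2)[of k]]) (use f0 in \<open>auto simp: indicator_def\<close>)
      have head: "nr (\<lambda>t. f k t * indicator {0<..<d} t) \<le> e / 2" for k
      proof -
        have "nr (\<lambda>t. f k t * indicator {0<..<d} t) \<le> nr ?gd"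
          using d(1) maj by (intro nr_mono_cumul gd_decr f(1) g(1) fdE gdE) (simp add: cumul_restrict)
        then show ?thesis using head_g by simp
      qed
      \<comment> \<open>The tail of \<open>f k\<close> beyond \<open>T\<close>, extended by 0, is in
        general not decreasing, so norm monotonicity cannot be applied to it. Capping
        \<open>f k\<close> at \<open>f k T\<close> gives a decreasing function with the same
        tail.\<close>
      have minE: "rE (\<lambda>t. min (f k t) (f k T))" for k T
        by (rule rE_mono(1)[OF _ f(2)[of k]]) (use f0 in auto)
      have "\<exists>T>0. \<forall>k. nr (\<lambda>t. min (f k t) (f k T)) \<le> e / 2"
      proof (cases "\<alpha> = \<infinity>")
        case False
        \<comment> \<open>The functions vanish from 1 on, so \<open>T = 1\<close> leaves no tail to
          estimate.\<close>
        then have "f k 1 = 0" for k using alpha decrD(4)[OF f(1), of 1] by (auto simp: one_ereal_def)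
        then have "min (f k t) (f k 1) = 0" for k t using f0 by simp
        moreover have "nr (\<lambda>t. 0) = 0" using rE_scale(2)[OF g(2), of 0] by simp
        ultimately show ?thesis using e by (intro exI[of _ 1]) simp
      next
        case True
        define C where "C = (\<lambda>m t. min (g t) (1 / real (Suc m)))"
        have C: "rE (C m)" "(\<lambda>m. nr (C m)) \<longlonglongrightarrow> 0" for m
          using order_cont_cap[OF oc] by (auto simp: C_def g_def)
        have "\<forall>\<^sub>F m in sequentially. nr (C m) < e / 4" using e by (intro order_tendstoD(2)[OF C(2)]) simp
        then obtain m where m: "nr (C m) < e / 4" using eventually_happens'[OF trivial_limit_sequentially] by blast
        have "\<forall>\<^sub>F T in at_top. g T < 1 / real (Suc m)" by (intro order_tendstoD(2)[OF ginf]) simp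
        moreover have "\<forall>\<^sub>F T in at_top. phi T * avg g T < e / 4"
          using i True e unfolding fund_vanishes_at_infty_iff[OF x] g_def[symmetric]
          by (intro order_tendstoD(2)[of _ 0]) auto
        ultimately have "\<forall>\<^sub>F T in at_top. 0 < T \<and> g T < 1 / real (Suc m) \<and> phi T * avg g T < e / 4"
          using eventually_gt_at_top[of 0] by eventually_elim simp
        then obtain T where T: "0 < T" "g T < 1 / real (Suc m)" "phi T * avg g T < e / 4"
          using eventually_happens'[OF trivial_limit_at_top_linorder] by blast
        \<comment> \<open>The majorant is flat at x^**(T) up to \<open>T\<close>, a piece of norm
          \<open>phi T * avg g T\<close>, and equals x^* beyond, where x^* lies below the cap
          \<open>C m\<close>.\<close>
        let ?tail = "\<lambda>r. g r * indicator {T..} r"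
        let ?flat = "\<lambda>r. avg g T * indicator {0<..<T} r"
        let ?G = "\<lambda>r. ?flat r + ?tail r"
        have tail_bd: "\<bar>?tail r\<bar> \<le> \<bar>C m r\<bar>" for r
          using decrD(3)[OF g(1) T(1), of r] T(2) g0[of r] by (auto simp: C_def indicator_def)
        have tail: "rE ?tail" "nr ?tail \<le> e / 4"
          using rE_mono[OF _ C(1) tail_bd] m by auto
        have flat: "rE ?flat" "nr ?flat \<le> e / 4"
          using rE_scale[OF indicator_rE, of "avg g T" "T"] T(3) avg_nonneg[of g T] by (auto simp: mult.commute)
        have G: "rE ?G" "nr ?G \<le> e / 2"
          using rE_add[OF flat(1) tail(1)] flat(2) tail(2) by auto
        have gT: "g T \<le> avg g T" using le_avg[OF g g(1) T(1)] by simp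
        have Gd: "decr \<alpha> ?G"
          unfolding decr_def
        proof (intro conjI allI impI)
          show "?G t \<le> ?G s" if "0 < s" "s \<le> t" for s t
            using that decrD(3)[OF g(1), of s t] decrD(3)[OF g(1), of T t] gT T(1) by (auto simp: indicator_def)
        qed (use g0 T avg_nonneg[of g T] True in \<open>auto simp: indicator_def\<close>)
        have "nr (\<lambda>t. min (f k t) (f k T)) \<le> e / 2" for k
        proof -
          have hd: "decr \<alpha> (\<lambda>t. min (f k t) (f k T))"
            unfolding decr_def using decrD[OF f(1)[of k]] by (auto simp: min.coboundedI1)
          have "nr (\<lambda>t. min (f k t) (f k T)) \<le> nr ?G"
          proof (rule nr_mono_cumul[OF hd Gd minE G(1)])
            fix t :: real assume t: "0 < t"
            show "cumul (\<lambda>t. min (f k t) (f k T)) t \<le> cumul ?G t"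
            \<comment> \<open>Up to \<open>T\<close> the comparison is pointwise, through
              \<open>f k T \<le> avg g T\<close>. Beyond \<open>T\<close> it goes through the
              integrals, where \<open>?G\<close> has at least as much mass as
              \<open>g\<close>.\<close>
            proof (cases "t \<le> T")
              case True
              have "f k T \<le> avg g T" using le_avg[OF g f(1) T(1) maj[OF T(1)]] .
              then show ?thesis using True by (intro cumul_mono) (auto simp: min_le_iff_disj)
            next
              case False
              have "cumul (\<lambda>t. min (f k t) (f k T)) t \<le> cumul (f k) t" by (rule cumul_mono) simp
              also have "\<dots> \<le> cumul g t" by (rule maj[OF t])
              also have "\<dots> \<le> cumul ?G t" using cumul_le_split_avg[OF g T(1), of t] False by simp
              finally show ?thesis .
            qed
          qed
          then show ?thesis using G(2) by simp
        qed
        then show ?thesis using T(1) by blast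
      qed
      then obtain T where T0: "0 < T" and T: "\<And>k. nr (\<lambda>t. min (f k t) (f k T)) \<le> e / 2" by blast
      have "\<exists>u. rE u \<and> nr u \<le> e \<and> (\<forall>t>0. f k t \<le> u t + f k d * indicator {0<..<T} t)" for k
      proof -
        let ?u = "\<lambda>t. f k t * indicator {0<..<d} t + min (f k t) (f k T)"
        have "rE ?u" "nr ?u \<le> e"
          using rE_add[OF fdE[of k] minE[of k T]] head[of k] T[of k] by auto
        moreover have "f k t \<le> ?u t + f k d * indicator {0<..<T} t" if t: "0 < t" for t
        proof -
          have "f k t \<le> f k d" if "d \<le> t" using decrD(3)[OF f(1) d(1) that] .
          moreover have "f k t \<le> f k T" if "T \<le> t" using decrD(3)[OF f(1) T0 that] .
          moreover have "0 \<le> f k t" "0 \<le> f k d" "0 \<le> f k T" using f0 by auto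
          ultimately show ?thesis using t by (auto simp: indicator_def)
        qed
        ultimately show ?thesis by (intro exI[of _ ?u] conjI allI impI)
      qed
      then show "\<exists>d>0. \<exists>T. \<forall>k. \<exists>u. rE u \<and> nr u \<le> e \<and> (\<forall>t>0. f k t \<le> u t + f k d * indicator {0<..<T} t)"
        using d(1) by blast
    qed
    then show ?thesis by (simp add: f(3))
  qed
  then show ?thesis using x by (auto simp: K_order_cont_point_def)
qed

end

section \<open>From K-order continuity to LLUKM points\<close>

text \<open>\<open>Helly_selection\<close> asks for increasing, right-continuous, uniformly bounded
  functions on the line. The substitution t = exp s moves the positive half-line to the line, and 1
  / (1 + f) turns decreasing nonnegative functions into increasing ones with values in [0,1]. The
  bound \<open>B\<close> keeps the limit away from 0, so that the transformation can be
  undone.\<close>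

lemma helly_decr:
  fixes f :: "nat \<Rightarrow> real \<Rightarrow> real"
  assumes f: "\<And>n. decr \<alpha> (f n)" and rc: "\<And>n t. 0 < t \<Longrightarrow> (f n \<longlongrightarrow> f n t) (at_right t)"
    and bd: "\<And>n t. 0 < t \<Longrightarrow> f n t \<le> B t"
  shows "\<exists>r y. strict_mono r \<and> decr \<alpha> y \<and> (AE t in lborel. 0 < t \<longrightarrow> (\<lambda>n. f (r n) t) \<longlonglongrightarrow> y t)"
proof -
  have f0: "0 \<le> f n t" for n t using decrD(1)[OF f] .
  define F where "F = (\<lambda>n s. 1 / (1 + f n (exp s)))"
  have F01: "0 \<le> F n s" "F n s \<le> 1" for n s using f0[of n "exp s"] by (auto simp: F_def)
  have "continuous (at_right s) (F n)" for n s
  proof -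
    have "filterlim exp (at_right (exp s)) (at_right s)"
      unfolding filterlim_at
      by (auto intro!: tendsto_intros simp: eventually_at_filter)
    then have "((\<lambda>u. f n (exp u)) \<longlongrightarrow> f n (exp s)) (at_right s)"
      by (rule filterlim_compose[OF rc[OF exp_gt_zero]])
    then show ?thesis
      unfolding F_def continuous_within using f0[of n "exp s"] by (intro tendsto_intros) auto
  qed
  moreover have "mono (F n)" for n
  proof (rule monoI)
    fix s u :: real assume "s \<le> u"
    then have "f n (exp u) \<le> f n (exp s)" by (intro decrD(3)[OF f]) auto
    then show "F n s \<le> F n u" unfolding F_def using f0[of n "exp u"] by (intro divide_left_mono) auto
  qed
  moreover have "\<bar>F n s\<bar> \<le> 1" for n s using F01[of n s] by simp
  ultimately obtain r G where r: "strict_mono r" and G: "mono G"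
    "\<And>s. continuous (at s) G \<Longrightarrow> (\<lambda>n. F (r n) s) \<longlonglongrightarrow> G s"
    using Helly_selection[of F 1] by metis
  \<comment> \<open>The lower limit exists everywhere and inherits monotonicity, so \<open>y\<close>
    decreases at all points and not only where the sequence converges.\<close>
  define y where "y = (\<lambda>t. if 0 < t then real_of_ereal (liminf (\<lambda>n. ereal (f (r n) t))) else 0)"
  have lim0: "0 \<le> liminf (\<lambda>n. ereal (f (r n) t))" for t
    using f0 by (intro Liminf_bounded always_eventually) auto
  have limB: "liminf (\<lambda>n. ereal (f (r n) t)) \<le> ereal (B t)" if "0 < t" for t
  proof -
    have "liminf (\<lambda>n. ereal (f (r n) t)) \<le> liminf (\<lambda>n. ereal (B t))"
      using bd[OF that] by (intro Liminf_mono always_eventually) auto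
    then show ?thesis by (simp add: Liminf_const)
  qed
  have ey: "ereal (y t) = liminf (\<lambda>n. ereal (f (r n) t))" if "0 < t" for t
    using lim0[of t] limB[OF that] that by (cases "liminf (\<lambda>n. ereal (f (r n) t))") (auto simp: y_def)
  have "decr \<alpha> y"
    unfolding decr_def
  proof (intro conjI allI impI)
    fix s t :: real
    show "0 \<le> y t" using lim0[of t] by (simp add: y_def real_of_ereal_pos)
    show "t \<le> 0 \<Longrightarrow> y t = 0" by (simp add: y_def)
    show "y t \<le> y s" if "0 < s" "s \<le> t"
    proof -
      have "liminf (\<lambda>n. ereal (f (r n) t)) \<le> liminf (\<lambda>n. ereal (f (r n) s))"
        using decrD(3)[OF f that] by (intro Liminf_mono always_eventually) auto
      then show ?thesis using ey[of t] ey[of s] that by (metis ereal_less_eq(3) order.strict_trans2)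
    qed
    show "y t = 0" if "\<alpha> \<le> ereal t"
      using decrD(4)[OF f that] by (simp add: y_def Liminf_const zero_ereal_def[symmetric])
  qed
  moreover have "AE t in lborel. 0 < t \<longrightarrow> (\<lambda>n. f (r n) t) \<longlonglongrightarrow> y t"
  proof -
    \<comment> \<open>The monotone \<open>G\<close> has countably many discontinuities, and their
      image under \<open>exp\<close> is null.\<close>
    let ?D = "{s. \<not> isCont G s}"
    have "countable (exp ` ?D)" by (intro countable_image mono_ctble_discont G(1))
    from AE_not_in[OF countable_imp_null_set_lborel[OF this]] show ?thesis
    proof eventually_elim
      case (elim t)
      show ?case
      proof
        assume t: "0 < t"
        have "isCont G (ln t)"
        proof (rule ccontr)
          assume "\<not> isCont G (ln t)"
          then have "exp (ln t) \<in> exp ` ?D" by blast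
          then show False using elim t by simp
        qed
        then have lim: "(\<lambda>n. F (r n) (ln t)) \<longlonglongrightarrow> G (ln t)" by (intro G(2)) 
        have "0 \<le> B t" using bd[OF t, of 0] f0[of 0 t] by simp
        have "1 / (1 + B t) \<le> F (r n) (ln t)" for n
          unfolding F_def using t bd[OF t, of "r n"] f0[of "r n" t] by (simp add: frac_le)
        then have "1 / (1 + B t) \<le> G (ln t)" by (intro LIMSEQ_le_const[OF lim]) auto
        moreover have "0 < 1 / (1 + B t)" using \<open>0 \<le> B t\<close> by simp
        ultimately have Gpos: "G (ln t) \<noteq> 0" by linarith
        have "(\<lambda>n. 1 / F (r n) (ln t) - 1) \<longlonglongrightarrow> 1 / G (ln t) - 1"
          by (intro tendsto_intros lim Gpos)
        then have L: "(\<lambda>n. f (r n) t) \<longlonglongrightarrow> 1 / G (ln t) - 1" using t by (simp add: F_def)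
        then have "liminf (\<lambda>n. ereal (f (r n) t)) = ereal (1 / G (ln t) - 1)"
          by (intro lim_imp_Liminf) (auto simp: lim_ereal)
        then show "(\<lambda>n. f (r n) t) \<longlonglongrightarrow> y t" using L ey[OF t] by simp
      qed
    qed
  qed
  ultimately show ?thesis using r by blast
qed

lemma cumul_le_of_AE_tendsto:
  assumes f: "\<And>n. f n \<in> borel_measurable borel"
    and lim: "AE s in lborel. 0 < s \<longrightarrow> (\<lambda>n. f n s) \<longlonglongrightarrow> y s"
    and le: "\<And>n. cumul (f n) t \<le> c"
  shows "cumul y t \<le> c"
proof -
  note [measurable] = f
  have "cumul y t = (\<integral>\<^sup>+s. liminf (\<lambda>n. ennreal (f n s) * indicator {0..t} s) \<partial>lborel)"
    unfolding cumul_def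
  proof (rule nn_integral_cong_AE, use lim AE_lborel_singleton[of 0] in eventually_elim)
    case (elim s)
    show ?case
    proof (cases "s \<in> {0..t}")
      case True
      then have "(\<lambda>n. ennreal (f n s)) \<longlonglongrightarrow> ennreal (y s)" using elim by (intro tendsto_ennrealI) auto
      from lim_imp_Liminf[OF _ this] show ?thesis using True by simp
    qed (simp add: Liminf_const)
  qed
  also have "\<dots> \<le> liminf (\<lambda>n. cumul (f n) t)"
    unfolding cumul_def by (rule nn_integral_liminf) measurable
  also have "\<dots> \<le> liminf (\<lambda>n. c)" using le by (intro Liminf_mono always_eventually) auto
  also have "\<dots> = c" by (simp add: Liminf_const)
  finally show ?thesis .
qed

lemma cumul_scale:
  assumes "f \<in> borel_measurable borel" "0 \<le> c"
  shows "cumul (\<lambda>s. c * f s) t = ennreal c * cumul f t"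
  unfolding cumul_def using assms
  by (subst nn_integral_cmult[symmetric]) (auto simp: ennreal_mult' mult.assoc intro!: nn_integral_cong)

lemma cumul_add:
  assumes "f \<in> borel_measurable borel" "g \<in> borel_measurable borel" "\<And>s. 0 \<le> f s" "\<And>s. 0 \<le> g s"
  shows "cumul (\<lambda>s. f s + g s) t = cumul f t + cumul g t"
  unfolding cumul_def using assms
  by (subst nn_integral_add[symmetric]) (auto simp: distrib_right intro!: nn_integral_cong)

context fatou_symmetric_space
begin

text \<open>By \<open>rearr_gt_iff\<close> the inequality x^*(t) > a says that t lies strictly below
  the distribution function at a, which persists slightly to the right of \<open>t\<close>. The
  other half is monotonicity. The result feeds \<open>helly_decr\<close>.\<close>

lemma real_rearr_right_continuous:
  assumes x: "x \<in> E" and t: "0 < t"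
  shows "(real_rearr \<alpha> x \<longlongrightarrow> real_rearr \<alpha> x t) (at_right t)"
proof (rule order_tendstoI)
  note g = real_rearr_decr[OF x]
  fix a assume a: "a < real_rearr \<alpha> x t"
  show "\<forall>\<^sub>F s in at_right t. a < real_rearr \<alpha> x s"
  proof (cases "0 \<le> a")
    case True
    have "ereal a < rearr \<alpha> x t" using a real_rearr_eq[OF x t] by (metis less_ereal.simps(1))
    then have "ennreal t < distr_fun \<alpha> x a" using rearr_gt_iff[OF E_L0[OF x] True] by simp
    then obtain c where c: "ennreal t < c" "c < distr_fun \<alpha> x a" using dense by blast
    then obtain u where u: "c = ennreal u" "0 \<le> u" by (cases c) auto
    have "t < u" using c(1) u t by (simp add: ennreal_less_iff)
    from eventually_at_right_real[OF this] show ?thesis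
    proof eventually_elim
      case (elim s)
      then have "ennreal s < distr_fun \<alpha> x a"
        using c(2) u t by (metis ennreal_leI greaterThanLessThan_iff le_less_trans less_imp_le)
      then have "ereal a < rearr \<alpha> x s" using rearr_gt_iff[OF E_L0[OF x] True] by simp
      then show ?case using real_rearr_eq[OF x, of s] elim t by (metis greaterThanLessThan_iff less_ereal.simps(1) less_trans)
    qed
  next
    case False
    then show ?thesis using decrD(1)[OF g] by (intro always_eventually allI) (meson less_le_trans not_le)
  qed
next
  fix a assume a: "real_rearr \<alpha> x t < a"
  show "\<forall>\<^sub>F s in at_right t. real_rearr \<alpha> x s < a"
    unfolding eventually_at_filter
    using a decrD(3)[OF real_rearr_decr[OF x] t] by (intro always_eventually) (auto intro: le_less_trans less_imp_le)
qed

section \<open>Boundary limits from K-order continuity\<close>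

lemma K_order_cont_D:
  assumes K: "K_order_cont_point \<alpha> E nrm x" and f: "\<And>n. decr \<alpha> (f n)" "\<And>n. rE (f n)"
    and maj: "\<And>n t. 0 < t \<Longrightarrow> cumul (f n) t \<le> cumul (real_rearr \<alpha> x) t"
    and lim: "\<And>t. 0 < t \<Longrightarrow> (\<lambda>n. f n t) \<longlonglongrightarrow> 0"
  shows "(\<lambda>n. nr (f n)) \<longlonglongrightarrow> 0"
proof -
  have x: "x \<in> E" using K by (simp add: K_order_cont_point_def)
  let ?X = "\<lambda>n s. ereal (f n s)"
  have "\<forall>n. submaj \<alpha> (?X n) x"
    using maj by (simp add: submaj_iff[OF f(2) x] cumul_real_rearr_of_decr[OF f(1)])
  moreover have ae: "AE t in lborel. \<forall>n. 0 < t \<longrightarrow> rearr \<alpha> (?X n) t = ereal (f n t)"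
    unfolding AE_all_countable using rearr_decr_AE[OF f(1)] by blast
  have "AE t in leb \<alpha>. (\<lambda>n. rearr \<alpha> (?X n) t) \<longlonglongrightarrow> 0"
  proof (rule AE_leb_lborel, use ae AE_lborel_singleton[of 0] in eventually_elim)
    case (elim t)
    show ?case
    proof
      assume "t \<in> interval \<alpha>"
      then have "0 < t" using elim by (auto simp: interval_def)
      then show "(\<lambda>n. rearr \<alpha> (?X n) t) \<longlonglongrightarrow> 0" using elim lim[of t] by (simp add: zero_ereal_def lim_ereal)
    qed
  qed
  ultimately show ?thesis
    using K f(2) unfolding K_order_cont_point_def by (elim conjE allE[of _ ?X]) blast
qed

text \<open>The product of \<open>phi t\<close> and x^*(t) is the norm of a constant on (0,t) that
  lies below x^*, hence at most the norm of x^* restricted to any longer segment. These restrictions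
  tend to 0 at every positive point as the segments shrink.\<close>

lemma K_order_cont_imp_vanishes_at_zero:
  assumes K: "K_order_cont_point \<alpha> E nrm x"
  shows "fund_vanishes_at_zero \<alpha> nrm x"
proof -
  have x: "x \<in> E" using K by (simp add: K_order_cont_point_def)
  define g where "g = real_rearr \<alpha> x"
  have g: "decr \<alpha> g" "rE g" using real_rearr_decr[OF x] real_rearr_rE(1)[OF x] by (auto simp: g_def)
  note [measurable] = decr_measurable[OF g(1)]
  note g0 = decrD(1)[OF g(1)]
  define f where "f = (\<lambda>n t. g t * indicator {0<..<1 / real (Suc n)} t)"
  have f_decr: "decr \<alpha> (f n)" for n
    using decrD[OF g(1)] by (auto simp: decr_def f_def indicator_def)
  have fE: "rE (f n)" for n
    by (rule rE_mono(1)[OF _ g(2)]) (use g0 in \<open>auto simp: f_def indicator_def\<close>)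
  have "(\<lambda>n. nr (f n)) \<longlonglongrightarrow> 0"
  proof (rule K_order_cont_D[OF K f_decr fE])
    show "cumul (f n) t \<le> cumul (real_rearr \<alpha> x) t" for n t
      using g0 by (intro cumul_mono) (auto simp: f_def g_def[symmetric] indicator_def)
    fix t :: real assume "0 < t"
    then obtain m where m: "inverse (real (Suc m)) < t" using reals_Archimedean by blast
    have "f n t = 0" if "m \<le> n" for n
    proof -
      have "1 / real (Suc n) \<le> 1 / real (Suc m)" using that by (simp add: frac_le)
      then show ?thesis using m by (simp add: f_def inverse_eq_divide)
    qed
    then have "\<forall>\<^sub>F n in sequentially. f n t = 0" by (rule eventually_sequentiallyI)
    then show "(\<lambda>n. f n t) \<longlonglongrightarrow> 0" by (rule tendsto_eventually)
  qed
  have "((\<lambda>t. phi t * g t) \<longlongrightarrow> 0) (at_right 0)"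
  proof (rule order_tendstoI)
    fix a :: real assume "a < 0"
    then show "\<forall>\<^sub>F t in at_right 0. a < phi t * g t"
      using phi_nonneg g0 by (intro always_eventually allI) (meson less_le_trans mult_nonneg_nonneg)
  next
    fix a :: real assume "0 < a"
    then have "\<forall>\<^sub>F n in sequentially. nr (f n) < a" by (intro order_tendstoD(2)[OF \<open>(\<lambda>n. nr (f n)) \<longlonglongrightarrow> 0\<close>])
    then obtain n where n: "nr (f n) < a" using eventually_happens'[OF trivial_limit_sequentially] by blast
    have "\<forall>\<^sub>F t in at_right 0. t \<in> {0<..<1 / real (Suc n)}"
      by (rule eventually_at_right_real) simp
    then show "\<forall>\<^sub>F t in at_right 0. phi t * g t < a"
    proof eventually_elim
      case (elim t)
      have "nr (\<lambda>s. g t * indicator {0<..<t} s) \<le> nr (f n)"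
      proof (rule rE_mono(2)[OF _ fE])
        fix s :: real assume "0 < s"
        then show "\<bar>g t * indicator {0<..<t} s\<bar> \<le> \<bar>f n s\<bar>"
          using elim g0 decrD(3)[OF g(1), of s t] by (auto simp: f_def indicator_def)
      qed measurable
      then have "g t * phi t \<le> nr (f n)" unfolding rE_scale(2)[OF indicator_rE] using g0 by simp
      then show ?case using n by (simp add: mult.commute)
    qed
  qed
  then show ?thesis unfolding fund_vanishes_at_zero_iff[OF x] g_def .
qed

text \<open>The product is the norm of the constant x^**(s) on (0,s). This function is submajorized
  by \<open>x\<close>: before s because averages decrease, afterwards because its total mass is the
  integral of x^* up to s. It tends to 0 because x^** does.\<close>

lemma K_order_cont_imp_vanishes_at_infty:
  assumes K: "K_order_cont_point \<alpha> E nrm x" and i: "rearr_infty \<alpha> x = 0"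
  shows "fund_vanishes_at_infty \<alpha> nrm x"
proof -
  have x: "x \<in> E" using K by (simp add: K_order_cont_point_def)
  define g where "g = real_rearr \<alpha> x"
  have g: "decr \<alpha> g" "rE g" using real_rearr_decr[OF x] real_rearr_rE(1)[OF x] by (auto simp: g_def)
  have "(g \<longlongrightarrow> 0) at_top" using i unfolding rearr_infty_iff[OF x] g_def .
  note alim = avg_tendsto_0[OF g this]
  have "((\<lambda>s. phi s * avg g s) \<longlongrightarrow> 0) at_top" if inf: "\<alpha> = \<infinity>"
  proof (rule tendsto_at_topI_sequentially)
    fix S :: "nat \<Rightarrow> real" assume S: "filterlim S at_top sequentially"
    define f where "f = (\<lambda>n t. avg g (S n) * indicator {0<..<S n} t)"
    have "(\<lambda>n. nr (f n)) \<longlonglongrightarrow> 0"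
    proof (rule K_order_cont_D[OF K])
      show "decr \<alpha> (f n)" for n unfolding f_def using inf by (intro decr_const_indicator avg_nonneg) simp
      show "rE (f n)" for n unfolding f_def by (rule rE_scale(1)[OF indicator_rE])
      fix t :: real assume t: "0 < t"
      show "cumul (f n) t \<le> cumul (real_rearr \<alpha> x) t" for n
      proof (cases "0 < S n")
        case True
        have "cumul (f n) t = ennreal (avg g (S n) * min (S n) t)"
          unfolding f_def by (rule cumul_const_indicator[OF avg_nonneg True t])
        also have "\<dots> \<le> cumul g t"
        proof (cases "S n \<le> t")
          case le: True
          have "ennreal (avg g (S n) * min (S n) t) = cumul g (S n)" using cumul_eq_avg[OF g True] le by simp
          then show ?thesis using cumul_mono_right[OF le, of g] by simp
        next
          case False
          then have "avg g (S n) * min (S n) t \<le> avg g t * t"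
            using avg_antimono[OF g t, of "S n"] t by (auto intro!: mult_right_mono)
          then show ?thesis unfolding cumul_eq_avg[OF g t] by (rule ennreal_leI)
        qed
        finally show ?thesis by (simp add: g_def)
      next
        case False
        \<comment> \<open>A sequence tending to infinity may begin with nonpositive terms, for which
          the indicator is empty.\<close>
        then have "f n = (\<lambda>_. 0)" by (auto simp: f_def fun_eq_iff)
        then show ?thesis by (simp add: cumul_def)
      qed
      have lim: "(\<lambda>n. avg g (S n)) \<longlonglongrightarrow> 0" by (rule filterlim_compose[OF alim S])
      show "(\<lambda>n. f n t) \<longlonglongrightarrow> 0"
      proof (rule tendsto_sandwich[OF _ _ tendsto_const lim])
        show "\<forall>\<^sub>F n in sequentially. 0 \<le> f n t" using avg_nonneg by (intro always_eventually allI) (simp add: f_def)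
        show "\<forall>\<^sub>F n in sequentially. f n t \<le> avg g (S n)"
          using avg_nonneg by (intro always_eventually allI) (simp add: f_def indicator_def)
      qed
    qed
    moreover have "nr (f n) = phi (S n) * avg g (S n)" for n
      unfolding f_def rE_scale(2)[OF indicator_rE] using avg_nonneg[of g "S n"] by simp
    ultimately show "(\<lambda>n. phi (S n) * avg g (S n)) \<longlonglongrightarrow> 0" by simp
  qed
  then show ?thesis unfolding fund_vanishes_at_infty_iff[OF x] g_def by blast
qed

text \<open>The Fatou property wants an increasing sequence, so it is applied to the tail infima,
  which lie below \<open>f n\<close> and increase a.e. to the limit.\<close>

lemma fatou_limit_in_E:
  assumes f: "\<And>n. decr \<alpha> (f n)" "\<And>n. rE (f n)" and bd: "\<And>n. nr (f n) \<le> C"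
    and y: "decr \<alpha> y" and lim: "AE t in lborel. 0 < t \<longrightarrow> (\<lambda>n. f n t) \<longlonglongrightarrow> y t"
  shows "rE y"
proof -
  note [measurable] = decr_measurable[OF f(1)]
  define Z where "Z = (\<lambda>n t. INF k\<in>{n..}. ereal (f k t))"
  have f0: "0 \<le> f n t" for n t using decrD(1)[OF f(1)] .
  have Z0: "0 \<le> Z n t" for n t unfolding Z_def using f0 by (intro INF_greatest) simp
  have Zle: "Z n t \<le> ereal (f n t)" for n t unfolding Z_def by (intro INF_lower) simp
  have ZL: "Z n \<in> L0 \<alpha>" for n
    unfolding Z_def by (intro borel_imp_L0 borel_measurable_INF) auto
  have "\<bar>Z n t\<bar> \<le> \<bar>ereal (f n t)\<bar>" for n t using Z0[of n t] Zle[of n t] f0[of n t] by simp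
  then have ZE: "Z n \<in> E \<and> nrm (Z n) \<le> nr (f n)" for n
    by (intro ideal ZL f(2)) simp
  have "\<forall>n. Z n \<in> pos_cone \<alpha> E" using ZE Z0 by (simp add: pos_cone_def)
  moreover have "nrm (Z n) \<le> C" for n using ZE[of n] bd[of n] by simp
  then have "bdd_above (range (\<lambda>n. nrm (Z n)))" by (intro bdd_aboveI2)
  moreover have "AE t in leb \<alpha>. incseq (\<lambda>n. Z n t) \<and> (\<lambda>n. Z n t) \<longlonglongrightarrow> ereal (y t)"
  proof (rule AE_leb_lborel, use lim AE_lborel_singleton[of 0] in eventually_elim)
    case (elim t)
    show ?case
    proof
      assume "t \<in> interval \<alpha>"
      then have t: "0 < t" using elim by (auto simp: interval_def)
      have inc: "incseq (\<lambda>n. Z n t)"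
        unfolding Z_def by (intro incseq_SucI INF_superset_mono) auto
      have "(\<lambda>n. ereal (f n t)) \<longlonglongrightarrow> ereal (y t)" using elim t by (simp add: lim_ereal)
      then have "(SUP n. Z n t) = ereal (y t)"
        unfolding Z_def liminf_SUP_INF[symmetric] by (intro lim_imp_Liminf) auto
      then show "incseq (\<lambda>n. Z n t) \<and> (\<lambda>n. Z n t) \<longlonglongrightarrow> ereal (y t)"
        using inc LIMSEQ_SUP[OF inc] by simp
    qed
  qed
  ultimately show ?thesis
    using fatou[unfolded fatou_property_def, THEN spec, THEN spec, THEN mp, of Z "\<lambda>t. ereal (y t)"]
      ereal_borel_L0[OF decr_measurable[OF y]] by blast
qed

text \<open>The difference is bounded by the sum of two functions submajorized by \<open>x\<close>;
  one half turns the sum into a mean, which is submajorized by \<open>x\<close> again. Pointwise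
  everything lies below x^**, whose level sets have finite measure because x^* vanishes at
  infinity.\<close>

lemma K_order_cont_halved_diff:
  assumes K: "K_order_cont_point \<alpha> E nrm x" and i: "rearr_infty \<alpha> x = 0"
    and f: "\<And>n. decr \<alpha> (f n)" "\<And>n. rE (f n)" and y: "decr \<alpha> y" "rE y"
    and fg: "\<And>n t. 0 < t \<Longrightarrow> cumul (f n) t \<le> cumul (real_rearr \<alpha> x) t"
    and yg: "\<And>t. 0 < t \<Longrightarrow> cumul y t \<le> cumul (real_rearr \<alpha> x) t"
    and lim: "AE t in lborel. 0 < t \<longrightarrow> (\<lambda>n. f n t) \<longlonglongrightarrow> y t"
  shows "\<And>n. rE (\<lambda>t. (1/2) * \<bar>f n t - y t\<bar>)" "(\<lambda>n. nr (\<lambda>t. (1/2) * \<bar>f n t - y t\<bar>)) \<longlonglongrightarrow> 0"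
proof -
  have x: "x \<in> E" using K by (simp add: K_order_cont_point_def)
  define g where "g = real_rearr \<alpha> x"
  have g: "decr \<alpha> g" "rE g" using real_rearr_decr[OF x] real_rearr_rE(1)[OF x] by (auto simp: g_def)
  have glim: "(g \<longlongrightarrow> 0) at_top" using i unfolding rearr_infty_iff[OF x] g_def .
  note [measurable] = decr_measurable[OF f(1)] decr_measurable[OF y(1)] decr_measurable[OF g(1)]
  have f0: "0 \<le> f n t" for n t using decrD(1)[OF f(1)] .
  have y0: "0 \<le> y t" for t using decrD(1)[OF y(1)] .
  let ?z = "\<lambda>n t. (1/2) * \<bar>f n t - y t\<bar>"
  let ?s = "\<lambda>n t. (1/2) * f n t + (1/2) * y t"
  have zs: "\<bar>?z n t\<bar> \<le> \<bar>?s n t\<bar>" for n t using f0[of n t] y0[of t] by (simp add: abs_if)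
  have sE: "rE (?s n)" for n by (intro rE_add(1) rE_scale(1) f y)
  show zE: "rE (?z n)" for n by (rule rE_mono(1)[OF _ sE[of n] zs]) measurable
  let ?X = "\<lambda>n t. ereal (?z n t)"
  have s_decr: "decr \<alpha> (?s n)" for n
    unfolding decr_def using decrD[OF f(1)[of n]] decrD[OF y(1)] by (auto intro!: add_mono)
  have s_maj: "cumul (?s n) t \<le> cumul g t" if "0 < t" for n t
  proof -
    have "cumul (?s n) t = ennreal (1/2) * cumul (f n) t + ennreal (1/2) * cumul y t"
    proof -
      have "cumul (?s n) t = cumul (\<lambda>t. (1/2) * f n t) t + cumul (\<lambda>t. (1/2) * y t) t"
        using f0 y0 by (intro cumul_add) auto
      also have "\<dots> = ennreal (1/2) * cumul (f n) t + ennreal (1/2) * cumul y t"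
        by (intro arg_cong2[where f = "(+)"] cumul_scale decr_measurable[OF f(1)] decr_measurable[OF y(1)]) auto
      finally show ?thesis .
    qed
    also have "\<dots> \<le> ennreal (1/2) * cumul g t + ennreal (1/2) * cumul g t"
      using fg[OF that] yg[OF that] by (intro add_mono mult_left_mono) (auto simp: g_def)
    also have "\<dots> = (ennreal (1/2) + ennreal (1/2)) * cumul g t" by (simp only: distrib_right)
    also have "ennreal (1/2) + ennreal (1/2) = ennreal (1/2 + 1/2)" by (rule ennreal_plus[symmetric]) auto
    finally show ?thesis by simp
  qed
  have "\<forall>n. submaj \<alpha> (?X n) x"
  proof
    fix n
    \<comment> \<open>The halved difference need not be decreasing. Its rearrangement is compared
      with that of the half-sum, which is a.e. its own rearrangement.\<close>
    have "real_rearr \<alpha> (?X n) s \<le> real_rearr \<alpha> (\<lambda>t. ereal (?s n t)) s" if "0 < s" for s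
    proof -
      have "rearr \<alpha> (?X n) s \<le> rearr \<alpha> (\<lambda>t. ereal (?s n t)) s"
        using zs by (intro rearr_mono E_L0 sE always_eventually allI) (simp del: times_divide_eq_left)
      then show ?thesis unfolding real_rearr_eq[OF zE that, symmetric] real_rearr_eq[OF sE that, symmetric] by simp
    qed
    then have "cumul (real_rearr \<alpha> (?X n)) t \<le> cumul (?s n) t" for t
      unfolding cumul_real_rearr_of_decr[OF s_decr, symmetric] by (intro cumul_mono)
    then show "submaj \<alpha> (?X n) x"
      unfolding submaj_iff[OF zE x] using s_maj order_trans unfolding g_def by blast
  qed
  moreover have "(\<lambda>n. rearr \<alpha> (?X n) t) \<longlonglongrightarrow> 0" if t: "0 < t" for t
  proof (rule rearr_tendsto_0[where w = "\<lambda>t. ereal (avg g t)"])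
    \<comment> \<open>For \<open>\<alpha> = 1\<close> averages need not vanish beyond 1, so
      \<open>avg g\<close> is treated as a decreasing function on the whole half-line.\<close>
    have avg_decr: "decr \<infinity> (avg g)"
      unfolding decr_def using avg_nonneg avg_antimono[OF g] by (auto simp: avg_def)
    note [measurable] = decr_measurable[OF avg_decr]
    show "?X n \<in> L0 \<alpha>" for n by (rule E_L0[OF zE])
    show "(\<lambda>t. ereal (avg g t)) \<in> L0 \<alpha>" by (rule ereal_borel_L0) measurable
    show "distr_fun \<alpha> (\<lambda>t. ereal (avg g t)) l < \<infinity>" if l: "0 < l" for l
    proof -
      have "\<forall>\<^sub>F s in at_top. avg g s < l \<and> 0 < s"
        using order_tendstoD(2)[OF avg_tendsto_0[OF g glim] l] eventually_gt_at_top[of 0] by (rule eventually_conj)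
      then obtain s where s: "avg g s < l" "0 < s" using eventually_happens'[OF trivial_limit_at_top_linorder] by blast
      have "{r \<in> interval \<alpha>. ereal l < \<bar>ereal (avg g r)\<bar>} \<subseteq> {0..s} \<inter> interval \<alpha>"
      proof
        fix r assume r: "r \<in> {r \<in> interval \<alpha>. ereal l < \<bar>ereal (avg g r)\<bar>}"
        then have "l < avg g r" "0 \<le> r" using avg_nonneg[of g r] by (auto simp: interval_def)
        moreover have "r < s"
        proof (rule ccontr)
          assume "\<not> r < s"
          then have "avg g r \<le> avg g s" using avg_antimono[OF g s(2)] by simp
          then show False using s(1) \<open>l < avg g r\<close> by simp
        qed
        ultimately show "r \<in> {0..s} \<inter> interval \<alpha>" using r by simp
      qed
      then have "distr_fun \<alpha> (\<lambda>t. ereal (avg g t)) l \<le> emeasure (leb \<alpha>) ({0..s} \<inter> interval \<alpha>)"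
        unfolding distr_fun_def by (rule emeasure_mono) (auto simp: sets_restrict_space_iff)
      also have "\<dots> = emeasure lborel ({0..s} \<inter> interval \<alpha>)" by (intro emeasure_leb) auto
      also have "\<dots> \<le> emeasure lborel {0..s}" by (intro emeasure_mono) auto
      also have "\<dots> < \<infinity>" using s(2) by simp
      finally show ?thesis .
    qed
    show "AE r in leb \<alpha>. \<bar>?X n r\<bar> \<le> \<bar>ereal (avg g r)\<bar>" for n
    proof (rule AE_lebI)
      fix r :: real assume r: "0 < r"
      have "?s n r \<le> avg g r" using le_avg[OF g s_decr r s_maj[OF r]] .
      then show "\<bar>?X n r\<bar> \<le> \<bar>ereal (avg g r)\<bar>" using zs[of n r] f0[of n r] y0[of r] by simp
    qed
    show "AE r in leb \<alpha>. (\<lambda>n. ?X n r) \<longlonglongrightarrow> 0"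
    proof (rule AE_leb_lborel, use lim AE_lborel_singleton[of 0] in eventually_elim)
      case (elim r)
      show ?case
      proof
        assume "r \<in> interval \<alpha>"
        then have "(\<lambda>n. f n r) \<longlonglongrightarrow> y r" using elim by (auto simp: interval_def)
        then have "(\<lambda>n. ?z n r) \<longlonglongrightarrow> (1/2) * \<bar>y r - y r\<bar>" by (intro tendsto_intros)
        then have "(\<lambda>n. ?z n r) \<longlonglongrightarrow> 0" by simp
        then show "(\<lambda>n. ?X n r) \<longlonglongrightarrow> 0" unfolding zero_ereal_def lim_ereal .
      qed
    qed
  qed (rule t)
  then have "AE t in leb \<alpha>. (\<lambda>n. rearr \<alpha> (?X n) t) \<longlonglongrightarrow> 0" by (intro AE_lebI)
  ultimately show "(\<lambda>n. nr (?z n)) \<longlonglongrightarrow> 0"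
    using K zE unfolding K_order_cont_point_def by (elim conjE allE[of _ ?X]) blast
qed

lemma LKM_K_order_cont_subsequence:
  assumes L: "LKM_point \<alpha> E nrm x" and K: "K_order_cont_point \<alpha> E nrm x" and i: "rearr_infty \<alpha> x = 0"
    and X: "\<And>n. X n \<in> E" "\<And>n. submaj \<alpha> (X n) x" and nl: "(\<lambda>n. nrm (X n)) \<longlonglongrightarrow> nrm x"
  shows "\<exists>r. strict_mono r \<and> (\<lambda>n. nrm (\<lambda>t. rearr \<alpha> x t - rearr \<alpha> (X (r n)) t)) \<longlonglongrightarrow> 0"
proof -
  have x: "x \<in> E" using K by (simp add: K_order_cont_point_def)
  define g where "g = real_rearr \<alpha> x"
  have g: "decr \<alpha> g" "rE g" using real_rearr_decr[OF x] real_rearr_rE(1)[OF x] by (auto simp: g_def)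
  define f where "f = (\<lambda>n. real_rearr \<alpha> (X n))"
  have f: "decr \<alpha> (f n)" "rE (f n)" "nr (f n) = nrm (X n)" for n
    using real_rearr_decr[OF X(1)] real_rearr_rE[OF X(1)] by (auto simp: f_def)
  have maj: "cumul (f n) t \<le> cumul g t" if "0 < t" for n t
    using X(2)[of n] that unfolding submaj_iff[OF X(1) x] f_def g_def by blast
  have "\<exists>r y. strict_mono r \<and> decr \<alpha> y \<and> (AE t in lborel. 0 < t \<longrightarrow> (\<lambda>n. f (r n) t) \<longlonglongrightarrow> y t)"
  proof (rule helly_decr[OF f(1)])
    show "(f n \<longlongrightarrow> f n t) (at_right t)" if "0 < t" for n t
      unfolding f_def by (rule real_rearr_right_continuous[OF X(1) that])
    show "f n t \<le> avg g t" if "0 < t" for n t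
      by (rule le_avg[OF g f(1) that maj[OF that]])
  qed
  then obtain r y where r: "strict_mono r" and y: "decr \<alpha> y"
    and lim: "AE t in lborel. 0 < t \<longrightarrow> (\<lambda>n. f (r n) t) \<longlonglongrightarrow> y t" by blast
  have yE: "rE y"
  proof (rule fatou_limit_in_E[OF f(1,2) _ y lim])
    show "nr (f (r n)) \<le> nrm x" for n unfolding f(3) by (rule submaj_nrm_le[OF x X])
  qed
  have ymaj: "cumul y t \<le> cumul g t" if "0 < t" for t
    by (rule cumul_le_of_AE_tendsto[OF decr_measurable[OF f(1)] lim maj[OF that]])
  define z where "z = (\<lambda>n t. (1/2) * \<bar>f (r n) t - y t\<bar>)"
  have z: "rE (z n)" "(\<lambda>n. nr (z n)) \<longlonglongrightarrow> 0" for n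
    unfolding z_def
    using K_order_cont_halved_diff[OF K i f(1,2) y yE maj[unfolded g_def] ymaj[unfolded g_def] lim] by auto
  have z2: "rE (\<lambda>t. 2 * z n t)" "nr (\<lambda>t. 2 * z n t) = 2 * nr (z n)" for n
    using rE_scale[OF z(1), of 2] by auto
  have z2lim: "(\<lambda>n. nr (\<lambda>t. 2 * z n t)) \<longlonglongrightarrow> 0"
    unfolding z2(2) using tendsto_mult_left[OF z(2), of 2] by simp
  have "nrm x \<le> nr y"
  proof -
    have "nr (f (r n)) \<le> nr y + nr (\<lambda>t. 2 * z n t)" for n
    proof -
      have "nr (f (r n)) \<le> nr (\<lambda>t. y t + 2 * z n t)"
      proof (rule rE_mono(2)[OF decr_measurable[OF f(1)] rE_add(1)[OF yE z2(1)]])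
        show "\<bar>f (r n) t\<bar> \<le> \<bar>y t + 2 * z n t\<bar>" for t
          using decrD(1)[OF f(1)[of "r n"], of t] decrD(1)[OF y, of t] by (simp add: z_def abs_if)
      qed
      also have "\<dots> \<le> nr y + nr (\<lambda>t. 2 * z n t)" by (rule rE_add(2)[OF yE z2(1)])
      finally show ?thesis .
    qed
    moreover have "(\<lambda>n. nr (f (r n))) \<longlonglongrightarrow> nrm x"
      unfolding f(3) using LIMSEQ_subseq_LIMSEQ[OF nl r] by (simp add: o_def)
    moreover have "(\<lambda>n. nr y + nr (\<lambda>t. 2 * z n t)) \<longlonglongrightarrow> nr y + 0"
      by (intro tendsto_add tendsto_const z2lim)
    ultimately show ?thesis using LIMSEQ_le by fastforce
  qed
  moreover have "submaj \<alpha> (\<lambda>t. ereal (y t)) x"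
    unfolding submaj_iff[OF yE x] cumul_real_rearr_of_decr[OF y] using ymaj by (simp add: g_def)
  ultimately have "rearr \<alpha> x = rearr \<alpha> (\<lambda>t. ereal (y t))"
    using L yE unfolding LKM_point_def by (metis not_le)
  then have gy: "AE t in lborel. 0 < t \<longrightarrow> g t = y t"
    using real_rearr_of_decr[OF y] unfolding g_def real_rearr_def[abs_def] by simp
  have "nrm (\<lambda>t. rearr \<alpha> x t - rearr \<alpha> (X (r n)) t) \<le> nr (\<lambda>t. 2 * z n t)" for n
  proof -
    have "AE t in leb \<alpha>. \<bar>ereal (g t - f (r n) t)\<bar> \<le> \<bar>ereal (2 * z n t)\<bar>"
      by (rule AE_leb_lborel, use gy AE_lborel_singleton[of 0] in eventually_elim)
        (auto simp: interval_def z_def abs_minus_commute)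
    moreover have "(\<lambda>t. ereal (g t - f (r n) t)) \<in> L0 \<alpha>"
      by (intro ereal_borel_L0 borel_measurable_diff decr_measurable[OF g(1)] decr_measurable[OF f(1)])
    ultimately have "nr (\<lambda>t. g t - f (r n) t) \<le> nr (\<lambda>t. 2 * z n t)"
      using ideal[OF _ z2(1)] by blast
    then show ?thesis unfolding rearr_diff(2)[OF x X(1)] g_def f_def .
  qed
  then have "(\<lambda>n. nrm (\<lambda>t. rearr \<alpha> x t - rearr \<alpha> (X (r n)) t)) \<longlonglongrightarrow> 0"
    using nrm_nonneg[OF rearr_diff(1)[OF x X(1)]]
    by (intro tendsto_sandwich[OF _ _ tendsto_const z2lim]) (auto intro: always_eventually)
  then show ?thesis using r by blast
qed

text \<open>Subsequence principle: if the norms of the differences stayed at least \<open>e\<close>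
  along infinitely many indices, the enumeration of these indices would have a further subsequence
  along which they tend to 0.\<close>

lemma LKM_K_order_cont_imp_LLUKM:
  assumes L: "LKM_point \<alpha> E nrm x" and K: "K_order_cont_point \<alpha> E nrm x" and i: "rearr_infty \<alpha> x = 0"
  shows "LLUKM_point \<alpha> E nrm x"
proof -
  have x: "x \<in> E" using K by (simp add: K_order_cont_point_def)
  have "(\<lambda>n. nrm (\<lambda>t. rearr \<alpha> x t - rearr \<alpha> (X n) t)) \<longlonglongrightarrow> 0"
    if X: "\<And>n. X n \<in> E" "\<And>n. submaj \<alpha> (X n) x" and nl: "(\<lambda>n. nrm (X n)) \<longlonglongrightarrow> nrm x" for X
  proof (rule ccontr)
    let ?D = "\<lambda>n. nrm (\<lambda>t. rearr \<alpha> x t - rearr \<alpha> (X n) t)"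
    assume "\<not> ?D \<longlonglongrightarrow> 0"
    then obtain e where e: "0 < e" "\<And>N. \<exists>n\<ge>N. e \<le> \<bar>?D n\<bar>"
      unfolding lim_sequentially by (auto simp: dist_real_def not_less)
    define S where "S = {n. e \<le> \<bar>?D n\<bar>}"
    have inf: "infinite S" unfolding infinite_nat_iff_unbounded_le S_def using e(2) by auto
    have s: "strict_mono (enumerate S)" using strict_mono_enumerate[OF inf] .
    have "(\<lambda>n. nrm (X (enumerate S n))) \<longlonglongrightarrow> nrm x"
      using LIMSEQ_subseq_LIMSEQ[OF nl s] by (simp add: o_def)
    then obtain r where r: "(\<lambda>n. ?D (enumerate S (r n))) \<longlonglongrightarrow> 0"
      using LKM_K_order_cont_subsequence[OF L K i, of "\<lambda>n. X (enumerate S n)"] X by auto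
    have "\<forall>\<^sub>F n in sequentially. \<bar>?D (enumerate S (r n))\<bar> < e"
      using order_tendstoD(2)[OF tendsto_rabs_zero[OF r] e(1)] .
    then obtain n where "\<bar>?D (enumerate S (r n))\<bar> < e"
      using eventually_happens'[OF trivial_limit_sequentially] by blast
    moreover have "enumerate S (r n) \<in> S" using enumerate_in_set[OF inf] .
    ultimately show False by (simp add: S_def)
  qed
  then show ?thesis using x by (auto simp: LLUKM_point_def)
qed

end

theorem theorem3p18:
  fixes \<alpha> :: ereal
    and E :: "(real \<Rightarrow> ereal) set"
    and nrm :: "(real \<Rightarrow> ereal) \<Rightarrow> real"
    and x :: "real \<Rightarrow> ereal"
  assumes "\<alpha> = 1 \<or> \<alpha> = \<infinity>"
    and "symmetric_space \<alpha> E nrm"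
    and "fatou_property \<alpha> E nrm"
    and "x \<in> E"
  shows "(LLUKM_point \<alpha> E nrm x \<and> fund_vanishes_at_zero \<alpha> nrm x
            \<and> fund_vanishes_at_infty \<alpha> nrm x
          \<longleftrightarrow>
          LKM_point \<alpha> E nrm x \<and> order_cont_point \<alpha> E nrm x
            \<and> fund_vanishes_at_infty \<alpha> nrm x)
       \<and> (LKM_point \<alpha> E nrm x \<and> order_cont_point \<alpha> E nrm x
            \<and> fund_vanishes_at_infty \<alpha> nrm x
          \<longleftrightarrow>
          LKM_point \<alpha> E nrm x \<and> K_order_cont_point \<alpha> E nrm x
            \<and> rearr_infty \<alpha> x = 0)"
proof -
  interpret fatou_symmetric_space \<alpha> E nrm
    using assms by (intro fatou_symmetric_space.intro fatou_symmetric_space_axioms.intro)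
  show ?thesis
    using LLUKM_imp_LKM[of x] LLUKM_imp_order_cont[of x] order_cont_imp_K_order_cont[of x]
      fund_vanishes_at_infty_imp_tendsto[OF \<open>x \<in> E\<close>] rearr_infty_iff[OF \<open>x \<in> E\<close>]
      K_order_cont_imp_vanishes_at_zero[of x] K_order_cont_imp_vanishes_at_infty[of x]
      LKM_K_order_cont_imp_LLUKM[of x]
    by blast
qed

end
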